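(* Let $M$ be an ortho-toric Kähler surface with Kähler structure $$g=(\xi-\eta)\Bigl(\frac{d\xi^2}{F(\xi)}-\frac{d\eta^2}{G(\eta)}\Bigr)+\frac{1}{\xi-\eta}\bigl(F(\xi)(dt+\eta\,dz)^2-G(\eta)(dt+\xi\,dz)^2\bigr),$$ $$\omega=d\xi\wedge(dt+\eta\,dz)+d\eta\wedge(dt+\xi\,dz),$$ where $F,G$ are functions of one variable. Then $M$ is extremal if and only if $F$ and $G$ are of the form $$F(x)=kx^4+\ell x^3+Ax^2+B_1x+C_1,\qquad G(x)=kx^4+\ell x^3+Ax^2+B_2x+C_2,$$ with $k,\ell,A,B_1,B_2,C_1,C_2$ constants, in which case $$s=-2k(\xi+\eta)-\ell,$$ and $(\bar g=(\xi-\eta)^{-2}g,I)$ is an extremal Kähler metric as well. Moreover, $M$ is - Bach-flat if and only if $4k(C_1-C_2)=(B_1-B_2)\ell$; - of constant scalar curvature if and only if $k=0$; - scalar-flat (i.e., anti-selfdual) if and only if $k=\ell=0$.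
   Context: A Kähler surface $(M,g,J,\omega)$ is an oriented Riemannian $4$-manifold with a $g$-orthogonal complex structure $J$ inducing the given orientation and satisfying $\nabla J=0$; $\omega(\cdot,\cdot)=g(J\cdot,\cdot)$. $J$ acts on $1$-forms by $(J\alpha)(X)=-\alpha(JX)$. A Kähler surface is ortho-toric if it admits two independent hamiltonian Killing vector fields with Poisson-commuting momentum maps $\xi\eta$ and $\xi+\eta$ such that $d\xi\perp d\eta$; every such surface is of the displayed form (with $t,z$ locally defined up to additive constants), with $Jd\xi=\frac{F(\xi)}{\xi-\eta}(dt+\eta\,dz)$ and $Jd\eta=\frac{G(\eta)}{\eta-\xi}(dt+\xi\,dz)$. $M$ is connected. $I$ is the orthogonal almost complex structure, inducing the opposite orientation to $J$, with $Id\xi=Jd\xi$, $Id\eta=-Jd\eta$, i.e. with fundamental form $\omega_I=d\xi\wedge(dt+\eta\,dz)-d\eta\wedge(dt+\xi\,dz)$. $s=\frac16\mathrm{Scal}$ is the normalized scalar curvature. A Kähler metric is extremal if $J\,\mathrm{grad}_gs$ is Killing (equivalently $\mathrm{grad}_gs$ is holomorphic). Bach-flat means that the Bach tensor of $g$ vanishes, where $B_{X,Y}=\sum_i\bigl(-(\nabla_{e_i}C)_{e_i,X}(Y)+(W_{e_i,X}h(e_i),Y)\bigr)$ for an orthonormal frame $e_i$, $h=\frac12\mathrm{Ric}_0+\frac1{24}\mathrm{Scal}\,g$, $C_{X,Y}(Z)=-(\nabla_Xh)(Y,Z)+(\nabla_Yh)(X,Z)$ and $W$ the Weyl tensor. Anti-selfdual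 means $W^+=0$. *)

theory Defs
  imports "HOL-Analysis.Analysis"
begin

type_synonym scalar = "real^4 \<Rightarrow> real"
type_synonym vfield = "real^4 \<Rightarrow> real^4"
type_synonym matfield = "real^4 \<Rightarrow> real^4^4"

definition partial :: "4 \<Rightarrow> scalar \<Rightarrow> scalar" where
  "partial i f x = deriv (\<lambda>h. f (x + h *\<^sub>R axis i 1)) 0"

definition smooth_on :: "(real^4) set \<Rightarrow> scalar \<Rightarrow> bool" where
  "smooth_on U f \<longleftrightarrow> (\<forall>is. \<forall>x\<in>U. (foldr partial is f) differentiable (at x))"

definition smooth_real_on :: "real set \<Rightarrow> (real \<Rightarrow> real) \<Rightarrow> bool" where
  "smooth_real_on S f \<longleftrightarrow> (\<forall>n. \<forall>x\<in>S. ((deriv ^^ n) f) differentiable (at x))"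

definition differential :: "scalar \<Rightarrow> vfield" where
  "differential f x = (\<chi> j. partial j f x)"

text \<open>A chart is a pair of a domain and a coordinate map on it. The smooth structure of a
  manifold is given by an atlas (not necessarily maximal).\<close>

type_synonym 'a chart = "'a set \<times> ('a \<Rightarrow> real^4)"

abbreviation cdom :: "'a chart \<Rightarrow> 'a set" where "cdom c \<equiv> fst c"
abbreviation cmap :: "'a chart \<Rightarrow> 'a \<Rightarrow> real^4" where "cmap c \<equiv> snd c"
abbreviation cimg :: "'a chart \<Rightarrow> (real^4) set" where "cimg c \<equiv> snd c ` fst c"

definition cinv :: "'a chart \<Rightarrow> real^4 \<Rightarrow> 'a" where
  "cinv c = the_inv_into (cdom c) (cmap c)"

definition transition :: "'a chart \<Rightarrow> 'a chart \<Rightarrow> real^4 \<Rightarrow> real^4" where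
  "transition c d x = cmap d (cinv c x)"

definition overlap :: "'a chart \<Rightarrow> 'a chart \<Rightarrow> (real^4) set" where
  "overlap c d = cmap c ` (cdom c \<inter> cdom d)"

definition smooth_atlas :: "'a topology \<Rightarrow> 'a chart set \<Rightarrow> bool" where
  "smooth_atlas X \<A> \<longleftrightarrow>
     (\<forall>c\<in>\<A>. openin X (cdom c) \<and> open (cimg c) \<and>
        homeomorphic_map (subtopology X (cdom c)) (top_of_set (cimg c)) (cmap c)) \<and>
     (\<Union>c\<in>\<A>. cdom c) = topspace X \<and>
     (\<forall>c\<in>\<A>. \<forall>d\<in>\<A>. \<forall>i. smooth_on (overlap c d) (\<lambda>x. transition c d x $ i))"

definition smooth_manifold :: "'a topology \<Rightarrow> 'a chart set \<Rightarrow> bool" where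
  "smooth_manifold X \<A> \<longleftrightarrow> Hausdorff_space X \<and> second_countable X \<and> smooth_atlas X \<A>"

definition in_chart :: "('a \<Rightarrow> real) \<Rightarrow> 'a chart \<Rightarrow> scalar" where
  "in_chart f c x = f (cinv c x)"

definition smooth_function :: "'a chart set \<Rightarrow> ('a \<Rightarrow> real) \<Rightarrow> bool" where
  "smooth_function \<A> f \<longleftrightarrow> (\<forall>c\<in>\<A>. smooth_on (cimg c) (in_chart f c))"

text \<open>A tensor field of rank two is given by its matrix of components in each chart, subject to the
  transformation law. The components of a bilinear form are \<open>B i j = B(\<partial>\<^sub>i, \<partial>\<^sub>j)\<close>; an endomorphism
  \<open>J\<close> acts on column vectors, i.e. \<open>J \<partial>\<^sub>j = \<Sum>\<^sub>i J i j \<partial>\<^sub>i\<close>.\<close>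

definition bilinear_field :: "'a chart set \<Rightarrow> ('a chart \<Rightarrow> matfield) \<Rightarrow> bool" where
  "bilinear_field \<A> B \<longleftrightarrow>
     (\<forall>c\<in>\<A>. \<forall>i j. smooth_on (cimg c) (\<lambda>x. B c x $ i $ j)) \<and>
     (\<forall>c\<in>\<A>. \<forall>d\<in>\<A>. \<forall>x\<in>overlap c d.
        let D = jacobian (transition c d) (at x)
        in B c x = transpose D ** B d (transition c d x) ** D)"

definition endo_field :: "'a chart set \<Rightarrow> ('a chart \<Rightarrow> matfield) \<Rightarrow> bool" where
  "endo_field \<A> J \<longleftrightarrow>
     (\<forall>c\<in>\<A>. \<forall>i j. smooth_on (cimg c) (\<lambda>x. J c x $ i $ j)) \<and>
     (\<forall>c\<in>\<A>. \<forall>d\<in>\<A>. \<forall>x\<in>overlap c d.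
        let D = jacobian (transition c d) (at x)
        in D ** J c x = J d (transition c d x) ** D)"

text \<open>An orientation assigns to each chart the sign of its coordinate frame.\<close>

definition orientation :: "'a chart set \<Rightarrow> ('a chart \<Rightarrow> scalar) \<Rightarrow> bool" where
  "orientation \<A> \<sigma> \<longleftrightarrow>
     (\<forall>c\<in>\<A>. continuous_on (cimg c) (\<sigma> c) \<and> (\<forall>x\<in>cimg c. \<sigma> c x = 1 \<or> \<sigma> c x = -1)) \<and>
     (\<forall>c\<in>\<A>. \<forall>d\<in>\<A>. \<forall>x\<in>overlap c d.
        \<sigma> c x = sgn (det (jacobian (transition c d) (at x))) * \<sigma> d (transition c d x))"

definition riemannian_metric :: "'a chart set \<Rightarrow> ('a chart \<Rightarrow> matfield) \<Rightarrow> bool" where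
  "riemannian_metric \<A> g \<longleftrightarrow> bilinear_field \<A> g \<and>
     (\<forall>c\<in>\<A>. \<forall>x\<in>cimg c. transpose (g c x) = g c x \<and> (\<forall>v. v \<noteq> 0 \<longrightarrow> v \<bullet> (g c x *v v) > 0))"

definition almost_complex_structure :: "'a chart set \<Rightarrow> ('a chart \<Rightarrow> matfield) \<Rightarrow> bool" where
  "almost_complex_structure \<A> J \<longleftrightarrow> endo_field \<A> J \<and>
     (\<forall>c\<in>\<A>. \<forall>x\<in>cimg c. J c x ** J c x = - mat 1)"

definition orthogonal_structure ::
  "'a chart set \<Rightarrow> ('a chart \<Rightarrow> matfield) \<Rightarrow> ('a chart \<Rightarrow> matfield) \<Rightarrow> bool" where
  "orthogonal_structure \<A> g J \<longleftrightarrow>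
     (\<forall>c\<in>\<A>. \<forall>x\<in>cimg c. transpose (J c x) ** g c x ** J c x = g c x)"

definition induces_orientation ::
  "'a chart set \<Rightarrow> ('a chart \<Rightarrow> scalar) \<Rightarrow> ('a chart \<Rightarrow> matfield) \<Rightarrow> bool" where
  "induces_orientation \<A> \<sigma> J \<longleftrightarrow>
     (\<forall>c\<in>\<A>. \<forall>x\<in>cimg c. \<forall>u v.
        let d = det (vector [u, J c x *v u, v, J c x *v v] :: real^4^4)
        in d \<noteq> 0 \<longrightarrow> sgn d = \<sigma> c x)"

definition fundamental_form :: "matfield \<Rightarrow> matfield \<Rightarrow> matfield" where
  "fundamental_form g J x = (\<chi> i j. (J x *v axis i 1) \<bullet> (g x *v axis j 1))"

definition act_form :: "real^4^4 \<Rightarrow> real^4 \<Rightarrow> real^4" where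
  "act_form J \<alpha> = - (\<alpha> v* J)"

definition christoffel :: "matfield \<Rightarrow> 4 \<Rightarrow> 4 \<Rightarrow> 4 \<Rightarrow> scalar" where
  "christoffel g k i j x = (1/2) * (\<Sum>l\<in>UNIV. matrix_inv (g x) $ k $ l *
     (partial i (\<lambda>y. g y $ j $ l) x + partial j (\<lambda>y. g y $ i $ l) x - partial l (\<lambda>y. g y $ i $ j) x))"

text \<open>The \<open>l\<close>-th component of \<open>R\<^bsub>\<partial>i,\<partial>j\<^esub> \<partial>k\<close>, with the sign convention
  \<open>R\<^bsub>X,Y\<^esub> = \<nabla>\<^bsub>[X,Y]\<^esub> - [\<nabla>\<^bsub>X\<^esub>, \<nabla>\<^bsub>Y\<^esub>]\<close>, so that \<open>g(R\<^bsub>X,Y\<^esub> X, Y) > 0\<close> on the round sphere.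
  The relative sign of the two terms of the Bach tensor depends on this choice: it makes that
  tensor, up to a constant, the gradient of the squared \<open>L\<^sup>2\<close>-norm of the Weyl tensor.\<close>

definition curvature :: "matfield \<Rightarrow> 4 \<Rightarrow> 4 \<Rightarrow> 4 \<Rightarrow> 4 \<Rightarrow> scalar" where
  "curvature g i j k l x =
     partial j (christoffel g l i k) x - partial i (christoffel g l j k) x +
     (\<Sum>m\<in>UNIV. christoffel g l j m x * christoffel g m i k x
              - christoffel g l i m x * christoffel g m j k x)"

definition ricci :: "matfield \<Rightarrow> 4 \<Rightarrow> 4 \<Rightarrow> scalar" where
  "ricci g j k x = (\<Sum>i\<in>UNIV. curvature g j i k i x)"

definition Scal :: "matfield \<Rightarrow> scalar" where
  "Scal g x = (\<Sum>i\<in>UNIV. \<Sum>j\<in>UNIV. matrix_inv (g x) $ i $ j * ricci g i j x)"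

definition nscal :: "matfield \<Rightarrow> scalar" where
  "nscal g x = Scal g x / 6"

definition ricci0 :: "matfield \<Rightarrow> 4 \<Rightarrow> 4 \<Rightarrow> scalar" where
  "ricci0 g i j x = ricci g i j x - Scal g x / 4 * g x $ i $ j"

definition hricci :: "matfield \<Rightarrow> 4 \<Rightarrow> 4 \<Rightarrow> scalar" where
  "hricci g i j x = (1/2) * ricci0 g i j x + (1/24) * Scal g x * g x $ i $ j"

text \<open>\<open>weyl g i j k l = g(W\<^bsub>\<partial>i,\<partial>j\<^esub> \<partial>k, \<partial>l)\<close>, from the decomposition of the curvature into the Weyl
  tensor and the Kulkarni--Nomizu product of \<open>h\<close> and \<open>g\<close>.\<close>

definition weyl :: "matfield \<Rightarrow> 4 \<Rightarrow> 4 \<Rightarrow> 4 \<Rightarrow> 4 \<Rightarrow> scalar" where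
  "weyl g i j k l x =
     (\<Sum>m\<in>UNIV. curvature g i j k m x * g x $ m $ l)
     - (hricci g i k x * g x $ j $ l + hricci g j l x * g x $ i $ k
        - hricci g i l x * g x $ j $ k - hricci g j k x * g x $ i $ l)"

definition nabla_hricci :: "matfield \<Rightarrow> 4 \<Rightarrow> 4 \<Rightarrow> 4 \<Rightarrow> scalar" where
  "nabla_hricci g k i j x = partial k (hricci g i j) x
     - (\<Sum>l\<in>UNIV. christoffel g l k i x * hricci g l j x + christoffel g l k j x * hricci g i l x)"

definition cotton :: "matfield \<Rightarrow> 4 \<Rightarrow> 4 \<Rightarrow> 4 \<Rightarrow> scalar" where
  "cotton g i j k x = - nabla_hricci g i j k x + nabla_hricci g j i k x"

definition nabla_cotton :: "matfield \<Rightarrow> 4 \<Rightarrow> 4 \<Rightarrow> 4 \<Rightarrow> 4 \<Rightarrow> scalar" where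
  "nabla_cotton g m i j k x = partial m (cotton g i j k) x
     - (\<Sum>l\<in>UNIV. christoffel g l m i x * cotton g l j k x + christoffel g l m j x * cotton g i l k x
                + christoffel g l m k x * cotton g i j l x)"

text \<open>The sum over an orthonormal frame is the contraction with the inverse metric; the
  inner sum over \<open>p, q\<close> applies the Weyl tensor to the vector \<open>h(\<partial>l)\<close>.\<close>

definition bach :: "matfield \<Rightarrow> 4 \<Rightarrow> 4 \<Rightarrow> scalar" where
  "bach g i j x = (\<Sum>m\<in>UNIV. \<Sum>l\<in>UNIV. matrix_inv (g x) $ m $ l *
     (- nabla_cotton g m l i j x
      + (\<Sum>p\<in>UNIV. \<Sum>q\<in>UNIV. hricci g l q x * matrix_inv (g x) $ q $ p * weyl g m i p j x)))"

definition vol_form :: "matfield \<Rightarrow> scalar \<Rightarrow> 4 \<Rightarrow> 4 \<Rightarrow> 4 \<Rightarrow> 4 \<Rightarrow> scalar" where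
  "vol_form g \<sigma> i j k l x = \<sigma> x * sqrt (det (g x)) *
     det (vector [axis i 1, axis j 1, axis k 1, axis l 1] :: real^4^4)"

definition hodge :: "matfield \<Rightarrow> scalar \<Rightarrow> (4 \<Rightarrow> 4 \<Rightarrow> scalar) \<Rightarrow> 4 \<Rightarrow> 4 \<Rightarrow> scalar" where
  "hodge g \<sigma> \<alpha> i j x = (1/2) * (\<Sum>p\<in>UNIV. \<Sum>q\<in>UNIV.
     (\<Sum>a\<in>UNIV. \<Sum>b\<in>UNIV. matrix_inv (g x) $ p $ a * matrix_inv (g x) $ q $ b * \<alpha> a b x)
     * vol_form g \<sigma> p q i j x)"

definition weyl_plus :: "matfield \<Rightarrow> scalar \<Rightarrow> 4 \<Rightarrow> 4 \<Rightarrow> 4 \<Rightarrow> 4 \<Rightarrow> scalar" where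
  "weyl_plus g \<sigma> i j k l x =
     (1/2) * (weyl g i j k l x + hodge g \<sigma> (\<lambda>a b. weyl g a b k l) i j x)"

definition gradient :: "matfield \<Rightarrow> scalar \<Rightarrow> vfield" where
  "gradient g f x = matrix_inv (g x) *v differential f x"

definition lie_metric :: "vfield \<Rightarrow> matfield \<Rightarrow> 4 \<Rightarrow> 4 \<Rightarrow> scalar" where
  "lie_metric K g i j x = (\<Sum>k\<in>UNIV. K x $ k * partial k (\<lambda>y. g y $ i $ j) x
     + g x $ k $ j * partial i (\<lambda>y. K y $ k) x + g x $ i $ k * partial j (\<lambda>y. K y $ k) x)"

definition nabla_endo :: "matfield \<Rightarrow> matfield \<Rightarrow> 4 \<Rightarrow> 4 \<Rightarrow> 4 \<Rightarrow> scalar" where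
  "nabla_endo g J k i j x = partial k (\<lambda>y. J y $ i $ j) x
     + (\<Sum>l\<in>UNIV. christoffel g i k l x * J x $ l $ j - christoffel g l k j x * J x $ i $ l)"

definition nijenhuis :: "matfield \<Rightarrow> 4 \<Rightarrow> 4 \<Rightarrow> 4 \<Rightarrow> scalar" where
  "nijenhuis J i j k x = (\<Sum>l\<in>UNIV.
       J x $ l $ i * partial l (\<lambda>y. J y $ k $ j) x - J x $ l $ j * partial l (\<lambda>y. J y $ k $ i) x
     - J x $ k $ l * (partial i (\<lambda>y. J y $ l $ j) x - partial j (\<lambda>y. J y $ l $ i) x))"

definition kaehler_surface ::
  "'a chart set \<Rightarrow> ('a chart \<Rightarrow> scalar) \<Rightarrow> ('a chart \<Rightarrow> matfield) \<Rightarrow> ('a chart \<Rightarrow> matfield) \<Rightarrow> bool" where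
  "kaehler_surface \<A> \<sigma> g J \<longleftrightarrow>
     orientation \<A> \<sigma> \<and> riemannian_metric \<A> g \<and>
     almost_complex_structure \<A> J \<and>
     (\<forall>c\<in>\<A>. \<forall>x\<in>cimg c. \<forall>i j k. nijenhuis (J c) i j k x = 0) \<and>
     orthogonal_structure \<A> g J \<and> induces_orientation \<A> \<sigma> J \<and>
     (\<forall>c\<in>\<A>. \<forall>x\<in>cimg c. \<forall>i j k. nabla_endo (g c) (J c) k i j x = 0)"

definition killing :: "'a chart set \<Rightarrow> ('a chart \<Rightarrow> matfield) \<Rightarrow> ('a chart \<Rightarrow> vfield) \<Rightarrow> bool" where
  "killing \<A> g K \<longleftrightarrow> (\<forall>c\<in>\<A>. \<forall>x\<in>cimg c. \<forall>i j. lie_metric (K c) (g c) i j x = 0)"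

text \<open>The hamiltonian vector field \<open>J grad f\<close>, whose momentum map is \<open>f\<close>:
  its contraction with the Kaehler form is \<open>-df\<close>.\<close>

definition ham_field :: "matfield \<Rightarrow> matfield \<Rightarrow> scalar \<Rightarrow> vfield" where
  "ham_field g J f x = J x *v gradient g f x"

definition poisson :: "matfield \<Rightarrow> matfield \<Rightarrow> scalar \<Rightarrow> scalar \<Rightarrow> scalar" where
  "poisson g J f h x = ham_field g J f x \<bullet> (fundamental_form g J x *v ham_field g J h x)"

definition ortho_toric ::
  "'a topology \<Rightarrow> 'a chart set \<Rightarrow> ('a chart \<Rightarrow> matfield) \<Rightarrow> ('a chart \<Rightarrow> matfield) \<Rightarrow>
   ('a \<Rightarrow> real) \<Rightarrow> ('a \<Rightarrow> real) \<Rightarrow> bool" where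
  "ortho_toric X \<A> g J \<xi> \<eta> \<longleftrightarrow>
     (let f\<^sub>1 = in_chart (\<lambda>p. \<xi> p * \<eta> p); f\<^sub>2 = in_chart (\<lambda>p. \<xi> p + \<eta> p);
          K\<^sub>1 = (\<lambda>c. ham_field (g c) (J c) (f\<^sub>1 c)); K\<^sub>2 = (\<lambda>c. ham_field (g c) (J c) (f\<^sub>2 c))
      in smooth_function \<A> \<xi> \<and> smooth_function \<A> \<eta> \<and>
         killing \<A> g K\<^sub>1 \<and> killing \<A> g K\<^sub>2 \<and>
         X closure_of {p. \<exists>c\<in>\<A>. p \<in> cdom c \<and>
            (\<forall>a b. a *\<^sub>R K\<^sub>1 c (cmap c p) + b *\<^sub>R K\<^sub>2 c (cmap c p) = 0 \<longrightarrow> a = 0 \<and> b = 0)} = topspace X \<and>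
         (\<forall>c\<in>\<A>. \<forall>x\<in>cimg c. poisson (g c) (J c) (f\<^sub>1 c) (f\<^sub>2 c) x = 0) \<and>
         (\<forall>c\<in>\<A>. \<forall>x\<in>cimg c.
            differential (in_chart \<xi> c) x \<bullet> gradient (g c) (in_chart \<eta> c) x = 0))"

definition extremal :: "'a chart set \<Rightarrow> ('a chart \<Rightarrow> matfield) \<Rightarrow> ('a chart \<Rightarrow> matfield) \<Rightarrow> bool" where
  "extremal \<A> g J \<longleftrightarrow> killing \<A> g (\<lambda>c. ham_field (g c) (J c) (nscal (g c)))"

definition bach_flat :: "'a chart set \<Rightarrow> ('a chart \<Rightarrow> matfield) \<Rightarrow> bool" where
  "bach_flat \<A> g \<longleftrightarrow> (\<forall>c\<in>\<A>. \<forall>x\<in>cimg c. \<forall>i j. bach (g c) i j x = 0)"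

definition constant_scalar_curvature :: "'a chart set \<Rightarrow> ('a chart \<Rightarrow> matfield) \<Rightarrow> bool" where
  "constant_scalar_curvature \<A> g \<longleftrightarrow> (\<exists>\<kappa>. \<forall>c\<in>\<A>. \<forall>x\<in>cimg c. Scal (g c) x = \<kappa>)"

definition scalar_flat :: "'a chart set \<Rightarrow> ('a chart \<Rightarrow> matfield) \<Rightarrow> bool" where
  "scalar_flat \<A> g \<longleftrightarrow> (\<forall>c\<in>\<A>. \<forall>x\<in>cimg c. Scal (g c) x = 0)"

definition anti_selfdual ::
  "'a chart set \<Rightarrow> ('a chart \<Rightarrow> scalar) \<Rightarrow> ('a chart \<Rightarrow> matfield) \<Rightarrow> bool" where
  "anti_selfdual \<A> \<sigma> g \<longleftrightarrow>
     (\<forall>c\<in>\<A>. \<forall>x\<in>cimg c. \<forall>i j k l. weyl_plus (g c) (\<sigma> c) i j k l x = 0)"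

text \<open>Components are with respect to the coordinates \<open>(\<xi>, \<eta>, t, z)\<close>, in this order.\<close>

definition tensor_sq :: "real^4 \<Rightarrow> real^4^4" where
  "tensor_sq \<alpha> = (\<chi> i j. \<alpha> $ i * \<alpha> $ j)"

definition wedge :: "real^4 \<Rightarrow> real^4 \<Rightarrow> real^4^4" where
  "wedge \<alpha> \<beta> = (\<chi> i j. \<alpha> $ i * \<beta> $ j - \<alpha> $ j * \<beta> $ i)"

abbreviation d\<xi> :: "real^4" where "d\<xi> \<equiv> axis 1 1"
abbreviation d\<eta> :: "real^4" where "d\<eta> \<equiv> axis 2 1"
abbreviation dt :: "real^4" where "dt \<equiv> axis 3 1"
abbreviation dz :: "real^4" where "dz \<equiv> axis 4 1"

definition ot_metric :: "(real \<Rightarrow> real) \<Rightarrow> (real \<Rightarrow> real) \<Rightarrow> matfield" where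
  "ot_metric F G x = (let \<xi> = x $ 1; \<eta> = x $ 2 in
     (\<xi> - \<eta>) *\<^sub>R ((1 / F \<xi>) *\<^sub>R tensor_sq d\<xi> - (1 / G \<eta>) *\<^sub>R tensor_sq d\<eta>)
     + (1 / (\<xi> - \<eta>)) *\<^sub>R (F \<xi> *\<^sub>R tensor_sq (dt + \<eta> *\<^sub>R dz) - G \<eta> *\<^sub>R tensor_sq (dt + \<xi> *\<^sub>R dz)))"

definition ot_form :: matfield where
  "ot_form x = (let \<xi> = x $ 1; \<eta> = x $ 2 in
     wedge d\<xi> (dt + \<eta> *\<^sub>R dz) + wedge d\<eta> (dt + \<xi> *\<^sub>R dz))"

text \<open>The atlas consists of local coordinate systems \<open>(\<xi>, \<eta>, t, z)\<close> with \<open>\<xi>, \<eta>\<close> globally defined,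
  in which the Kaehler structure takes the ortho-toric form. Choosing this atlas for the smooth
  structure loses no generality, since the properties considered do not depend on the atlas.
  The transformation laws of \<open>g\<close> and \<open>J\<close> then force \<open>t\<close> and \<open>z\<close> to change by locally constant
  functions only.\<close>

definition ortho_toric_form ::
  "'a chart set \<Rightarrow> ('a chart \<Rightarrow> matfield) \<Rightarrow> ('a chart \<Rightarrow> matfield) \<Rightarrow>
   ('a \<Rightarrow> real) \<Rightarrow> ('a \<Rightarrow> real) \<Rightarrow> (real \<Rightarrow> real) \<Rightarrow> (real \<Rightarrow> real) \<Rightarrow> bool" where
  "ortho_toric_form \<A> g J \<xi> \<eta> F G \<longleftrightarrow>
     (\<forall>c\<in>\<A>. (\<forall>p\<in>cdom c. cmap c p $ 1 = \<xi> p \<and> cmap c p $ 2 = \<eta> p) \<and>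
        (\<forall>x\<in>cimg c. g c x = ot_metric F G x \<and> fundamental_form (g c) (J c) x = ot_form x))"

definition opposite_structure ::
  "'a chart set \<Rightarrow> ('a chart \<Rightarrow> scalar) \<Rightarrow> ('a chart \<Rightarrow> matfield) \<Rightarrow> ('a chart \<Rightarrow> matfield) \<Rightarrow>
   ('a \<Rightarrow> real) \<Rightarrow> ('a \<Rightarrow> real) \<Rightarrow> ('a chart \<Rightarrow> matfield) \<Rightarrow> bool" where
  "opposite_structure \<A> \<sigma> g J \<xi> \<eta> I \<longleftrightarrow>
     almost_complex_structure \<A> I \<and> orthogonal_structure \<A> g I \<and>
     induces_orientation \<A> (\<lambda>c x. - \<sigma> c x) I \<and>
     (\<forall>c\<in>\<A>. \<forall>x\<in>cimg c.
        let \<alpha> = differential (in_chart \<xi> c) x; \<beta> = differential (in_chart \<eta> c) x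
        in act_form (I c x) \<alpha> = act_form (J c x) \<alpha> \<and> act_form (I c x) \<beta> = - act_form (J c x) \<beta>)"

definition conformal_metric :: "('a \<Rightarrow> real) \<Rightarrow> ('a chart \<Rightarrow> matfield) \<Rightarrow> 'a chart \<Rightarrow> matfield" where
  "conformal_metric u g c x = in_chart u c x *\<^sub>R g c x"

definition quartic_form ::
  "real set \<Rightarrow> real set \<Rightarrow> (real \<Rightarrow> real) \<Rightarrow> (real \<Rightarrow> real) \<Rightarrow>
   real \<Rightarrow> real \<Rightarrow> real \<Rightarrow> real \<Rightarrow> real \<Rightarrow> real \<Rightarrow> real \<Rightarrow> bool" where
  "quartic_form S T F G k l A B\<^sub>1 B\<^sub>2 C\<^sub>1 C\<^sub>2 \<longleftrightarrow>
     (\<forall>x\<in>S. F x = k * x^4 + l * x^3 + A * x^2 + B\<^sub>1 * x + C\<^sub>1) \<and>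
     (\<forall>x\<in>T. G x = k * x^4 + l * x^3 + A * x^2 + B\<^sub>2 * x + C\<^sub>2)"

end

theory Submission
  imports Defs
begin

text \<open>
  Everything is computed in the moving coframe \<open>\<theta>\<^sub>1 = d\<xi>\<close>, \<open>\<theta>\<^sub>2 = d\<eta>\<close>, \<open>\<theta>\<^sub>3 = dt + \<eta> dz\<close>,
  \<open>\<theta>\<^sub>4 = dt + \<xi> dz\<close>. It diagonalises the metric, its only nonzero exterior derivatives are
  \<open>d\<theta>\<^sub>3 = d\<eta> \<and> dz\<close> and \<open>d\<theta>\<^sub>4 = d\<xi> \<and> dz\<close>, and in it all components are rational in
  \<open>d = \<xi> - \<eta>\<close> and the derivatives of \<open>F\<close> and \<open>G\<close>. The curvature tensor then depends on three
  functions only: the two Ricci eigenvalues \<open>r\<^sub>1, r\<^sub>2\<close>, and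
  \<open>q = (F' + G') / d\<^sup>2 - 2 (F - G) / d\<^sup>3\<close> (lemmas \<open>frame_riemann_conn\<close> and \<open>Rm_table\<close>). With
  \<open>s = (r\<^sub>1 + r\<^sub>2) / 3\<close>, the normalized scalar curvature, the self-dual Weyl tensor is a multiple
  of \<open>s\<close> and the anti-self-dual one a multiple of \<open>q + s\<close>; hence anti-self-duality means \<open>s = 0\<close>
  (\<open>weyl_plus_at_iff\<close>).

  Since \<open>s = (G'' - F'') / (6 d)\<close>, the field \<open>J grad s\<close> is \<open>a \<partial>\<^sub>t + b \<partial>\<^sub>z\<close> with coefficients depending
  on \<open>\<xi>, \<eta>\<close> only, and it is Killing exactly when \<open>a, b\<close> are constant. Then \<open>s\<close> is
  \<open>a (\<xi> + \<eta>) + b \<xi> \<eta> + c\<close>, and as \<open>6 d s\<close> is a sum of a function of \<open>\<xi>\<close> and a function of \<open>\<eta>\<close>, first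
  \<open>b = 0\<close>, and then \<open>F''\<close> and \<open>G''\<close> are one and the same quadratic polynomial. This is an argument about the open
  connected image of \<open>(\<xi>, \<eta>)\<close> in the plane (\<open>affine_scalar_imp_quadratic\<close>), which makes the
  coefficients global constants.

  Conversely, for quartic \<open>F, G\<close> with \<open>\<beta> = B\<^sub>1 - B\<^sub>2\<close> and \<open>\<gamma> = C\<^sub>1 - C\<^sub>2\<close> one has
  \<open>s = - 2 k (\<xi> + \<eta>) - l\<close> and \<open>q + s = - (\<beta> (\<xi> + \<eta>) + 2 \<gamma>) / d\<^sup>3\<close>. The Schouten tensor is diagonal in the
  coframe, its Cotton tensor involves \<open>k\<close> and \<open>\<beta>\<close> only, and the Bach tensor
  is \<open>\<beta> s / (2 d\<^sup>2) - d k (q + s) = (4 k \<gamma> - \<beta> l) / (2 d\<^sup>2)\<close> times a nondegenerate diagonal form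
  (\<open>frame_bach_table\<close>, \<open>bach_quartic\<close>). The conformal metric is
  treated with the same coframe: the Levi-Civita connection of \<open>d\<^sup>-\<^sup>2 g\<close> differs from that of \<open>g\<close>
  by changing one parameter in the table \<open>conn\<close>. With it \<open>I\<close> is parallel (\<open>iota_parallel\<close>), the
  scalar curvature of the conformal metric is determined by \<open>- (\<beta> (\<xi> + \<eta>) + 2 \<gamma>) / d\<close>, and its
  hamiltonian field is \<open>2 \<gamma> \<partial>\<^sub>t + 2 \<beta> \<partial>\<^sub>z\<close>, which is Killing because the metric does not depend on
  \<open>t, z\<close>.
\<close>

section \<open>Partial derivatives along coordinate axes\<close>

definition has_partial :: "4 \<Rightarrow> scalar \<Rightarrow> real \<Rightarrow> real^4 \<Rightarrow> bool" where
  "has_partial k f D x \<longleftrightarrow> ((\<lambda>h. f (x + h *\<^sub>R axis k 1)) has_real_derivative D) (at 0)"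

lemma has_partial_imp_partial: "has_partial k f D x \<Longrightarrow> partial k f x = D"
  unfolding has_partial_def partial_def by (rule DERIV_imp_deriv)

lemma eventually_in_open_along_axis:
  assumes "open U" "x \<in> U"
  shows "\<forall>\<^sub>F h in nhds 0. x + h *\<^sub>R axis k (1::real) \<in> U"
proof -
  have "((\<lambda>h. x + h *\<^sub>R axis k (1::real)) \<longlongrightarrow> x + 0 *\<^sub>R axis k 1) (at 0)"
    by (intro tendsto_intros)
  then have "\<forall>\<^sub>F h in at 0. x + h *\<^sub>R axis k (1::real) \<in> U"
    using assms by (auto dest!: topological_tendstoD[where S = U])
  then show ?thesis
    using assms by (simp add: eventually_at_filter eventually_mono) (auto elim: eventually_mono)
qed

lemma has_partial_cong:
  assumes "open U" "x \<in> U" "\<And>y. y \<in> U \<Longrightarrow> f y = f' y"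
  shows "has_partial k f D x \<longleftrightarrow> has_partial k f' D x"
  unfolding has_partial_def
  by (rule DERIV_cong_ev[OF refl _ refl])
    (rule eventually_mono[OF eventually_in_open_along_axis[OF assms(1,2), of k]], simp add: assms(3))

lemma partial_cong:
  assumes "open U" "x \<in> U" "\<And>y. y \<in> U \<Longrightarrow> f y = f' y"
  shows "partial k f x = partial k f' x"
  unfolding partial_def
  by (rule deriv_cong_ev[OF _ refl])
    (rule eventually_mono[OF eventually_in_open_along_axis[OF assms(1,2), of k]], simp add: assms(3))

lemma has_partial_const: "has_partial k (\<lambda>y. c) 0 x"
  unfolding has_partial_def by simp

lemma has_partial_add:
  "has_partial k f D x \<Longrightarrow> has_partial k f' D' x \<Longrightarrow> has_partial k (\<lambda>y. f y + f' y) (D + D') x"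
  unfolding has_partial_def by (rule DERIV_add)

lemma has_partial_mult:
  assumes "has_partial k f D x" "has_partial k f' D' x"
  shows "has_partial k (\<lambda>y. f y * f' y) (D * f' x + f x * D') x"
  using DERIV_mult[OF assms[unfolded has_partial_def]] unfolding has_partial_def
  by (simp add: algebra_simps)

lemma has_partial_sum:
  assumes "\<And>i. i \<in> S \<Longrightarrow> has_partial k (f i) (D i) x"
  shows "has_partial k (\<lambda>y. \<Sum>i\<in>S. f i y) (\<Sum>i\<in>S. D i) x"
  using assms unfolding has_partial_def by (rule DERIV_sum)

lemma has_partial_sum_mult:
  assumes "\<And>i. i \<in> S \<Longrightarrow> has_partial k (\<lambda>y. f y i) (D i) x"
    and "\<And>i. i \<in> S \<Longrightarrow> has_partial k (\<lambda>y. f' y i) (D' i) x"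
  shows "has_partial k (\<lambda>y. \<Sum>i\<in>S. f y i * f' y i) (\<Sum>i\<in>S. D i * f' x i + f x i * D' i) x"
  by (intro has_partial_sum has_partial_mult assms)

lemma sum_delta4: "(\<Sum>a\<in>UNIV. (if b = a then 1 else 0) * f a) = (f b :: real)" for b :: 4
  by (simp add: if_distrib[where f = "\<lambda>z. z * _"] cong: if_cong)

lemma contract_dual:
  fixes Q P :: "4 \<Rightarrow> 4 \<Rightarrow> real"
  assumes "\<And>a b. (\<Sum>i\<in>UNIV. Q a i * P i b) = (if a = b then 1 else 0)"
  shows "(\<Sum>i\<in>UNIV. P i b * (\<Sum>a\<in>UNIV. Q a i * \<tau> a)) = \<tau> b"
proof -
  have "(\<Sum>i\<in>UNIV. P i b * (\<Sum>a\<in>UNIV. Q a i * \<tau> a)) = (\<Sum>a\<in>UNIV. \<Sum>i\<in>UNIV. Q a i * P i b * \<tau> a)"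
    by (subst sum.swap) (simp add: sum_distrib_left mult_ac)
  also have "\<dots> = (\<Sum>a\<in>UNIV. (if b = a then 1 else 0) * \<tau> a)"
    by (intro sum.cong) (auto simp: assms simp flip: sum_distrib_right)
  finally show ?thesis by (simp add: sum_delta4)
qed

lemma matrix_inv_eqI:
  fixes A B :: "real^4^4"
  assumes "A ** B = mat 1"
  shows "matrix_inv A = B" "invertible A"
proof -
  have BA: "B ** A = mat 1"
    using assms matrix_left_right_inverse by blast
  show "invertible A"
    using assms BA by (auto simp: invertible_def)
  have "A ** matrix_inv A = mat 1 \<and> matrix_inv A ** A = mat 1"
    unfolding matrix_inv_def by (rule someI[of _ B]) (use assms BA in simp)
  then show "matrix_inv A = B"
    by (metis BA matrix_mul_assoc matrix_mul_lid matrix_mul_rid)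
qed

text \<open>Koszul: a torsion-free connection preserving the metric is given by the Christoffel symbols, since the three derivatives in their definition combine to a single contraction.\<close>

lemma christoffel_unique:
  assumes inv: "matrix_inv (g x) ** g x = mat 1" and sym: "\<And>i j. g x $ i $ j = g x $ j $ i"
    and torsion_free: "\<And>l i j. \<Gamma> l i j = \<Gamma> l j i"
    and metric: "\<And>k i j. partial k (\<lambda>y. g y $ i $ j) x = (\<Sum>l\<in>UNIV. \<Gamma> l k i * g x $ l $ j + \<Gamma> l k j * g x $ l $ i)"
  shows "christoffel g k i j x = \<Gamma> k i j"
proof -
  have "(\<Sum>n\<in>UNIV. \<Gamma> n i j * g x $ n $ l + \<Gamma> n i l * g x $ n $ j)
      + (\<Sum>n\<in>UNIV. \<Gamma> n j i * g x $ n $ l + \<Gamma> n j l * g x $ n $ i)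
      - (\<Sum>n\<in>UNIV. \<Gamma> n l i * g x $ n $ j + \<Gamma> n l j * g x $ n $ i) = 2 * (\<Sum>n\<in>UNIV. g x $ l $ n * \<Gamma> n i j)" for l
    unfolding sum_distrib_left sum.distrib[symmetric] sum_subtractf[symmetric]
    by (intro sum.cong refl) (simp add: torsion_free[of _ j i] torsion_free[of _ l] sym[of l])
  then have "christoffel g k i j x = (\<Sum>l\<in>UNIV. matrix_inv (g x) $ k $ l * (\<Sum>n\<in>UNIV. g x $ l $ n * \<Gamma> n i j))"
    unfolding christoffel_def metric by (simp add: sum_distrib_left)
  also have "\<dots> = (\<Sum>n\<in>UNIV. \<Sum>l\<in>UNIV. matrix_inv (g x) $ k $ l * (g x $ l $ n * \<Gamma> n i j))"
    unfolding sum_distrib_left by (rule sum.swap)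
  also have "\<dots> = (\<Sum>n\<in>UNIV. (matrix_inv (g x) ** g x) $ k $ n * \<Gamma> n i j)"
    unfolding matrix_matrix_mult_def by (simp add: sum_distrib_left sum_distrib_right mult_ac)
  also have "\<dots> = \<Gamma> k i j"
    by (simp add: inv mat_def sum_delta4)
  finally show ?thesis .
qed

section \<open>Curvature in a moving frame\<close>

definition pull1 :: "(4 \<Rightarrow> 4 \<Rightarrow> real) \<Rightarrow> (4 \<Rightarrow> real) \<Rightarrow> 4 \<Rightarrow> real" where
  "pull1 q \<tau> i = (\<Sum>a\<in>UNIV. q a i * \<tau> a)"

definition pull2 :: "(4 \<Rightarrow> 4 \<Rightarrow> real) \<Rightarrow> (4 \<Rightarrow> 4 \<Rightarrow> real) \<Rightarrow> 4 \<Rightarrow> 4 \<Rightarrow> real" where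
  "pull2 q \<tau> i j = pull1 q (\<lambda>a. pull1 q (\<tau> a) j) i"

definition pull3 :: "(4 \<Rightarrow> 4 \<Rightarrow> real) \<Rightarrow> (4 \<Rightarrow> 4 \<Rightarrow> 4 \<Rightarrow> real) \<Rightarrow> 4 \<Rightarrow> 4 \<Rightarrow> 4 \<Rightarrow> real" where
  "pull3 q \<tau> i j k = pull1 q (\<lambda>a. pull2 q (\<tau> a) j k) i"

definition pull4 :: "(4 \<Rightarrow> 4 \<Rightarrow> real) \<Rightarrow> (4 \<Rightarrow> 4 \<Rightarrow> 4 \<Rightarrow> 4 \<Rightarrow> real) \<Rightarrow> 4 \<Rightarrow> 4 \<Rightarrow> 4 \<Rightarrow> 4 \<Rightarrow> real" where
  "pull4 q \<tau> i j k l = pull1 q (\<lambda>a. pull3 q (\<tau> a) j k l) i"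

lemma pull1_add: "pull1 q (\<lambda>a. s a + t a) i = pull1 q s i + pull1 q t i"
  by (simp add: pull1_def sum.distrib algebra_simps)

lemma pull1_diff: "pull1 q (\<lambda>a. s a - t a) i = pull1 q s i - pull1 q t i"
  by (simp add: pull1_def sum_subtractf algebra_simps)

lemma pull1_minus: "pull1 q (\<lambda>a. - t a) i = - pull1 q t i"
  by (simp add: pull1_def sum_negf)

lemma pull1_cmult: "pull1 q (\<lambda>a. c * t a) i = c * pull1 q t i"
  by (simp add: pull1_def sum_distrib_left sum_distrib_right mult_ac)

lemma pull1_multc: "pull1 q (\<lambda>a. t a * c) i = pull1 q t i * c"
  by (simp add: pull1_def sum_distrib_left sum_distrib_right mult_ac)

lemma pull1_sum: "pull1 q (\<lambda>a. \<Sum>s\<in>S. t s a) i = (\<Sum>s\<in>S. pull1 q (t s) i)"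
  unfolding pull1_def sum_distrib_left by (rule sum.swap)

lemma pull1_zero: "pull1 q (\<lambda>a. 0) i = 0"
  by (simp add: pull1_def)

lemma pull1_swap: "pull1 q (\<lambda>a. pull1 r (\<tau> a) j) i = pull1 r (\<lambda>b. pull1 q (\<lambda>a. \<tau> a b) i) j"
  unfolding pull1_def[of r] pull1_sum by (simp add: pull1_cmult)

lemma pull2_swap: "pull2 q (\<lambda>a b. \<tau> b a) i j = pull2 q \<tau> j i"
  unfolding pull2_def by (rule pull1_swap)

lemmas pull_linear = pull1_add pull1_diff pull1_minus pull1_cmult pull1_multc pull1_sum pull1_zero
lemmas pull_defs = pull2_def pull3_def pull4_def

text \<open>\<open>Q a i\<close> is the \<open>i\<close>-th coordinate component of the coframe form \<open>\<theta>\<^sub>a\<close>, and \<open>P\<close> is the dual frame. The components \<open>Q\<close> have constant derivatives \<open>dQ\<close>: they are affine in the coordinates, so that their second derivatives drop out of the curvature.\<close>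

locale moving_frame =
  fixes U :: "(real^4) set" and Q P :: "real^4 \<Rightarrow> 4 \<Rightarrow> 4 \<Rightarrow> real" and dQ :: "4 \<Rightarrow> 4 \<Rightarrow> 4 \<Rightarrow> real"
  assumes open_U: "open U"
    and QP: "\<And>x a b. x \<in> U \<Longrightarrow> (\<Sum>i\<in>UNIV. Q x a i * P x i b) = (if a = b then 1 else 0)"
    and PQ: "\<And>x i j. x \<in> U \<Longrightarrow> (\<Sum>a\<in>UNIV. P x i a * Q x a j) = (if i = j then 1 else 0)"
    and has_partial_Q: "\<And>x a i k. x \<in> U \<Longrightarrow> has_partial k (\<lambda>y. Q y a i) (dQ k a i) x"
    and has_partial_P: "\<And>x a i k. x \<in> U \<Longrightarrow> \<exists>D. has_partial k (\<lambda>y. P y i a) D x"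
begin

lemma contract_pull1:
  assumes "x \<in> U"
  shows "(\<Sum>i\<in>UNIV. P x i b * pull1 (Q x) \<tau> i) = \<tau> b"
  unfolding pull1_def by (rule contract_dual[OF QP[OF assms]])

lemma contract_QP:
  assumes "x \<in> U"
  shows "(\<Sum>i\<in>UNIV. Q x a i * (\<Sum>b\<in>UNIV. P x i b * \<tau> b)) = \<tau> a"
proof -
  have "(\<Sum>i\<in>UNIV. Q x a i * (\<Sum>b\<in>UNIV. P x i b * \<tau> b)) = (\<Sum>b\<in>UNIV. (\<Sum>i\<in>UNIV. Q x a i * P x i b) * \<tau> b)"
    by (simp add: sum_distrib_left sum_distrib_right mult_ac) (rule sum.swap)
  then show ?thesis by (simp add: QP[OF assms] sum_delta4)
qed

lemma contract_PQ:
  assumes "x \<in> U"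
  shows "(\<Sum>a\<in>UNIV. P x i a * (\<Sum>l\<in>UNIV. Q x a l * t l)) = t i"
proof -
  have "(\<Sum>a\<in>UNIV. P x i a * (\<Sum>l\<in>UNIV. Q x a l * t l)) = (\<Sum>l\<in>UNIV. (\<Sum>a\<in>UNIV. P x i a * Q x a l) * t l)"
    by (simp add: sum_distrib_left sum_distrib_right mult_ac) (rule sum.swap)
  then show ?thesis by (simp add: PQ[OF assms] sum_delta4)
qed

lemma pull1_eq_0_iff:
  assumes "x \<in> U"
  shows "(\<forall>i. pull1 (Q x) \<tau> i = 0) \<longleftrightarrow> (\<forall>a. \<tau> a = 0)"
proof
  assume "\<forall>i. pull1 (Q x) \<tau> i = 0"
  then show "\<forall>a. \<tau> a = 0"
    using contract_pull1[OF assms, of _ \<tau>] by simp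
qed (simp add: pull1_def)

lemma pull2_eq_0_iff:
  assumes "x \<in> U"
  shows "(\<forall>i j. pull2 (Q x) \<tau> i j = 0) \<longleftrightarrow> (\<forall>a b. \<tau> a b = 0)"
proof -
  have "(\<forall>i j. pull2 (Q x) \<tau> i j = 0) \<longleftrightarrow> (\<forall>j a. pull1 (Q x) (\<tau> a) j = 0)"
    unfolding pull2_def using pull1_eq_0_iff[OF assms] by (metis (no_types, lifting))
  also have "\<dots> \<longleftrightarrow> (\<forall>a b. \<tau> a b = 0)"
    using pull1_eq_0_iff[OF assms] by metis
  finally show ?thesis .
qed

lemma pull4_eq_0_iff:
  assumes "x \<in> U"
  shows "(\<forall>i j k l. pull4 (Q x) \<tau> i j k l = 0) \<longleftrightarrow> (\<forall>a b c d. \<tau> a b c d = 0)"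
proof -
  have "(\<forall>i j k l. pull4 (Q x) \<tau> i j k l = 0) \<longleftrightarrow> (\<forall>j k l a. pull3 (Q x) (\<tau> a) j k l = 0)"
    unfolding pull4_def using pull1_eq_0_iff[OF assms] by (metis (no_types, lifting))
  also have "\<dots> \<longleftrightarrow> (\<forall>k l a b. pull2 (Q x) (\<tau> a b) k l = 0)"
    unfolding pull3_def using pull1_eq_0_iff[OF assms] by (metis (no_types, lifting))
  also have "\<dots> \<longleftrightarrow> (\<forall>a b c d. \<tau> a b c d = 0)"
    using pull2_eq_0_iff[OF assms] by metis
  finally show ?thesis .
qed

end

text \<open>The metric is diagonal in the coframe with entries \<open>H\<close>, and \<open>\<gamma> a c b\<close> is the coefficient in \<open>\<nabla>\<theta>\<^sub>a = - \<gamma> a c b \<theta>\<^sub>c \<otimes> \<theta>\<^sub>b\<close>. The derivatives \<open>dH\<close> and \<open>d\<gamma>\<close> are taken along the frame; their first index is the direction.\<close>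

locale metric_frame = moving_frame +
  fixes g :: matfield and H :: "real^4 \<Rightarrow> 4 \<Rightarrow> real" and dH :: "real^4 \<Rightarrow> 4 \<Rightarrow> 4 \<Rightarrow> real"
    and \<gamma> :: "real^4 \<Rightarrow> 4 \<Rightarrow> 4 \<Rightarrow> 4 \<Rightarrow> real" and d\<gamma> :: "real^4 \<Rightarrow> 4 \<Rightarrow> 4 \<Rightarrow> 4 \<Rightarrow> 4 \<Rightarrow> real"
  assumes g: "\<And>x i j. x \<in> U \<Longrightarrow> g x $ i $ j = (\<Sum>a\<in>UNIV. H x a * Q x a i * Q x a j)"
    and H_nonzero: "\<And>x a. x \<in> U \<Longrightarrow> H x a \<noteq> 0"
    and has_partial_H: "\<And>x a k. x \<in> U \<Longrightarrow> has_partial k (\<lambda>y. H y a) (pull1 (Q x) (\<lambda>c. dH x c a) k) x"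
    and has_partial_\<gamma>: "\<And>x a b c k. x \<in> U \<Longrightarrow>
          has_partial k (\<lambda>y. \<gamma> y a c b) (pull1 (Q x) (\<lambda>e. d\<gamma> x e a c b) k) x"
    and compatible: "\<And>x a b c. x \<in> U \<Longrightarrow>
          H x a * \<gamma> x a c b + H x b * \<gamma> x b c a = (if a = b then dH x c a else 0)"
    and torsion_free: "\<And>x a k i. x \<in> U \<Longrightarrow>
          dQ k a i - dQ i a k = pull2 (Q x) (\<lambda>c b. \<gamma> x a b c - \<gamma> x a c b) k i"
begin

text \<open>The connection form evaluated on a coordinate field; \<open>Gam\<close> below is the coordinate expression of the connection that makes the covariant derivative of the coframe equal to minus this form.\<close>

definition \<omega> :: "real^4 \<Rightarrow> 4 \<Rightarrow> 4 \<Rightarrow> 4 \<Rightarrow> real" where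
  "\<omega> x k a b = pull1 (Q x) (\<lambda>c. \<gamma> x a c b) k"

definition Gam :: "real^4 \<Rightarrow> 4 \<Rightarrow> 4 \<Rightarrow> 4 \<Rightarrow> real" where
  "Gam x l k i = (\<Sum>a\<in>UNIV. P x l a * (dQ k a i + pull1 (Q x) (\<omega> x k a) i))"

lemma Q_Gam: "x \<in> U \<Longrightarrow> (\<Sum>l\<in>UNIV. Q x a l * Gam x l k i) = dQ k a i + pull1 (Q x) (\<omega> x k a) i"
  unfolding Gam_def by (rule contract_QP)

lemma Gam_sym:
  assumes x: "x \<in> U"
  shows "Gam x l k i = Gam x l i k"
proof -
  have "pull1 (Q x) (\<omega> x k a) i = pull2 (Q x) (\<lambda>c b. \<gamma> x a c b) k i" for a k i
    unfolding \<omega>_def pull2_def by (rule pull1_swap)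
  then have "dQ k a i + pull1 (Q x) (\<omega> x k a) i = dQ i a k + pull1 (Q x) (\<omega> x i a) k" for a
    using torsion_free[OF x, of k a i] pull2_swap[of "Q x" "\<gamma> x a" k i]
    by (simp add: pull2_def pull_linear)
  then show ?thesis unfolding Gam_def by simp
qed

lemma matrix_inv_g:
  assumes x: "x \<in> U"
  shows "matrix_inv (g x) $ i $ j = (\<Sum>a\<in>UNIV. P x i a * P x j a / H x a)"
    and "matrix_inv (g x) ** g x = mat 1"
proof -
  define B :: "real^4^4" where "B = (\<chi> i j. \<Sum>a\<in>UNIV. P x i a * P x j a / H x a)"
  have "(B ** g x) $ i $ j = (if i = j then 1 else 0)" for i j
  proof -
    have "(B ** g x) $ i $ j = (\<Sum>k\<in>UNIV. \<Sum>a\<in>UNIV. P x i a / H x a * (P x k a * g x $ k $ j))"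
      by (simp add: B_def matrix_matrix_mult_def sum_distrib_left sum_distrib_right mult_ac)
    also have "\<dots> = (\<Sum>a\<in>UNIV. P x i a / H x a * (\<Sum>k\<in>UNIV. P x k a * g x $ k $ j))"
      by (subst sum.swap) (simp add: sum_distrib_left)
    also have "\<dots> = (\<Sum>a\<in>UNIV. P x i a / H x a * (H x a * Q x a j))"
      using contract_pull1[OF x, of _ "\<lambda>a. H x a * Q x a j"]
      by (simp add: g[OF x] pull1_def mult_ac)
    also have "\<dots> = (if i = j then 1 else 0)"
      using PQ[OF x, of i j] H_nonzero[OF x] by (simp add: mult_ac)
    finally show ?thesis .
  qed
  then have "B ** g x = mat 1"
    by (simp add: vec_eq_iff mat_def)
  then have gB: "g x ** B = mat 1" using matrix_left_right_inverse by blast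
  then show "matrix_inv (g x) ** g x = mat 1"
    using \<open>B ** g x = mat 1\<close> matrix_inv_eqI(1) by metis
  show "matrix_inv (g x) $ i $ j = (\<Sum>a\<in>UNIV. P x i a * P x j a / H x a)"
    using matrix_inv_eqI(1)[OF gB] by (simp add: B_def)
qed

lemma compatible_\<omega>:
  assumes x: "x \<in> U"
  shows "H x a * \<omega> x k a b + H x b * \<omega> x k b a = (if a = b then pull1 (Q x) (\<lambda>c. dH x c a) k else 0)"
  unfolding \<omega>_def pull1_cmult[symmetric] pull1_add[symmetric] compatible[OF x]
  by (simp add: pull1_zero)

lemma christoffel_eq_Gam:
  assumes x: "x \<in> U"
  shows "christoffel g l k i x = Gam x l k i"
proof (rule christoffel_unique)
  show "matrix_inv (g x) ** g x = mat 1" by (rule matrix_inv_g(2)[OF x])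
  show "g x $ i $ j = g x $ j $ i" for i j by (simp add: g[OF x] mult_ac)
  show "Gam x l i j = Gam x l j i" for l i j by (rule Gam_sym[OF x])
  fix k i j
  have "has_partial k (\<lambda>y. \<Sum>a\<in>UNIV. H y a * Q y a i * Q y a j)
      (\<Sum>a\<in>UNIV. (pull1 (Q x) (\<lambda>c. dH x c a) k * Q x a i + H x a * dQ k a i) * Q x a j + H x a * Q x a i * dQ k a j) x"
    by (intro has_partial_sum has_partial_mult has_partial_H has_partial_Q x)
  then have "partial k (\<lambda>y. g y $ i $ j) x =
      (\<Sum>a\<in>UNIV. (pull1 (Q x) (\<lambda>c. dH x c a) k * Q x a i + H x a * dQ k a i) * Q x a j + H x a * Q x a i * dQ k a j)"
    using partial_cong[OF open_U x, of "\<lambda>y. g y $ i $ j"] g has_partial_imp_partial by force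
  also have "\<dots> = (\<Sum>a\<in>UNIV. \<Sum>b\<in>UNIV. (if a = b then pull1 (Q x) (\<lambda>c. dH x c a) k else 0) * Q x a i * Q x b j)
     + (\<Sum>a\<in>UNIV. H x a * dQ k a i * Q x a j + H x a * Q x a i * dQ k a j)"
    by (simp add: sum.distrib algebra_simps if_distrib[where f = "\<lambda>z. z * _"] if_distrib[where f = "\<lambda>z. _ * z"] cong: if_cong)
  also have "(\<Sum>a\<in>UNIV. \<Sum>b\<in>UNIV. (if a = b then pull1 (Q x) (\<lambda>c. dH x c a) k else 0) * Q x a i * Q x b j)
     = (\<Sum>a\<in>UNIV. \<Sum>b\<in>UNIV. H x a * \<omega> x k a b * Q x a i * Q x b j) + (\<Sum>a\<in>UNIV. \<Sum>b\<in>UNIV. H x b * \<omega> x k b a * Q x a i * Q x b j)"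
    unfolding compatible_\<omega>[OF x, symmetric] by (simp add: sum.distrib algebra_simps)
  also have "(\<Sum>a\<in>UNIV. \<Sum>b\<in>UNIV. H x b * \<omega> x k b a * Q x a i * Q x b j)
     = (\<Sum>a\<in>UNIV. \<Sum>b\<in>UNIV. H x a * \<omega> x k a b * Q x b i * Q x a j)"
    by (rule sum.swap)
  also have "(\<Sum>a\<in>UNIV. \<Sum>b\<in>UNIV. H x a * \<omega> x k a b * Q x a i * Q x b j) + \<dots>
       + (\<Sum>a\<in>UNIV. H x a * dQ k a i * Q x a j + H x a * Q x a i * dQ k a j)
     = (\<Sum>a\<in>UNIV. H x a * Q x a j * (dQ k a i + pull1 (Q x) (\<omega> x k a) i))
     + (\<Sum>a\<in>UNIV. H x a * Q x a i * (dQ k a j + pull1 (Q x) (\<omega> x k a) j))"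
    by (simp add: pull1_def sum.distrib sum_distrib_left algebra_simps)
  also have "\<dots> = (\<Sum>a\<in>UNIV. \<Sum>l\<in>UNIV. H x a * Q x a j * Q x a l * Gam x l k i)
     + (\<Sum>a\<in>UNIV. \<Sum>l\<in>UNIV. H x a * Q x a i * Q x a l * Gam x l k j)"
    by (simp add: Q_Gam[OF x, symmetric] sum_distrib_left mult_ac)
  also have "\<dots> = (\<Sum>l\<in>UNIV. Gam x l k i * g x $ l $ j + Gam x l k j * g x $ l $ i)"
    unfolding sum.distrib g[OF x] sum_distrib_left
    by (intro arg_cong2[where f = "(+)"]; subst sum.swap) (simp_all add: mult_ac)
  finally show "partial k (\<lambda>y. g y $ i $ j) x = (\<Sum>l\<in>UNIV. Gam x l k i * g x $ l $ j + Gam x l k j * g x $ l $ i)" .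
qed

end

lemma pull3_swap12: "pull3 q (\<lambda>a b c. \<tau> b a c) i j k = pull3 q \<tau> j i k"
  unfolding pull_defs by (rule pull1_swap)

definition frame_riemann ::
  "(4 \<Rightarrow> 4 \<Rightarrow> 4 \<Rightarrow> real) \<Rightarrow> (4 \<Rightarrow> 4 \<Rightarrow> 4 \<Rightarrow> 4 \<Rightarrow> real) \<Rightarrow> 4 \<Rightarrow> 4 \<Rightarrow> 4 \<Rightarrow> 4 \<Rightarrow> real" where
  "frame_riemann \<gamma> d\<gamma> a b c d = d\<gamma> b d a c - d\<gamma> a d b c
     + (\<Sum>e\<in>UNIV. \<gamma> d b e * \<gamma> e a c - \<gamma> d a e * \<gamma> e b c + (\<gamma> e a b - \<gamma> e b a) * \<gamma> d e c)"

context metric_frame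
begin

definition Rm :: "real^4 \<Rightarrow> 4 \<Rightarrow> 4 \<Rightarrow> 4 \<Rightarrow> 4 \<Rightarrow> real" where
  "Rm x = frame_riemann (\<gamma> x) (d\<gamma> x)"

definition d\<omega> :: "real^4 \<Rightarrow> 4 \<Rightarrow> 4 \<Rightarrow> 4 \<Rightarrow> 4 \<Rightarrow> real" where
  "d\<omega> x j i a b = (\<Sum>c\<in>UNIV. dQ j c i * \<gamma> x a c b + Q x c i * pull1 (Q x) (\<lambda>e. d\<gamma> x e a c b) j)"

lemma has_partial_\<omega>: "x \<in> U \<Longrightarrow> has_partial j (\<lambda>y. \<omega> y i a b) (d\<omega> x j i a b) x"
  unfolding \<omega>_def pull1_def[of "Q _" "\<lambda>c. \<gamma> _ a c b"] d\<omega>_def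
  by (intro has_partial_sum_mult has_partial_Q has_partial_\<gamma>)

text \<open>Cartan's second structure equation: torsion-freeness turns the derivatives of the coframe into the bracket terms of the frame curvature.\<close>

lemma curvature_form:
  assumes x: "x \<in> U"
  shows "d\<omega> x j i d c - d\<omega> x i j d c + (\<Sum>b\<in>UNIV. \<omega> x j d b * \<omega> x i b c - \<omega> x i d b * \<omega> x j b c)
    = pull2 (Q x) (\<lambda>a b. Rm x a b c d) i j" (is "?L = _")
proof -
  define q where "q = Q x"
  have \<omega>\<omega>: "(\<Sum>b\<in>UNIV. \<omega> x j d b * \<omega> x i b c) = pull2 q (\<lambda>a b. \<Sum>e\<in>UNIV. \<gamma> x d b e * \<gamma> x e a c) i j" for i j
    unfolding \<omega>_def pull2_def q_def by (simp add: pull_linear mult_ac)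
  have \<omega>\<omega>': "(\<Sum>b\<in>UNIV. \<omega> x i d b * \<omega> x j b c) = pull2 q (\<lambda>a b. \<Sum>e\<in>UNIV. \<gamma> x d a e * \<gamma> x e b c) i j"
    unfolding \<omega>\<omega>[of i j] by (rule pull2_swap)
  have d\<omega>: "d\<omega> x j i d c = (\<Sum>e\<in>UNIV. dQ j e i * \<gamma> x d e c) + pull2 q (\<lambda>a b. d\<gamma> x b d a c) i j" for i j
    unfolding d\<omega>_def pull2_def q_def by (simp add: sum.distrib pull1_def)
  have d\<omega>': "d\<omega> x i j d c = (\<Sum>e\<in>UNIV. dQ i e j * \<gamma> x d e c) + pull2 q (\<lambda>a b. d\<gamma> x a d b c) i j"
    unfolding d\<omega>[of i j] by (subst pull2_swap[of q "\<lambda>a b. d\<gamma> x a d b c" j i]) (rule refl)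
  have "(\<Sum>e\<in>UNIV. dQ j e i * \<gamma> x d e c) - (\<Sum>e\<in>UNIV. dQ i e j * \<gamma> x d e c)
     = (\<Sum>e\<in>UNIV. pull2 q (\<lambda>a b. \<gamma> x e b a - \<gamma> x e a b) j i * \<gamma> x d e c)"
    using torsion_free[OF x, of j _ i]
    by (simp add: q_def left_diff_distrib[symmetric] sum_subtractf[symmetric])
  also have "\<dots> = (\<Sum>e\<in>UNIV. pull2 q (\<lambda>a b. \<gamma> x e a b - \<gamma> x e b a) i j * \<gamma> x d e c)"
    using pull2_swap[of q "\<lambda>a b. \<gamma> x _ a b - \<gamma> x _ b a" j i] by simp
  also have "\<dots> = pull2 q (\<lambda>a b. \<Sum>e\<in>UNIV. (\<gamma> x e a b - \<gamma> x e b a) * \<gamma> x d e c) i j"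
    unfolding pull2_def by (simp only: pull_linear)
  finally have "?L = pull2 q (\<lambda>a b. d\<gamma> x b d a c) i j - pull2 q (\<lambda>a b. d\<gamma> x a d b c) i j
      + (pull2 q (\<lambda>a b. \<Sum>e\<in>UNIV. \<gamma> x d b e * \<gamma> x e a c) i j - pull2 q (\<lambda>a b. \<Sum>e\<in>UNIV. \<gamma> x d a e * \<gamma> x e b c) i j
      + pull2 q (\<lambda>a b. \<Sum>e\<in>UNIV. (\<gamma> x e a b - \<gamma> x e b a) * \<gamma> x d e c) i j)"
    unfolding sum_subtractf \<omega>\<omega>[of j i] \<omega>\<omega>' d\<omega>[of j i] d\<omega>' by linarith
  then show ?thesis
    unfolding q_def Rm_def frame_riemann_def pull2_def sum.distrib sum_subtractf by (simp only: pull_linear)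
qed

text \<open>Differentiating the structure equation \<open>Q \<Gamma> = dQ + \<omega> Q\<close> and antisymmetrising cancels the derivatives of \<open>Q\<close> and leaves the curvature of \<open>\<omega>\<close>.\<close>

lemma curvature_frame:
  assumes x: "x \<in> U"
  shows "(\<Sum>l\<in>UNIV. Q x d l * curvature g i j k l x)
      = pull1 (Q x) (\<lambda>c. pull2 (Q x) (\<lambda>a b. Rm x a b c d) i j) k"
proof -
  have partial_Q_Gam: "(\<Sum>l\<in>UNIV. Q x d l * partial j (christoffel g l i k) x)
     = (\<Sum>b\<in>UNIV. d\<omega> x j i d b * Q x b k + \<omega> x i d b * dQ j b k) - (\<Sum>l\<in>UNIV. dQ j d l * Gam x l i k)"
    for i j
  proof -
    have "\<exists>D. \<forall>l. has_partial j (christoffel g l i k) (D l) x"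
    proof (rule choice, rule allI)
      fix l
      obtain DP where DP: "\<And>a. has_partial j (\<lambda>y. P y l a) (DP a) x"
        using has_partial_P[OF x, of j l] by metis
      have "has_partial j (\<lambda>y. \<Sum>a\<in>UNIV. P y l a * (dQ i a k + (\<Sum>b\<in>UNIV. Q y b k * \<omega> y i a b)))
         (\<Sum>a\<in>UNIV. DP a * (dQ i a k + (\<Sum>b\<in>UNIV. Q x b k * \<omega> x i a b)) + P x l a * (0 + (\<Sum>b\<in>UNIV. dQ j b k * \<omega> x i a b + Q x b k * d\<omega> x j i a b))) x"
        by (intro has_partial_sum has_partial_mult DP has_partial_add has_partial_const has_partial_Q has_partial_\<omega> x)
      then have "has_partial j (\<lambda>y. Gam y l i k) (\<Sum>a\<in>UNIV. DP a * (dQ i a k + (\<Sum>b\<in>UNIV. Q x b k * \<omega> x i a b)) + P x l a * (0 + (\<Sum>b\<in>UNIV. dQ j b k * \<omega> x i a b + Q x b k * d\<omega> x j i a b))) x"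
        unfolding Gam_def pull1_def .
      then show "\<exists>D. has_partial j (christoffel g l i k) D x"
        using has_partial_cong[OF open_U x, of "christoffel g l i k" "\<lambda>y. Gam y l i k"] christoffel_eq_Gam by blast
    qed
    then obtain D where D: "\<And>l. has_partial j (christoffel g l i k) (D l) x" by blast
    have 1: "has_partial j (\<lambda>y. \<Sum>l\<in>UNIV. Q y d l * christoffel g l i k y)
        (\<Sum>l\<in>UNIV. dQ j d l * christoffel g l i k x + Q x d l * D l) x"
      by (intro has_partial_sum has_partial_mult has_partial_Q D x)
    have "has_partial j (\<lambda>y. dQ i d k + (\<Sum>b\<in>UNIV. Q y b k * \<omega> y i d b))
        (0 + (\<Sum>b\<in>UNIV. dQ j b k * \<omega> x i d b + Q x b k * d\<omega> x j i d b)) x"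
      by (intro has_partial_sum has_partial_mult has_partial_add has_partial_const has_partial_Q has_partial_\<omega> x)
    moreover have "(\<Sum>l\<in>UNIV. Q y d l * christoffel g l i k y) = dQ i d k + (\<Sum>b\<in>UNIV. Q y b k * \<omega> y i d b)"
      if "y \<in> U" for y
      using Q_Gam[OF that, of d i k] by (simp add: christoffel_eq_Gam[OF that] pull1_def)
    ultimately have 2: "has_partial j (\<lambda>y. \<Sum>l\<in>UNIV. Q y d l * christoffel g l i k y)
        (0 + (\<Sum>b\<in>UNIV. dQ j b k * \<omega> x i d b + Q x b k * d\<omega> x j i d b)) x"
      using has_partial_cong[OF open_U x, of "\<lambda>y. \<Sum>l\<in>UNIV. Q y d l * christoffel g l i k y" "\<lambda>y. dQ i d k + (\<Sum>b\<in>UNIV. Q y b k * \<omega> y i d b)"] by blast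
    have "(\<Sum>l\<in>UNIV. dQ j d l * christoffel g l i k x + Q x d l * D l)
       = (\<Sum>b\<in>UNIV. dQ j b k * \<omega> x i d b + Q x b k * d\<omega> x j i d b)"
      using has_partial_imp_partial[OF 1] has_partial_imp_partial[OF 2] by simp
    moreover have "D l = partial j (christoffel g l i k) x" for l
      using has_partial_imp_partial[OF D] by simp
    ultimately show ?thesis
      by (simp add: sum.distrib christoffel_eq_Gam[OF x] mult_ac)
  qed
  have Gam_Gam: "(\<Sum>l\<in>UNIV. Q x d l * (\<Sum>m\<in>UNIV. Gam x l j m * Gam x m i k))
     = (\<Sum>m\<in>UNIV. dQ j d m * Gam x m i k)
     + (\<Sum>b\<in>UNIV. \<omega> x j d b * dQ i b k) + (\<Sum>c\<in>UNIV. Q x c k * (\<Sum>b\<in>UNIV. \<omega> x j d b * \<omega> x i b c))" for i j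
  proof -
    have "(\<Sum>l\<in>UNIV. Q x d l * (\<Sum>m\<in>UNIV. Gam x l j m * Gam x m i k)) = (\<Sum>m\<in>UNIV. (\<Sum>l\<in>UNIV. Q x d l * Gam x l j m) * Gam x m i k)"
      unfolding sum_distrib_left sum_distrib_right by (subst sum.swap) (simp add: mult_ac)
    also have "\<dots> = (\<Sum>m\<in>UNIV. dQ j d m * Gam x m i k) + (\<Sum>m\<in>UNIV. \<Sum>b\<in>UNIV. \<omega> x j d b * (Q x b m * Gam x m i k))"
      unfolding Q_Gam[OF x] pull1_def by (simp add: sum_distrib_left sum_distrib_right algebra_simps sum.distrib)
    also have "(\<Sum>m\<in>UNIV. \<Sum>b\<in>UNIV. \<omega> x j d b * (Q x b m * Gam x m i k))
      = (\<Sum>b\<in>UNIV. \<omega> x j d b * (\<Sum>m\<in>UNIV. Q x b m * Gam x m i k))"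
      by (subst sum.swap) (simp add: sum_distrib_left)
    also have "\<dots> = (\<Sum>b\<in>UNIV. \<omega> x j d b * dQ i b k) + (\<Sum>b\<in>UNIV. \<Sum>c\<in>UNIV. Q x c k * (\<omega> x j d b * \<omega> x i b c))"
      unfolding Q_Gam[OF x] pull1_def by (simp add: sum_distrib_left algebra_simps sum.distrib)
    also have "(\<Sum>b\<in>UNIV. \<Sum>c\<in>UNIV. Q x c k * (\<omega> x j d b * \<omega> x i b c)) = (\<Sum>c\<in>UNIV. Q x c k * (\<Sum>b\<in>UNIV. \<omega> x j d b * \<omega> x i b c))"
      by (subst sum.swap) (simp add: sum_distrib_left)
    finally show ?thesis by simp
  qed
  have "(\<Sum>l\<in>UNIV. Q x d l * curvature g i j k l x)
     = ((\<Sum>l\<in>UNIV. Q x d l * partial j (christoffel g l i k) x) + (\<Sum>l\<in>UNIV. Q x d l * (\<Sum>m\<in>UNIV. Gam x l j m * Gam x m i k)))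
     - ((\<Sum>l\<in>UNIV. Q x d l * partial i (christoffel g l j k) x) + (\<Sum>l\<in>UNIV. Q x d l * (\<Sum>m\<in>UNIV. Gam x l i m * Gam x m j k)))"
    unfolding curvature_def christoffel_eq_Gam[OF x]
    by (simp add: sum_subtractf sum.distrib algebra_simps)
  also have "\<dots> = (\<Sum>c\<in>UNIV. Q x c k * (d\<omega> x j i d c - d\<omega> x i j d c + (\<Sum>b\<in>UNIV. \<omega> x j d b * \<omega> x i b c - \<omega> x i d b * \<omega> x j b c)))"
    unfolding partial_Q_Gam Gam_Gam by (simp add: sum_subtractf sum.distrib algebra_simps)
  finally show ?thesis
    unfolding curvature_form[OF x] pull1_def .
qed

lemma curvature_eq:
  assumes x: "x \<in> U"
  shows "curvature g i j k l x = (\<Sum>d\<in>UNIV. P x l d * pull1 (Q x) (\<lambda>c. pull2 (Q x) (\<lambda>a b. Rm x a b c d) i j) k)"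
  using contract_PQ[OF x, of l "\<lambda>l. curvature g i j k l x"] unfolding curvature_frame[OF x] by simp

lemma lowered_curvature:
  assumes x: "x \<in> U"
  shows "(\<Sum>m\<in>UNIV. curvature g i j k m x * g x $ m $ l) = pull4 (Q x) (\<lambda>a b c d. Rm x a b c d * H x d) i j k l"
proof -
  have "(\<Sum>m\<in>UNIV. curvature g i j k m x * g x $ m $ l) = (\<Sum>d\<in>UNIV. Q x d l * ((\<Sum>m\<in>UNIV. Q x d m * curvature g i j k m x) * H x d))"
    unfolding g[OF x] sum_distrib_left sum_distrib_right by (subst sum.swap) (simp add: mult_ac)
  also have "\<dots> = pull1 (Q x) (\<lambda>d. pull1 (Q x) (\<lambda>c. pull2 (Q x) (\<lambda>a b. Rm x a b c d * H x d) i j) k) l"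
    unfolding curvature_frame[OF x] pull1_def[of _ _ l] pull2_def by (simp only: pull_linear)
  also have "\<dots> = pull4 (Q x) (\<lambda>a b c d. Rm x a b c d * H x d) i j k l"
    unfolding pull_defs
    apply (subst pull1_swap[of _ _ _ k l])
    apply (subst pull1_swap[of _ _ _ i l])
    apply (subst pull1_swap[of _ _ _ i k])
    apply (rule arg_cong[where f="\<lambda>f. pull1 (Q x) f i"], rule ext)
    apply (subst pull1_swap[of _ _ _ j l])
    apply (subst pull1_swap[of _ _ _ j k])
    apply (rule refl)
    done
  finally show ?thesis .
qed

definition Ric :: "real^4 \<Rightarrow> 4 \<Rightarrow> 4 \<Rightarrow> real" where
  "Ric x a c = (\<Sum>d\<in>UNIV. Rm x a d c d)"

definition Sc :: "real^4 \<Rightarrow> real" where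
  "Sc x = (\<Sum>a\<in>UNIV. Ric x a a / H x a)"

lemma ricci_eq:
  assumes x: "x \<in> U"
  shows "ricci g j k x = pull2 (Q x) (Ric x) j k"
proof -
  have swap: "pull1 (Q x) (\<lambda>c. pull2 (Q x) (\<lambda>a b. Rm x a b c d) j i) k
      = pull1 (Q x) (\<lambda>b. pull2 (Q x) (\<lambda>a c. Rm x a b c d) j k) i" for i d
    unfolding pull2_def
    by (subst pull1_swap[of _ _ _ j k], subst pull1_swap[of _ _ _ i k], subst pull1_swap[of _ _ _ i j], rule refl)
  have "ricci g j k x = (\<Sum>d\<in>UNIV. \<Sum>i\<in>UNIV. P x i d * pull1 (Q x) (\<lambda>b. pull2 (Q x) (\<lambda>a c. Rm x a b c d) j k) i)"
    unfolding ricci_def curvature_eq[OF x] swap by (rule sum.swap)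
  also have "\<dots> = pull2 (Q x) (Ric x) j k"
    unfolding contract_pull1[OF x] pull2_def Ric_def pull_linear ..
  finally show ?thesis .
qed

lemma trace_eq:
  assumes x: "x \<in> U"
  shows "(\<Sum>i\<in>UNIV. \<Sum>j\<in>UNIV. matrix_inv (g x) $ i $ j * pull2 (Q x) \<tau> i j) = (\<Sum>a\<in>UNIV. \<tau> a a / H x a)"
proof -
  have inner: "(\<Sum>j\<in>UNIV. matrix_inv (g x) $ i $ j * pull2 (Q x) \<tau> i j)
     = (\<Sum>a\<in>UNIV. P x i a * pull1 (Q x) (\<lambda>b. \<tau> b a) i / H x a)" for i
  proof -
    have "(\<Sum>j\<in>UNIV. matrix_inv (g x) $ i $ j * pull2 (Q x) \<tau> i j)
      = (\<Sum>j\<in>UNIV. \<Sum>a\<in>UNIV. P x i a / H x a * (P x j a * pull1 (Q x) (\<lambda>b. pull1 (Q x) (\<lambda>c. \<tau> c b) i) j))"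
      unfolding matrix_inv_g(1)[OF x] pull2_def sum_distrib_right
      by (subst pull1_swap) (simp add: mult_ac)
    also have "\<dots> = (\<Sum>a\<in>UNIV. P x i a / H x a * (\<Sum>j\<in>UNIV. P x j a * pull1 (Q x) (\<lambda>b. pull1 (Q x) (\<lambda>c. \<tau> c b) i) j))"
      by (subst sum.swap) (simp add: sum_distrib_left)
    finally show ?thesis
      unfolding contract_pull1[OF x] by simp
  qed
  have "(\<Sum>i\<in>UNIV. \<Sum>j\<in>UNIV. matrix_inv (g x) $ i $ j * pull2 (Q x) \<tau> i j)
      = (\<Sum>a\<in>UNIV. (\<Sum>i\<in>UNIV. P x i a * pull1 (Q x) (\<lambda>b. \<tau> b a) i) / H x a)"
    unfolding inner by (subst sum.swap) (simp add: sum_divide_distrib)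
  then show ?thesis by (simp add: contract_pull1[OF x])
qed

lemma Scal_eq: "x \<in> U \<Longrightarrow> Scal g x = Sc x"
  unfolding Scal_def Sc_def by (simp add: ricci_eq trace_eq)

lemma g_pull: "x \<in> U \<Longrightarrow> g x $ i $ j = pull2 (Q x) (\<lambda>a b. if a = b then H x a else 0) i j"
  by (simp add: g pull2_def pull1_def mult_ac if_distrib[where f = "\<lambda>z. _ * z"] cong: if_cong)

text \<open>The Schouten tensor \<open>hricci\<close> in the frame: tracefree and scalar part combine to \<open>Ric / 2 - Scal / 12\<close>.\<close>

definition Sch :: "real^4 \<Rightarrow> 4 \<Rightarrow> 4 \<Rightarrow> real" where
  "Sch x a b = Ric x a b / 2 - (if a = b then Sc x / 12 * H x a else 0)"

lemma hricci_eq: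
  assumes x: "x \<in> U"
  shows "hricci g i j x = pull2 (Q x) (Sch x) i j"
proof -
  have "pull2 (Q x) (Sch x) i j = pull2 (Q x) (\<lambda>a b. Ric x a b * (1/2) - (if a = b then H x a else 0) * (Sc x / 12)) i j"
    by (rule arg_cong[where f="\<lambda>\<tau>. pull2 (Q x) \<tau> i j"]) (auto simp: Sch_def fun_eq_iff)
  then show ?thesis
    unfolding hricci_def ricci0_def Scal_eq[OF x] ricci_eq[OF x] g_pull[OF x] pull2_def pull_linear
    by (simp add: field_simps)
qed

lemma pull4_prod13_24: "pull4 q (\<lambda>a b c d. s a c * t b d) i j k l = pull2 q s i k * pull2 q t j l"
  unfolding pull_defs by (simp add: pull_linear)

lemma pull4_prod14_23: "pull4 q (\<lambda>a b c d. s a d * t b c) i j k l = pull2 q s i l * pull2 q t j k"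
  unfolding pull_defs by (simp add: pull_linear)

definition Wl :: "real^4 \<Rightarrow> 4 \<Rightarrow> 4 \<Rightarrow> 4 \<Rightarrow> 4 \<Rightarrow> real" where
  "Wl x a b c d = (let \<delta> = (\<lambda>a b. if a = b then H x a else 0) in Rm x a b c d * H x d
     - (Sch x a c * \<delta> b d + \<delta> a c * Sch x b d - Sch x a d * \<delta> b c - \<delta> a d * Sch x b c))"

lemma weyl_eq:
  assumes x: "x \<in> U"
  shows "weyl g i j k l x = pull4 (Q x) (Wl x) i j k l"
proof -
  define \<delta> where "\<delta> a b = (if a = b then H x a else 0)" for a b
  have \<delta>: "g x $ i $ j = pull2 (Q x) \<delta> i j" for i j
    unfolding g_pull[OF x] \<delta>_def ..
  have "pull4 (Q x) (Wl x) i j k l = pull4 (Q x) (\<lambda>a b c d. Rm x a b c d * H x d) i j k l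
    - (pull4 (Q x) (\<lambda>a b c d. Sch x a c * \<delta> b d) i j k l + pull4 (Q x) (\<lambda>a b c d. \<delta> a c * Sch x b d) i j k l
     - pull4 (Q x) (\<lambda>a b c d. Sch x a d * \<delta> b c) i j k l - pull4 (Q x) (\<lambda>a b c d. \<delta> a d * Sch x b c) i j k l)"
    unfolding Wl_def Let_def \<delta>_def[symmetric] pull_defs by (simp only: pull1_add pull1_diff)
  then show ?thesis
    unfolding weyl_def lowered_curvature[OF x]
    unfolding hricci_eq[OF x] \<delta>
      pull4_prod13_24[of _ "Sch x" \<delta>] pull4_prod13_24[of _ \<delta> "Sch x"]
      pull4_prod14_23[of _ "Sch x" \<delta>] pull4_prod14_23[of _ \<delta> "Sch x"]
    by (simp add: mult.commute)
qed

text \<open>One index of a covariant derivative. Higher ranks follow by treating the remaining indices as parameters, so only this identity involves the Christoffel symbols.\<close>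

lemma slot_connection:
  assumes x: "x \<in> U"
  shows "(\<Sum>a\<in>UNIV. dQ k a i * S a) - (\<Sum>l\<in>UNIV. christoffel g l k i x * pull1 (Q x) S l)
     = - pull1 (Q x) (\<lambda>a. \<Sum>e\<in>UNIV. \<omega> x k e a * S e) i"
proof -
  have "(\<Sum>l\<in>UNIV. christoffel g l k i x * pull1 (Q x) S l) = (\<Sum>a\<in>UNIV. (\<Sum>l\<in>UNIV. Q x a l * Gam x l k i) * S a)"
    unfolding pull1_def christoffel_eq_Gam[OF x] sum_distrib_left sum_distrib_right
    by (subst sum.swap) (simp add: mult_ac)
  also have "\<dots> = (\<Sum>a\<in>UNIV. dQ k a i * S a) + (\<Sum>a\<in>UNIV. pull1 (Q x) (\<omega> x k a) i * S a)"
    unfolding Q_Gam[OF x] by (simp add: algebra_simps sum.distrib)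
  also have "(\<Sum>a\<in>UNIV. pull1 (Q x) (\<omega> x k a) i * S a) = pull1 (Q x) (\<lambda>a. \<Sum>e\<in>UNIV. \<omega> x k e a * S e) i"
    by (simp only: pull_linear)
  finally show ?thesis by simp
qed

end

text \<open>For a torsion-free connection, partial derivatives in the Nijenhuis tensor may be replaced by covariant ones: the Christoffel terms cancel in pairs.\<close>

lemma nijenhuis_eq_0:
  assumes sym: "\<And>l i j. christoffel g l i j x = christoffel g l j i x"
    and nabla: "\<And>k i j. nabla_endo g J k i j x = 0"
  shows "nijenhuis J i j k x = 0"
proof -
  define \<Gamma> where "\<Gamma> l i j = christoffel g l i j x" for l i j
  define A where "A i j = J x $ i $ j" for i j
  have sym': "\<Gamma> l i j = \<Gamma> l j i" for l i j
    unfolding \<Gamma>_def by (rule sym)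
  have p: "partial l (\<lambda>y. J y $ k $ j) x = (\<Sum>m\<in>UNIV. \<Gamma> m l j * A k m - \<Gamma> k l m * A m j)" for l k j
    using nabla[of l k j] unfolding nabla_endo_def \<Gamma>_def A_def by (simp add: sum_subtractf)
  have 1: "(\<Sum>l\<in>UNIV. A l i * (\<Sum>m\<in>UNIV. \<Gamma> k l m * A m j)) = (\<Sum>l\<in>UNIV. A l j * (\<Sum>m\<in>UNIV. \<Gamma> k l m * A m i))"
    unfolding sum_distrib_left
    by (subst sum.swap) (simp add: sym'[of k] mult_ac)
  have 2: "(\<Sum>l\<in>UNIV. A l i * (\<Sum>m\<in>UNIV. \<Gamma> m l j * A k m)) = (\<Sum>l\<in>UNIV. A k l * (\<Sum>m\<in>UNIV. \<Gamma> l j m * A m i))" for i j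
    unfolding sum_distrib_left
    by (subst sum.swap) (simp add: sym'[of _ j] mult_ac)
  have "nijenhuis J i j k x
     = ((\<Sum>l\<in>UNIV. A l i * (\<Sum>m\<in>UNIV. \<Gamma> m l j * A k m)) - (\<Sum>l\<in>UNIV. A l i * (\<Sum>m\<in>UNIV. \<Gamma> k l m * A m j)))
     - ((\<Sum>l\<in>UNIV. A l j * (\<Sum>m\<in>UNIV. \<Gamma> m l i * A k m)) - (\<Sum>l\<in>UNIV. A l j * (\<Sum>m\<in>UNIV. \<Gamma> k l m * A m i)))
     - ((\<Sum>l\<in>UNIV. A k l * (\<Sum>m\<in>UNIV. \<Gamma> m i j * A l m)) - (\<Sum>l\<in>UNIV. A k l * (\<Sum>m\<in>UNIV. \<Gamma> l i m * A m j))
      - (\<Sum>l\<in>UNIV. A k l * (\<Sum>m\<in>UNIV. \<Gamma> m i j * A l m)) + (\<Sum>l\<in>UNIV. A k l * (\<Sum>m\<in>UNIV. \<Gamma> l j m * A m i)))"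
    unfolding nijenhuis_def p sum_subtractf A_def[symmetric] sym'[of _ j i]
    by (simp add: sum_subtractf sum.distrib right_diff_distrib)
  also have "\<dots> = 0"
    unfolding 1 2[of i j] 2[of j i] by simp
  finally show ?thesis .
qed

definition frame_nabla2 where
  "frame_nabla2 \<gamma> s ds c a b = ds c a b - (\<Sum>e\<in>UNIV. \<gamma> e c a * s e b) - (\<Sum>e\<in>UNIV. \<gamma> e c b * s a e)"
  for \<gamma> ds :: "4 \<Rightarrow> 4 \<Rightarrow> 4 \<Rightarrow> real"

definition frame_nabla3 where
  "frame_nabla3 \<gamma> s ds m a b c = ds m a b c - (\<Sum>e\<in>UNIV. \<gamma> e m a * s e b c)
     - (\<Sum>e\<in>UNIV. \<gamma> e m b * s a e c) - (\<Sum>e\<in>UNIV. \<gamma> e m c * s a b e)"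
  for \<gamma> s :: "4 \<Rightarrow> 4 \<Rightarrow> 4 \<Rightarrow> real"

definition frame_bach where
  "frame_bach \<gamma> H h W C dC c d =
     (\<Sum>a\<in>UNIV. (- frame_nabla3 \<gamma> C dC a a c d + (\<Sum>e\<in>UNIV. h a e / H e * W a c e d)) / H a)"

context metric_frame
begin

lemma christoffel_sym: "x \<in> U \<Longrightarrow> christoffel g l i j x = christoffel g l j i x"
  by (simp add: christoffel_eq_Gam Gam_sym)

definition D1 :: "real^4 \<Rightarrow> 4 \<Rightarrow> (4 \<Rightarrow> real) \<Rightarrow> (4 \<Rightarrow> real) \<Rightarrow> 4 \<Rightarrow> real" where
  "D1 x k s ds i = (\<Sum>a\<in>UNIV. dQ k a i * s a) + pull1 (Q x) ds i"

definition D2 :: "real^4 \<Rightarrow> 4 \<Rightarrow> (4 \<Rightarrow> 4 \<Rightarrow> real) \<Rightarrow> (4 \<Rightarrow> 4 \<Rightarrow> real) \<Rightarrow> 4 \<Rightarrow> 4 \<Rightarrow> real" where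
  "D2 x k s ds i j = D1 x k (\<lambda>a. pull1 (Q x) (s a) j) (\<lambda>a. D1 x k (s a) (ds a) j) i"

definition D3 :: "real^4 \<Rightarrow> 4 \<Rightarrow> (4 \<Rightarrow> 4 \<Rightarrow> 4 \<Rightarrow> real) \<Rightarrow> (4 \<Rightarrow> 4 \<Rightarrow> 4 \<Rightarrow> real) \<Rightarrow> 4 \<Rightarrow> 4 \<Rightarrow> 4 \<Rightarrow> real" where
  "D3 x k s ds i j l = D1 x k (\<lambda>a. pull2 (Q x) (s a) j l) (\<lambda>a. D2 x k (s a) (ds a) j l) i"

lemma has_partial_pull1:
  assumes x: "x \<in> U" and s: "\<And>a. has_partial k (\<lambda>y. s y a) (ds a) x"
  shows "has_partial k (\<lambda>y. pull1 (Q y) (s y) i) (D1 x k (s x) ds i) x"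
  unfolding pull1_def D1_def sum.distrib[symmetric]
  by (intro has_partial_sum_mult has_partial_Q x s)

lemma has_partial_pull2:
  assumes x: "x \<in> U" and s: "\<And>a b. has_partial k (\<lambda>y. s y a b) (ds a b) x"
  shows "has_partial k (\<lambda>y. pull2 (Q y) (s y) i j) (D2 x k (s x) ds i j) x"
  unfolding pull2_def D2_def
  by (rule has_partial_pull1[OF x has_partial_pull1[OF x s]])

lemma has_partial_pull3:
  assumes x: "x \<in> U" and s: "\<And>a b c. has_partial k (\<lambda>y. s y a b c) (ds a b c) x"
  shows "has_partial k (\<lambda>y. pull3 (Q y) (s y) i j l) (D3 x k (s x) ds i j l) x"
  unfolding pull3_def D3_def
  by (rule has_partial_pull1[OF x has_partial_pull2[OF x s]])

lemma nabla_pull1: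
  assumes x: "x \<in> U"
  shows "D1 x k s ds i - (\<Sum>l\<in>UNIV. christoffel g l k i x * pull1 (Q x) s l)
     = pull1 (Q x) (\<lambda>a. ds a - (\<Sum>e\<in>UNIV. \<omega> x k e a * s e)) i"
  using slot_connection[OF x, of k i s] unfolding D1_def by (simp add: pull1_diff)

lemma nabla_pull2:
  assumes x: "x \<in> U"
  shows "D2 x k s ds i j - (\<Sum>l\<in>UNIV. christoffel g l k i x * pull2 (Q x) s l j)
      - (\<Sum>l\<in>UNIV. christoffel g l k j x * pull2 (Q x) s i l)
     = pull2 (Q x) (\<lambda>a b. ds a b - (\<Sum>e\<in>UNIV. \<omega> x k e a * s e b) - (\<Sum>e\<in>UNIV. \<omega> x k e b * s a e)) i j"
proof -
  have first: "D2 x k s ds i j - (\<Sum>l\<in>UNIV. christoffel g l k i x * pull2 (Q x) s l j)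
     = pull1 (Q x) (\<lambda>a. D1 x k (s a) (ds a) j) i - pull1 (Q x) (\<lambda>a. \<Sum>e\<in>UNIV. \<omega> x k e a * pull1 (Q x) (s e) j) i"
    unfolding D2_def pull2_def pull1_diff[symmetric] by (rule nabla_pull1[OF x])
  have second: "(\<Sum>l\<in>UNIV. christoffel g l k j x * pull2 (Q x) s i l)
     = pull1 (Q x) (\<lambda>a. \<Sum>l\<in>UNIV. christoffel g l k j x * pull1 (Q x) (s a) l) i"
    unfolding pull2_def by (simp only: pull_linear)
  have "D2 x k s ds i j - (\<Sum>l\<in>UNIV. christoffel g l k i x * pull2 (Q x) s l j)
      - (\<Sum>l\<in>UNIV. christoffel g l k j x * pull2 (Q x) s i l)
    = pull1 (Q x) (\<lambda>a. D1 x k (s a) (ds a) j - (\<Sum>l\<in>UNIV. christoffel g l k j x * pull1 (Q x) (s a) l)) i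
        - pull1 (Q x) (\<lambda>a. \<Sum>e\<in>UNIV. \<omega> x k e a * pull1 (Q x) (s e) j) i"
    unfolding first second pull1_diff by simp
  also have "\<dots> = pull2 (Q x) (\<lambda>a b. ds a b - (\<Sum>e\<in>UNIV. \<omega> x k e a * s e b) - (\<Sum>e\<in>UNIV. \<omega> x k e b * s a e)) i j"
    unfolding nabla_pull1[OF x] unfolding pull2_def pull_linear by simp
  finally show ?thesis .
qed

lemma nabla_pull3:
  assumes x: "x \<in> U"
  shows "D3 x k s ds i j n - (\<Sum>l\<in>UNIV. christoffel g l k i x * pull3 (Q x) s l j n)
      - (\<Sum>l\<in>UNIV. christoffel g l k j x * pull3 (Q x) s i l n)
      - (\<Sum>l\<in>UNIV. christoffel g l k n x * pull3 (Q x) s i j l)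
     = pull3 (Q x) (\<lambda>a b c. ds a b c - (\<Sum>e\<in>UNIV. \<omega> x k e a * s e b c)
          - (\<Sum>e\<in>UNIV. \<omega> x k e b * s a e c) - (\<Sum>e\<in>UNIV. \<omega> x k e c * s a b e)) i j n"
proof -
  have first: "D3 x k s ds i j n - (\<Sum>l\<in>UNIV. christoffel g l k i x * pull3 (Q x) s l j n)
     = pull1 (Q x) (\<lambda>a. D2 x k (s a) (ds a) j n) i - pull1 (Q x) (\<lambda>a. \<Sum>e\<in>UNIV. \<omega> x k e a * pull2 (Q x) (s e) j n) i"
    unfolding D3_def pull3_def pull1_diff[symmetric] by (rule nabla_pull1[OF x])
  have second: "(\<Sum>l\<in>UNIV. christoffel g l k j x * pull3 (Q x) s i l n)
     = pull1 (Q x) (\<lambda>a. \<Sum>l\<in>UNIV. christoffel g l k j x * pull2 (Q x) (s a) l n) i"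
    "(\<Sum>l\<in>UNIV. christoffel g l k n x * pull3 (Q x) s i j l)
     = pull1 (Q x) (\<lambda>a. \<Sum>l\<in>UNIV. christoffel g l k n x * pull2 (Q x) (s a) j l) i"
    unfolding pull3_def by (simp_all only: pull_linear)
  have "D3 x k s ds i j n - (\<Sum>l\<in>UNIV. christoffel g l k i x * pull3 (Q x) s l j n)
      - (\<Sum>l\<in>UNIV. christoffel g l k j x * pull3 (Q x) s i l n)
      - (\<Sum>l\<in>UNIV. christoffel g l k n x * pull3 (Q x) s i j l)
    = pull1 (Q x) (\<lambda>a. D2 x k (s a) (ds a) j n - (\<Sum>l\<in>UNIV. christoffel g l k j x * pull2 (Q x) (s a) l n)
             - (\<Sum>l\<in>UNIV. christoffel g l k n x * pull2 (Q x) (s a) j l)) i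
         - pull1 (Q x) (\<lambda>a. \<Sum>e\<in>UNIV. \<omega> x k e a * pull2 (Q x) (s e) j n) i"
    unfolding first second pull1_diff by simp
  also have "\<dots> = pull3 (Q x) (\<lambda>a b c. ds a b c - (\<Sum>e\<in>UNIV. \<omega> x k e a * s e b c)
          - (\<Sum>e\<in>UNIV. \<omega> x k e b * s a e c) - (\<Sum>e\<in>UNIV. \<omega> x k e c * s a b e)) i j n"
    unfolding nabla_pull2[OF x] unfolding pull3_def pull2_def pull_linear by simp
  finally show ?thesis .
qed

lemma nabla_hricci_eq:
  assumes x: "x \<in> U" and h: "\<And>y a b. y \<in> U \<Longrightarrow> Sch y a b = h y a b"
    and dh: "\<And>k a b. has_partial k (\<lambda>y. h y a b) (pull1 (Q x) (\<lambda>c. dh c a b) k) x"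
  shows "nabla_hricci g k i j x = pull3 (Q x) (frame_nabla2 (\<gamma> x) (h x) dh) k i j"
proof -
  have hr: "hricci g i j y = pull2 (Q y) (h y) i j" if "y \<in> U" for y i j
  proof -
    have "Sch y = h y" using h[OF that] by (intro ext)
    then show ?thesis using hricci_eq[OF that] by simp
  qed
  have "partial k (hricci g i j) x = D2 x k (h x) (\<lambda>a b. pull1 (Q x) (\<lambda>c. dh c a b) k) i j"
    by (subst partial_cong[OF open_U x, of "hricci g i j" "\<lambda>y. pull2 (Q y) (h y) i j"], rule hr, assumption, rule has_partial_imp_partial[OF has_partial_pull2[OF x dh]])
  then have "nabla_hricci g k i j x = pull2 (Q x) (\<lambda>a b. pull1 (Q x) (\<lambda>c. dh c a b) k
      - (\<Sum>e\<in>UNIV. \<omega> x k e a * h x e b) - (\<Sum>e\<in>UNIV. \<omega> x k e b * h x a e)) i j"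
    unfolding nabla_hricci_def hr[OF x] nabla_pull2[OF x, symmetric] by (simp add: sum.distrib)
  also have "\<dots> = pull2 (Q x) (\<lambda>a b. pull1 (Q x) (\<lambda>c. frame_nabla2 (\<gamma> x) (h x) dh c a b) k) i j"
    unfolding frame_nabla2_def \<omega>_def by (simp only: pull_linear)
  also have "\<dots> = pull3 (Q x) (frame_nabla2 (\<gamma> x) (h x) dh) k i j"
    unfolding pull_defs
    by (subst pull1_swap[of _ _ _ k j], subst pull1_swap[of _ _ _ k i], rule refl)
  finally show ?thesis .
qed

lemma nabla_cotton_eq:
  assumes x: "x \<in> U" and C: "\<And>y i j k. y \<in> U \<Longrightarrow> cotton g i j k y = pull3 (Q y) (C y) i j k"
    and dC: "\<And>k a b c. has_partial k (\<lambda>y. C y a b c) (pull1 (Q x) (\<lambda>m. dC m a b c) k) x"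
  shows "nabla_cotton g m i j k x = pull4 (Q x) (frame_nabla3 (\<gamma> x) (C x) dC) m i j k"
proof -
  have "partial m (cotton g i j k) x = D3 x m (C x) (\<lambda>a b c. pull1 (Q x) (\<lambda>m. dC m a b c) m) i j k"
    by (subst partial_cong[OF open_U x, of "cotton g i j k" "\<lambda>y. pull3 (Q y) (C y) i j k"], rule C, assumption, rule has_partial_imp_partial[OF has_partial_pull3[OF x dC]])
  then have "nabla_cotton g m i j k x = pull3 (Q x) (\<lambda>a b c. pull1 (Q x) (\<lambda>m. dC m a b c) m
      - (\<Sum>e\<in>UNIV. \<omega> x m e a * C x e b c) - (\<Sum>e\<in>UNIV. \<omega> x m e b * C x a e c)
      - (\<Sum>e\<in>UNIV. \<omega> x m e c * C x a b e)) i j k"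
    unfolding nabla_cotton_def C[OF x] nabla_pull3[OF x, symmetric] by (simp add: sum.distrib)
  also have "\<dots> = pull3 (Q x) (\<lambda>a b c. pull1 (Q x) (\<lambda>m. frame_nabla3 (\<gamma> x) (C x) dC m a b c) m) i j k"
    unfolding frame_nabla3_def \<omega>_def by (simp only: pull_linear)
  also have "\<dots> = pull4 (Q x) (frame_nabla3 (\<gamma> x) (C x) dC) m i j k"
    unfolding pull_defs
    by (subst pull1_swap[of _ _ _ m k], subst pull1_swap[of _ _ _ m j], subst pull1_swap[of _ _ _ m i], rule refl)
  finally show ?thesis .
qed

lemma bach_eq:
  assumes x: "x \<in> U" and h: "\<And>y a b. y \<in> U \<Longrightarrow> Sch y a b = h y a b"
    and dh: "\<And>y k a b. y \<in> U \<Longrightarrow> has_partial k (\<lambda>y. h y a b) (pull1 (Q y) (\<lambda>c. dh y c a b) k) y"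
    and C: "\<And>y a b c. y \<in> U \<Longrightarrow> C y a b c = - frame_nabla2 (\<gamma> y) (h y) (dh y) a b c + frame_nabla2 (\<gamma> y) (h y) (dh y) b a c"
    and dC: "\<And>k a b c. has_partial k (\<lambda>y. C y a b c) (pull1 (Q x) (\<lambda>m. dC m a b c) k) x"
  shows "bach g i j x = pull2 (Q x) (frame_bach (\<gamma> x) (H x) (h x) (Wl x) (C x) dC) i j"
proof -
  have cot: "cotton g i j k y = pull3 (Q y) (C y) i j k" if y: "y \<in> U" for y i j k
  proof -
    have "cotton g i j k y = - pull3 (Q y) (frame_nabla2 (\<gamma> y) (h y) (dh y)) i j k
        + pull3 (Q y) (\<lambda>a b c. frame_nabla2 (\<gamma> y) (h y) (dh y) b a c) i j k"
      unfolding cotton_def pull3_swap12[of "Q y" "frame_nabla2 (\<gamma> y) (h y) (dh y)" i j k]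
      by (subst (1 2) nabla_hricci_eq[OF y, of h "dh y"]) (simp_all add: h dh y)
    also have "\<dots> = pull3 (Q y) (C y) i j k"
      unfolding pull3_def pull2_def C[OF y] by (simp only: pull_linear)
    finally show ?thesis .
  qed
  have hW: "(\<Sum>p\<in>UNIV. \<Sum>q\<in>UNIV. hricci g l q x * matrix_inv (g x) $ q $ p * weyl g m i p j x)
     = pull4 (Q x) (\<lambda>a b c d. \<Sum>e\<in>UNIV. h x b e / H x e * Wl x a c e d) m l i j" for m l i j
  proof -
    have prod: "hricci g l q x * weyl g m i p j x
        = pull2 (Q x) (\<lambda>e f. pull1 (Q x) (\<lambda>b. h x b e) l * pull3 (Q x) (\<lambda>a c d. Wl x a c f d) m i j) q p" for p q
    proof -
      have "weyl g m i p j x = pull1 (Q x) (\<lambda>f. pull3 (Q x) (\<lambda>a c d. Wl x a c f d) m i j) p"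
        unfolding weyl_eq[OF x] pull_defs
        by (subst pull1_swap[of _ _ _ p i], subst pull1_swap[of _ _ _ p m], rule refl)
      moreover have "hricci g l q x = pull1 (Q x) (\<lambda>e. pull1 (Q x) (\<lambda>b. h x b e) l) q"
        unfolding hricci_eq[OF x] h[OF x] pull2_def by (rule pull1_swap)
      ultimately show ?thesis
        unfolding pull2_def by (simp add: pull_linear)
    qed
    have "(\<Sum>p\<in>UNIV. \<Sum>q\<in>UNIV. hricci g l q x * matrix_inv (g x) $ q $ p * weyl g m i p j x)
      = (\<Sum>q\<in>UNIV. \<Sum>p\<in>UNIV. matrix_inv (g x) $ q $ p * pull2 (Q x) (\<lambda>e f. pull1 (Q x) (\<lambda>b. h x b e) l * pull3 (Q x) (\<lambda>a c d. Wl x a c f d) m i j) q p)"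
      unfolding prod[symmetric] by (subst sum.swap) (simp add: mult_ac)
    also have "\<dots> = (\<Sum>e\<in>UNIV. pull1 (Q x) (\<lambda>b. h x b e) l * pull3 (Q x) (\<lambda>a c d. Wl x a c e d) m i j / H x e)"
      by (rule trace_eq[OF x])
    also have "\<dots> = pull4 (Q x) (\<lambda>a b c d. \<Sum>e\<in>UNIV. h x b e / H x e * Wl x a c e d) m l i j"
      unfolding pull_defs divide_inverse by (simp add: pull_linear mult_ac)
    finally show ?thesis .
  qed
  have nc: "nabla_cotton g m l i j x = pull4 (Q x) (frame_nabla3 (\<gamma> x) (C x) dC) m l i j" for m l i j
    by (rule nabla_cotton_eq[OF x _ dC]) (rule cot)
  have "- nabla_cotton g m l i j x + (\<Sum>p\<in>UNIV. \<Sum>q\<in>UNIV. hricci g l q x * matrix_inv (g x) $ q $ p * weyl g m i p j x)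
     = pull2 (Q x) (\<lambda>a b. pull2 (Q x) (\<lambda>c d. - frame_nabla3 (\<gamma> x) (C x) dC a b c d + (\<Sum>e\<in>UNIV. h x b e / H x e * Wl x a c e d)) i j) m l" for m l
    unfolding hW nc pull_defs by (simp add: pull_linear)
  then have "bach g i j x = (\<Sum>a\<in>UNIV. pull2 (Q x) (\<lambda>c d. - frame_nabla3 (\<gamma> x) (C x) dC a a c d + (\<Sum>e\<in>UNIV. h x a e / H x e * Wl x a c e d)) i j / H x a)"
    unfolding bach_def by (simp only: trace_eq[OF x])
  also have "\<dots> = pull2 (Q x) (frame_bach (\<gamma> x) (H x) (h x) (Wl x) (C x) dC) i j"
    unfolding frame_bach_def pull2_def divide_inverse by (simp only: pull_linear)
  finally show ?thesis .
qed

text \<open>Differentiating the relation \<open>Q J = \<iota> Q\<close> instead of solved forms of \<open>J\<close> avoids derivatives of the dual frame.\<close>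

lemma nabla_endo_frame:
  assumes x: "x \<in> U" and J: "\<And>y i j. y \<in> U \<Longrightarrow> J y $ i $ j = (\<Sum>a\<in>UNIV. P y i a * pull1 (Q y) (\<iota> y a) j)"
    and d\<iota>: "\<And>k a b. has_partial k (\<lambda>y. \<iota> y a b) (pull1 (Q x) (\<lambda>c. d\<iota> c a b) k) x"
    and parallel: "\<And>c a b. d\<iota> c a b + (\<Sum>e\<in>UNIV. \<gamma> x a c e * \<iota> x e b) - (\<Sum>e\<in>UNIV. \<gamma> x e c b * \<iota> x a e) = 0"
  shows "nabla_endo g J k i j x = 0"
proof -
  define D where "D i = partial k (\<lambda>y. J y $ i $ j) x" for i
  define dk where "dk a b = pull1 (Q x) (\<lambda>c. d\<iota> c a b) k" for a b
  have QJ: "(\<Sum>i\<in>UNIV. Q y a i * J y $ i $ j) = pull1 (Q y) (\<iota> y a) j" if "y \<in> U" for y a j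
    unfolding J[OF that] by (rule contract_QP[OF that])
  have D: "has_partial k (\<lambda>y. J y $ i $ j) (D i) x" for i
  proof -
    obtain DP where DP: "\<And>a. has_partial k (\<lambda>y. P y i a) (DP a) x"
      using has_partial_P[OF x, of k i] by metis
    have "has_partial k (\<lambda>y. \<Sum>a\<in>UNIV. P y i a * pull1 (Q y) (\<iota> y a) j)
        (\<Sum>a\<in>UNIV. DP a * pull1 (Q x) (\<iota> x a) j + P x i a * D1 x k (\<iota> x a) (dk a) j) x"
      unfolding dk_def by (intro has_partial_sum has_partial_mult DP has_partial_pull1 x d\<iota>)
    then have "has_partial k (\<lambda>y. J y $ i $ j)
        (\<Sum>a\<in>UNIV. DP a * pull1 (Q x) (\<iota> x a) j + P x i a * D1 x k (\<iota> x a) (dk a) j) x"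
      by (subst has_partial_cong[OF open_U x J])
    then show ?thesis
      unfolding D_def using has_partial_imp_partial by force
  qed
  have dJ: "(\<Sum>i\<in>UNIV. Q x a i * D i) = D1 x k (\<iota> x a) (dk a) j - (\<Sum>i\<in>UNIV. dQ k a i * J x $ i $ j)" for a
  proof -
    have "has_partial k (\<lambda>y. \<Sum>i\<in>UNIV. Q y a i * J y $ i $ j) (\<Sum>i\<in>UNIV. dQ k a i * J x $ i $ j + Q x a i * D i) x"
      by (intro has_partial_sum has_partial_mult has_partial_Q x D)
    moreover have "has_partial k (\<lambda>y. pull1 (Q y) (\<iota> y a) j) (D1 x k (\<iota> x a) (dk a) j) x"
      unfolding dk_def by (rule has_partial_pull1[OF x d\<iota>])
    moreover have "partial k (\<lambda>y. \<Sum>i\<in>UNIV. Q y a i * J y $ i $ j) x = partial k (\<lambda>y. pull1 (Q y) (\<iota> y a) j) x"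
      by (rule partial_cong[OF open_U x QJ])
    ultimately have "(\<Sum>i\<in>UNIV. dQ k a i * J x $ i $ j + Q x a i * D i) = D1 x k (\<iota> x a) (dk a) j"
      by (simp only: has_partial_imp_partial)
    then show ?thesis by (simp add: sum.distrib)
  qed
  have G1: "(\<Sum>i\<in>UNIV. Q x a i * (\<Sum>l\<in>UNIV. christoffel g i k l x * J x $ l $ j))
     = (\<Sum>i\<in>UNIV. dQ k a i * J x $ i $ j) + (\<Sum>e\<in>UNIV. \<omega> x k a e * pull1 (Q x) (\<iota> x e) j)" for a
  proof -
    have "(\<Sum>i\<in>UNIV. Q x a i * (\<Sum>l\<in>UNIV. christoffel g i k l x * J x $ l $ j))
       = (\<Sum>l\<in>UNIV. (\<Sum>i\<in>UNIV. Q x a i * Gam x i k l) * J x $ l $ j)"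
      unfolding sum_distrib_left sum_distrib_right christoffel_eq_Gam[OF x]
      by (subst sum.swap) (simp add: mult_ac)
    also have "\<dots> = (\<Sum>l\<in>UNIV. dQ k a l * J x $ l $ j) + (\<Sum>l\<in>UNIV. \<Sum>e\<in>UNIV. \<omega> x k a e * (Q x e l * J x $ l $ j))"
      unfolding Q_Gam[OF x] pull1_def by (simp add: sum_distrib_left sum_distrib_right algebra_simps sum.distrib)
    also have "(\<Sum>l\<in>UNIV. \<Sum>e\<in>UNIV. \<omega> x k a e * (Q x e l * J x $ l $ j)) = (\<Sum>e\<in>UNIV. \<omega> x k a e * (\<Sum>l\<in>UNIV. Q x e l * J x $ l $ j))"
      by (subst sum.swap) (simp add: sum_distrib_left)
    finally show ?thesis unfolding QJ[OF x] .
  qed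
  have G2: "(\<Sum>i\<in>UNIV. Q x a i * (\<Sum>l\<in>UNIV. christoffel g l k j x * J x $ i $ l))
     = (\<Sum>l\<in>UNIV. christoffel g l k j x * pull1 (Q x) (\<iota> x a) l)" for a
    unfolding QJ[OF x, symmetric] sum_distrib_left by (subst sum.swap) (simp add: mult_ac)
  have "(\<Sum>i\<in>UNIV. Q x a i * nabla_endo g J k i j x) = 0" for a
  proof -
    have "(\<Sum>i\<in>UNIV. Q x a i * nabla_endo g J k i j x)
      = (\<Sum>i\<in>UNIV. Q x a i * D i) + (\<Sum>i\<in>UNIV. Q x a i * (\<Sum>l\<in>UNIV. christoffel g i k l x * J x $ l $ j))
       - (\<Sum>i\<in>UNIV. Q x a i * (\<Sum>l\<in>UNIV. christoffel g l k j x * J x $ i $ l))"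
      unfolding nabla_endo_def D_def[symmetric] by (simp add: sum.distrib sum_subtractf algebra_simps)
    also have "\<dots> = pull1 (Q x) (\<lambda>b. dk a b - (\<Sum>e\<in>UNIV. \<omega> x k e b * \<iota> x a e)) j + (\<Sum>e\<in>UNIV. \<omega> x k a e * pull1 (Q x) (\<iota> x e) j)"
      unfolding dJ G1 G2 nabla_pull1[OF x, symmetric] by simp
    also have "\<dots> = pull1 (Q x) (\<lambda>b. pull1 (Q x) (\<lambda>c. d\<iota> c a b + (\<Sum>e\<in>UNIV. \<gamma> x a c e * \<iota> x e b) - (\<Sum>e\<in>UNIV. \<gamma> x e c b * \<iota> x a e)) k) j"
      unfolding dk_def \<omega>_def by (simp add: pull_linear)
    also have "\<dots> = 0"
      unfolding parallel pull1_zero ..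
    finally show ?thesis .
  qed
  then show ?thesis
    using contract_PQ[OF x, of i "\<lambda>i. nabla_endo g J k i j x"] by simp
qed

end

section \<open>The ortho-toric frame and its curvature\<close>

definition sel4 :: "'a \<Rightarrow> 'a \<Rightarrow> 'a \<Rightarrow> 'a \<Rightarrow> 4 \<Rightarrow> 'a" where
  "sel4 p q r s i = (if i = 1 then p else if i = 2 then q else if i = 3 then r else s)"

lemma sel4_simps [simp]:
  "sel4 p q r s 1 = p" "sel4 p q r s 2 = q" "sel4 p q r s 3 = r" "sel4 p q r s 4 = s"
  by (simp_all add: sel4_def)

text \<open>The component on \<open>(a, b)\<close> of the elementary two-form \<open>\<theta>\<^sub>p \<and> \<theta>\<^sub>q\<close>.\<close>

definition bv :: "4 \<Rightarrow> 4 \<Rightarrow> 4 \<Rightarrow> 4 \<Rightarrow> real" where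
  "bv p q a b = (if a = p \<and> b = q then 1 else if a = q \<and> b = p then -1 else 0)"

definition ot_H :: "real \<Rightarrow> real \<Rightarrow> real \<Rightarrow> 4 \<Rightarrow> real" where
  "ot_H d f g = sel4 (d / f) (- d / g) (f / d) (- g / d)"

text \<open>Levi-Civita connection coefficients, in the order upper index, direction, lower index, of the diagonal metric multiplied by \<open>1 / d ^ (2 e)\<close>. The case \<open>e = 0\<close> is the given metric and \<open>e = 1\<close> its conformal companion. The conformal factor itself cancels, so a single table, linear in \<open>e\<close>, serves both metrics.\<close>

definition conn :: "real \<Rightarrow> real \<Rightarrow> real \<Rightarrow> real \<Rightarrow> real \<Rightarrow> real \<Rightarrow> 4 \<Rightarrow> 4 \<Rightarrow> 4 \<Rightarrow> real" where
  "conn e d f f1 g g1 = (sel4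
      (sel4
        (sel4 (- f1 / (2 * f) - (e - 1/2) / d) ((e - 1/2) / d) 0 0)
        (sel4 ((e - 1/2) / d) (- (e - 1/2) * f / (d * g)) 0 0)
        (sel4 0 0 (- f * f1 / (2 * d^2) + (e + 1/2) * f^2 / d^3) (- f * g / (2 * d^3)))
        (sel4 0 0 (- f * g / (2 * d^3)) (- (e - 1/2) * f * g / d^3)))
      (sel4
        (sel4 ((e - 1/2) * g / (d * f)) (- (e - 1/2) / d) 0 0)
        (sel4 (- (e - 1/2) / d) (- g1 / (2 * g) + (e - 1/2) / d) 0 0)
        (sel4 0 0 ((e - 1/2) * f * g / d^3) (f * g / (2 * d^3)))
        (sel4 0 0 (f * g / (2 * d^3)) (- g * g1 / (2 * d^2) - (e + 1/2) * g^2 / d^3)))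
      (sel4
        (sel4 0 0 (f1 / (2 * f) - (e + 1/2) / d) (g / (2 * d * f)))
        (sel4 0 0 ((e + 1/2) / d) (- 1 / (2 * d)))
        (sel4 (f1 / (2 * f) - (e + 1/2) / d) ((e - 1/2) / d) 0 0)
        (sel4 (g / (2 * d * f)) (1 / (2 * d)) 0 0))
      (sel4
        (sel4 0 0 (1 / (2 * d)) (- (e + 1/2) / d))
        (sel4 0 0 (- f / (2 * d * g)) (g1 / (2 * g) + (e + 1/2) / d))
        (sel4 (- 1 / (2 * d)) (- f / (2 * d * g)) 0 0)
        (sel4 (- (e - 1/2) / d) (g1 / (2 * g) + (e + 1/2) / d) 0 0)))"

text \<open>Derivatives of \<open>conn\<close> along the frame, the direction coming first. The last two directions contribute zero, since nothing depends on \<open>t\<close> and \<open>z\<close>.\<close>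

definition dconn ::
  "real \<Rightarrow> real \<Rightarrow> real \<Rightarrow> real \<Rightarrow> real \<Rightarrow> real \<Rightarrow> real \<Rightarrow> real \<Rightarrow> 4 \<Rightarrow> 4 \<Rightarrow> 4 \<Rightarrow> 4 \<Rightarrow> real" where
  "dconn e d f f1 f2 g g1 g2 = (sel4
      (sel4
        (sel4
          (sel4 (- f2 / (2 * f) + f1^2 / (2 * f^2) + (e - 1/2) / d^2) (- (e - 1/2) / d^2) 0 0)
          (sel4 (- (e - 1/2) / d^2) (- (e - 1/2) * f1 / (d * g) + (e - 1/2) * f / (d^2 * g)) 0 0)
          (sel4 0 0 (- f * f2 / (2 * d^2) - f1^2 / (2 * d^2) + 2 * (e + 1) * f * f1 / d^3 - 3 * (e + 1/2) * f^2 / d^4) (- f1 * g / (2 * d^3) + 3 * f * g / (2 * d^4)))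
          (sel4 0 0 (- f1 * g / (2 * d^3) + 3 * f * g / (2 * d^4)) (- (e - 1/2) * f1 * g / d^3 + 3 * (e - 1/2) * f * g / d^4)))
        (sel4
          (sel4 (- (e - 1/2) * f1 * g / (d * f^2) - (e - 1/2) * g / (d^2 * f)) ((e - 1/2) / d^2) 0 0)
          (sel4 ((e - 1/2) / d^2) (- (e - 1/2) / d^2) 0 0)
          (sel4 0 0 ((e - 1/2) * f1 * g / d^3 - 3 * (e - 1/2) * f * g / d^4) (f1 * g / (2 * d^3) - 3 * f * g / (2 * d^4)))
          (sel4 0 0 (f1 * g / (2 * d^3) - 3 * f * g / (2 * d^4)) (g * g1 / d^3 + 3 * (e + 1/2) * g^2 / d^4)))
        (sel4
          (sel4 0 0 (f2 / (2 * f) - f1^2 / (2 * f^2) + (e + 1/2) / d^2) (- f1 * g / (2 * d * f^2) - g / (2 * d^2 * f)))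
          (sel4 0 0 (- (e + 1/2) / d^2) (1 / (2 * d^2)))
          (sel4 (f2 / (2 * f) - f1^2 / (2 * f^2) + (e + 1/2) / d^2) (- (e - 1/2) / d^2) 0 0)
          (sel4 (- f1 * g / (2 * d * f^2) - g / (2 * d^2 * f)) (- 1 / (2 * d^2)) 0 0))
        (sel4
          (sel4 0 0 (- 1 / (2 * d^2)) ((e + 1/2) / d^2))
          (sel4 0 0 (- f1 / (2 * d * g) + f / (2 * d^2 * g)) (- (e + 1/2) / d^2))
          (sel4 (1 / (2 * d^2)) (- f1 / (2 * d * g) + f / (2 * d^2 * g)) 0 0)
          (sel4 ((e - 1/2) / d^2) (- (e + 1/2) / d^2) 0 0)))
      (sel4
        (sel4
          (sel4 (- (e - 1/2) / d^2) ((e - 1/2) / d^2) 0 0)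
          (sel4 ((e - 1/2) / d^2) ((e - 1/2) * f * g1 / (d * g^2) - (e - 1/2) * f / (d^2 * g)) 0 0)
          (sel4 0 0 (- f * f1 / d^3 + 3 * (e + 1/2) * f^2 / d^4) (- f * g1 / (2 * d^3) - 3 * f * g / (2 * d^4)))
          (sel4 0 0 (- f * g1 / (2 * d^3) - 3 * f * g / (2 * d^4)) (- (e - 1/2) * f * g1 / d^3 - 3 * (e - 1/2) * f * g / d^4)))
        (sel4
          (sel4 ((e - 1/2) * g1 / (d * f) + (e - 1/2) * g / (d^2 * f)) (- (e - 1/2) / d^2) 0 0)
          (sel4 (- (e - 1/2) / d^2) (- g2 / (2 * g) + g1^2 / (2 * g^2) + (e - 1/2) / d^2) 0 0)
          (sel4 0 0 ((e - 1/2) * f * g1 / d^3 + 3 * (e - 1/2) * f * g / d^4) (f * g1 / (2 * d^3) + 3 * f * g / (2 * d^4)))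
          (sel4 0 0 (f * g1 / (2 * d^3) + 3 * f * g / (2 * d^4)) (- g * g2 / (2 * d^2) - g1^2 / (2 * d^2) - 2 * (e + 1) * g * g1 / d^3 - 3 * (e + 1/2) * g^2 / d^4)))
        (sel4
          (sel4 0 0 (- (e + 1/2) / d^2) (g1 / (2 * d * f) + g / (2 * d^2 * f)))
          (sel4 0 0 ((e + 1/2) / d^2) (- 1 / (2 * d^2)))
          (sel4 (- (e + 1/2) / d^2) ((e - 1/2) / d^2) 0 0)
          (sel4 (g1 / (2 * d * f) + g / (2 * d^2 * f)) (1 / (2 * d^2)) 0 0))
        (sel4
          (sel4 0 0 (1 / (2 * d^2)) (- (e + 1/2) / d^2))
          (sel4 0 0 (f * g1 / (2 * d * g^2) - f / (2 * d^2 * g)) (g2 / (2 * g) - g1^2 / (2 * g^2) + (e + 1/2) / d^2))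
          (sel4 (- 1 / (2 * d^2)) (f * g1 / (2 * d * g^2) - f / (2 * d^2 * g)) 0 0)
          (sel4 (- (e - 1/2) / d^2) (g2 / (2 * g) - g1^2 / (2 * g^2) + (e + 1/2) / d^2) 0 0)))
      (\<lambda>_ _ _. 0)
      (\<lambda>_ _ _. 0))"

text \<open>Shape shared by the curvature, the Weyl tensor and its self-dual part. The three pairings \<open>13|24\<close>, \<open>12|34\<close>, \<open>14|23\<close> of the frame indices do not mix, and the fixed ratio of the \<open>q\<close>-terms expresses the first Bianchi identity together with the \<open>J\<close>-invariance.\<close>

definition riemann_table :: "real \<Rightarrow> real \<Rightarrow> real \<Rightarrow> real \<Rightarrow> (4 \<Rightarrow> real) \<Rightarrow> 4 \<Rightarrow> 4 \<Rightarrow> 4 \<Rightarrow> 4 \<Rightarrow> real" where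
  "riemann_table m n q p H a b c e =
     m * bv 1 3 a b * bv 1 3 c e + n * bv 2 4 a b * bv 2 4 c e
     - q / 2 * (bv 1 3 a b * bv 2 4 c e + bv 2 4 a b * bv 1 3 c e)
     - q / 4 * (bv 1 2 a b * bv 3 4 c e + bv 3 4 a b * bv 1 2 c e + bv 1 4 a b * bv 2 3 c e + bv 2 3 a b * bv 1 4 c e)
     - p / 4 * (H 1 * H 2 * bv 1 2 a b * bv 1 2 c e + H 3 * H 4 * bv 3 4 a b * bv 3 4 c e
              + H 1 * H 4 * bv 1 4 a b * bv 1 4 c e + H 2 * H 3 * bv 2 3 a b * bv 2 3 c e)"

lemma frame_riemann_swap: "frame_riemann \<gamma> d\<gamma> b a c e = - frame_riemann \<gamma> d\<gamma> a b c e"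
  unfolding frame_riemann_def minus_add_distrib minus_diff_eq sum_negf[symmetric]
  by (simp add: algebra_simps)

lemma riemann_table_swap: "riemann_table m n q p H b a c e = - riemann_table m n q p H a b c e"
proof -
  have "bv i j b a = - bv i j a b" if "i \<noteq> j" for i j
    using that by (auto simp: bv_def)
  then show ?thesis unfolding riemann_table_def by (simp add: algebra_simps)
qed

text \<open>By antisymmetry only the six index pairs with \<open>a < b\<close> need to be computed.\<close>

lemma frame_riemann_conn:
  fixes d f g f1 f2 g1 g2 :: real
  assumes nz: "d \<noteq> 0" "f \<noteq> 0" "g \<noteq> 0"
  defines "q \<equiv> (f1 + g1) / d^2 - 2 * (f - g) / d^3"
  shows "frame_riemann (conn 0 d f f1 g g1) (dconn 0 d f f1 f2 g g1 g2) a b c e * ot_H d f g e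
    = riemann_table (- f2 / (2 * d) + f1 / d^2 - (f - g) / d^3) (g2 / (2 * d) + g1 / d^2 - (f - g) / d^3) q q
        (ot_H d f g) a b c e" (is "?L a b c e = ?R a b c e")
proof -
  note defs = frame_riemann_def sum_4 conn_def dconn_def ot_H_def riemann_table_def bv_def q_def
  have all_12: "\<forall>c e. ?L 1 2 c e = ?R 1 2 c e"
    unfolding forall_4 defs
    by (intro conjI; simp add: nz; simp add: field_simps nz eval_nat_numeral)
  have all_13: "\<forall>c e. ?L 1 3 c e = ?R 1 3 c e"
    unfolding forall_4 defs
    by (intro conjI; simp add: nz; simp add: field_simps nz eval_nat_numeral)
  have all_14: "\<forall>c e. ?L 1 4 c e = ?R 1 4 c e"
    unfolding forall_4 defs
    by (intro conjI; simp add: nz; simp add: field_simps nz eval_nat_numeral)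
  have all_23: "\<forall>c e. ?L 2 3 c e = ?R 2 3 c e"
    unfolding forall_4 defs
    by (intro conjI; simp add: nz; simp add: field_simps nz eval_nat_numeral)
  have all_24: "\<forall>c e. ?L 2 4 c e = ?R 2 4 c e"
    unfolding forall_4 defs
    by (intro conjI; simp add: nz; simp add: field_simps nz eval_nat_numeral)
  have all_34: "\<forall>c e. ?L 3 4 c e = ?R 3 4 c e"
    unfolding forall_4 defs
    by (intro conjI; simp add: nz; simp add: field_simps nz eval_nat_numeral)
  have swap: "?L b a c e = ?R b a c e" if "?L a b c e = ?R a b c e" for a b c e
    using that frame_riemann_swap[of _ _ b a c e] riemann_table_swap[of _ _ _ _ _ b a c e] by simp
  have diag: "?L a a c e = ?R a a c e" for a c e
    using frame_riemann_swap[of _ _ a a c e] riemann_table_swap[of _ _ _ _ _ a a c e]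
    by (metis add.inverse_neutral equal_neg_zero mult_zero_left)
  show ?thesis
    using exhaust_4[of a] exhaust_4[of b]
    by (elim disjE; hypsubst; intro diag all_12[rule_format] all_13[rule_format] all_14[rule_format]
      all_23[rule_format] all_24[rule_format] all_34[rule_format] swap)
qed

text \<open>The scalar curvature of the conformal metric, up to the conformal factor.\<close>

lemma frame_riemann_trace_conformal:
  fixes d f g f1 f2 g1 g2 :: real
  assumes nz: "d \<noteq> 0" "f \<noteq> 0" "g \<noteq> 0"
  shows "(\<Sum>a\<in>UNIV. (\<Sum>b\<in>UNIV. frame_riemann (conn 1 d f f1 g g1) (dconn 1 d f f1 f2 g g1 g2) a b a b) / ot_H d f g a)
    = (g2 - f2) / d + 6 * (f1 + g1) / d^2 - 12 * (f - g) / d^3"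
proof -
  note defs = frame_riemann_def sum_4 conn_def dconn_def ot_H_def
  have "(\<Sum>b\<in>UNIV. frame_riemann (conn 1 d f f1 g g1) (dconn 1 d f f1 f2 g g1 g2) a b a b) / ot_H d f g a
     = (if a = 1 \<or> a = 3 then - f2 / (2 * d) + (5 * f1 + g1) / (2 * d^2) - (4 * f - 2 * g) / d^3
        else g2 / (2 * d) + (f1 + 5 * g1) / (2 * d^2) - (2 * f - 4 * g) / d^3)" for a
  proof -
    have "\<forall>a. (\<Sum>b\<in>UNIV. frame_riemann (conn 1 d f f1 g g1) (dconn 1 d f f1 f2 g g1 g2) a b a b) / ot_H d f g a
     = (if a = 1 \<or> a = 3 then - f2 / (2 * d) + (5 * f1 + g1) / (2 * d^2) - (4 * f - 2 * g) / d^3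
        else g2 / (2 * d) + (f1 + 5 * g1) / (2 * d^2) - (2 * f - 4 * g) / d^3)"
      unfolding forall_4 defs
      by (intro conjI; simp add: nz; simp add: field_simps nz eval_nat_numeral)
    then show ?thesis by blast
  qed
  then show ?thesis
    using nz by (simp add: sum_4 field_simps eval_nat_numeral)
qed

section \<open>Schouten, Cotton and Bach tensors for quartic functions\<close>

text \<open>Eigenvalues of the Schouten tensor for quartic \<open>F, G\<close>, written in terms of \<open>d = \<xi> - \<eta>\<close>, \<open>u = \<xi> + \<eta>\<close> and \<open>\<beta> = B\<^sub>1 - B\<^sub>2\<close>.\<close>

definition schouten_diag :: "real \<Rightarrow> real \<Rightarrow> real \<Rightarrow> real \<Rightarrow> real \<Rightarrow> 4 \<Rightarrow> real" where
  "schouten_diag k l \<beta> d u = sel4 ((\<beta> / d^2 - 2 * k * (u + d) - l) / 4) ((- \<beta> / d^2 - 2 * k * (u - d) - l) / 4)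
     ((\<beta> / d^2 - 2 * k * (u + d) - l) / 4) ((- \<beta> / d^2 - 2 * k * (u - d) - l) / 4)"

definition dschouten :: "real \<Rightarrow> real \<Rightarrow> real \<Rightarrow> real \<Rightarrow> real \<Rightarrow> real \<Rightarrow> real \<Rightarrow> real \<Rightarrow> real \<Rightarrow> 4 \<Rightarrow> 4 \<Rightarrow> real" where
  "dschouten k l \<beta> d u f f1 g g1 = (sel4
    (sel4
      (d^2 * f1 * k / (2 * f^2) - 3 * d * k / (2 * f) + d * f1 * k * u / (2 * f^2) + d * f1 * l / (4 * f^2) - k * u / (2 * f) - l / (4 * f) - f1 * \<beta> / (4 * d * f^2) - \<beta> / (4 * d^2 * f))
      (- d * k / (2 * g) + k * u / (2 * g) + l / (4 * g) - \<beta> / (4 * d^2 * g))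
      (- f1 * k / 2 - f * k / (2 * d) - f1 * k * u / (2 * d) - f1 * l / (4 * d) + f * k * u / (2 * d^2) + f * l / (4 * d^2) + f1 * \<beta> / (4 * d^3) - 3 * f * \<beta> / (4 * d^4))
      (g * k / (2 * d) - g * k * u / (2 * d^2) - g * l / (4 * d^2) - 3 * g * \<beta> / (4 * d^4)))
    (sel4
      (d * k / (2 * f) + k * u / (2 * f) + l / (4 * f) + \<beta> / (4 * d^2 * f))
      (d^2 * g1 * k / (2 * g^2) + 3 * d * k / (2 * g) - d * g1 * k * u / (2 * g^2) - d * g1 * l / (4 * g^2) - k * u / (2 * g) - l / (4 * g) - g1 * \<beta> / (4 * d * g^2) + \<beta> / (4 * d^2 * g))
      (- f * k / (2 * d) - f * k * u / (2 * d^2) - f * l / (4 * d^2) + 3 * f * \<beta> / (4 * d^4))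
      (- g1 * k / 2 + g * k / (2 * d) + g1 * k * u / (2 * d) + g1 * l / (4 * d) + g * k * u / (2 * d^2) + g * l / (4 * d^2) + g1 * \<beta> / (4 * d^3) + 3 * g * \<beta> / (4 * d^4)))
    (\<lambda>_. 0) (\<lambda>_. 0))"

definition cotton_form where
  "cotton_form t12 t13 t14 t23 t24 t34 i j c = bv 1 2 i j * t12 c + bv 1 3 i j * t13 c + bv 1 4 i j * t14 c
     + bv 2 3 i j * t23 c + bv 2 4 i j * t24 c + bv 3 4 i j * t34 (c::4)"

text \<open>The parameter \<open>l\<close> and the remaining coefficients of the quartics enter the Cotton tensor only through the values of \<open>F\<close> and \<open>G\<close>.\<close>

definition cotton_table :: "real \<Rightarrow> real \<Rightarrow> real \<Rightarrow> real \<Rightarrow> real \<Rightarrow> 4 \<Rightarrow> 4 \<Rightarrow> 4 \<Rightarrow> real" where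
  "cotton_table k \<beta> d f g = cotton_form
      (sel4 (d * k / (2 * f) + \<beta> / (4 * d^2 * f)) (d * k / (2 * g) + \<beta> / (4 * d^2 * g)) 0 0)
      (sel4 0 0 (f * k / d + f * \<beta> / (2 * d^4)) (- g * k / d + g * \<beta> / (2 * d^4)))
      (sel4 0 0 (- g * k / (2 * d) + g * \<beta> / (4 * d^4)) (g * k / (2 * d) + g * \<beta> / (4 * d^4)))
      (sel4 0 0 (- f * k / (2 * d) - f * \<beta> / (4 * d^4)) (f * k / (2 * d) - f * \<beta> / (4 * d^4)))
      (sel4 0 0 (f * k / d - f * \<beta> / (2 * d^4)) (- g * k / d - g * \<beta> / (2 * d^4)))
      (sel4 (g * k / (2 * d) - g * \<beta> / (4 * d^4)) (f * k / (2 * d) - f * \<beta> / (4 * d^4)) 0 0)"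

definition dcotton :: "real \<Rightarrow> real \<Rightarrow> real \<Rightarrow> real \<Rightarrow> real \<Rightarrow> real \<Rightarrow> real \<Rightarrow> 4 \<Rightarrow> 4 \<Rightarrow> 4 \<Rightarrow> 4 \<Rightarrow> real" where
  "dcotton k \<beta> d f f1 g g1 = (sel4
    (cotton_form
      (sel4 (- d * f1 * k / (2 * f^2) + k / (2 * f) - f1 * \<beta> / (4 * d^2 * f^2) - \<beta> / (2 * d^3 * f)) (k / (2 * g) - \<beta> / (2 * d^3 * g)) 0 0)
      (sel4 0 0 (f1 * k / d - f * k / d^2 + f1 * \<beta> / (2 * d^4) - 2 * f * \<beta> / d^5) (g * k / d^2 - 2 * g * \<beta> / d^5))
      (sel4 0 0 (g * k / (2 * d^2) - g * \<beta> / d^5) (- g * k / (2 * d^2) - g * \<beta> / d^5))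
      (sel4 0 0 (- f1 * k / (2 * d) + f * k / (2 * d^2) - f1 * \<beta> / (4 * d^4) + f * \<beta> / d^5) (f1 * k / (2 * d) - f * k / (2 * d^2) - f1 * \<beta> / (4 * d^4) + f * \<beta> / d^5))
      (sel4 0 0 (f1 * k / d - f * k / d^2 - f1 * \<beta> / (2 * d^4) + 2 * f * \<beta> / d^5) (g * k / d^2 + 2 * g * \<beta> / d^5))
      (sel4 (- g * k / (2 * d^2) + g * \<beta> / d^5) (f1 * k / (2 * d) - f * k / (2 * d^2) - f1 * \<beta> / (4 * d^4) + f * \<beta> / d^5) 0 0))
    (cotton_form
      (sel4 (- k / (2 * f) + \<beta> / (2 * d^3 * f)) (- d * g1 * k / (2 * g^2) - k / (2 * g) - g1 * \<beta> / (4 * d^2 * g^2) + \<beta> / (2 * d^3 * g)) 0 0)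
      (sel4 0 0 (f * k / d^2 + 2 * f * \<beta> / d^5) (- g1 * k / d - g * k / d^2 + g1 * \<beta> / (2 * d^4) + 2 * g * \<beta> / d^5))
      (sel4 0 0 (- g1 * k / (2 * d) - g * k / (2 * d^2) + g1 * \<beta> / (4 * d^4) + g * \<beta> / d^5) (g1 * k / (2 * d) + g * k / (2 * d^2) + g1 * \<beta> / (4 * d^4) + g * \<beta> / d^5))
      (sel4 0 0 (- f * k / (2 * d^2) - f * \<beta> / d^5) (f * k / (2 * d^2) - f * \<beta> / d^5))
      (sel4 0 0 (f * k / d^2 - 2 * f * \<beta> / d^5) (- g1 * k / d - g * k / d^2 - g1 * \<beta> / (2 * d^4) - 2 * g * \<beta> / d^5))
      (sel4 (g1 * k / (2 * d) + g * k / (2 * d^2) - g1 * \<beta> / (4 * d^4) - g * \<beta> / d^5) (f * k / (2 * d^2) - f * \<beta> / d^5) 0 0))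
    (\<lambda>_ _ _. 0) (\<lambda>_ _ _. 0))"

definition diag4 :: "(4 \<Rightarrow> real) \<Rightarrow> 4 \<Rightarrow> 4 \<Rightarrow> real" where
  "diag4 h a b = (if a = b then h a else 0)"

lemma cotton_table_eq:
  fixes d f g f1 g1 k l \<beta> u :: real
  assumes nz: "d \<noteq> 0" "f \<noteq> 0" "g \<noteq> 0"
  defines "N \<equiv> frame_nabla2 (conn 0 d f f1 g g1) (diag4 (\<lambda>a. schouten_diag k l \<beta> d u a * ot_H d f g a))
      (\<lambda>c. diag4 (dschouten k l \<beta> d u f f1 g g1 c))"
  shows "cotton_table k \<beta> d f g a b c = - N a b c + N b a c"
proof -
  have "\<forall>a b c. cotton_table k \<beta> d f g a b c = - N a b c + N b a c"
    unfolding forall_4 N_def frame_nabla2_def sum_4 conn_def diag4_def schouten_diag_def dschouten_def ot_H_def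
      cotton_table_def cotton_form_def bv_def
    by (intro conjI; simp add: nz; simp add: field_simps nz eval_nat_numeral)
  then show ?thesis by blast
qed

text \<open>The terms \<open>\<nabla>\<^sub>m C\<^sub>m\<^sub>a\<^sub>c / H\<^sub>m\<close>, whose sum over \<open>m\<close> is the divergence of the Cotton tensor. They are tabulated one by one because the derivatives of \<open>F\<close> and \<open>G\<close> combine into \<open>q\<close> only in the sum.\<close>

definition laplace_cotton :: "real \<Rightarrow> real \<Rightarrow> real \<Rightarrow> real \<Rightarrow> real \<Rightarrow> real \<Rightarrow> real \<Rightarrow> 4 \<Rightarrow> 4 \<Rightarrow> 4 \<Rightarrow> real" where
  "laplace_cotton k \<beta> d f f1 g g1 = (sel4
      (sel4
        (\<lambda>_. 0)
        (sel4 (- 3 * \<beta> / (4 * d^4)) (f1 * k / (4 * g) - f * k / (4 * d * g) + k / (4 * d) + f1 * \<beta> / (8 * d^3 * g) - 7 * f * \<beta> / (8 * d^4 * g) + \<beta> / (8 * d^4)) 0 0)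
        (sel4 0 0 (f * f1 * k / (2 * d^2) - f^2 * k / (2 * d^3) + f * g * k / (2 * d^3) + f * f1 * \<beta> / (4 * d^5) - 7 * f^2 * \<beta> / (4 * d^6) - f * g * \<beta> / (2 * d^6)) (- 9 * f * g * \<beta> / (4 * d^6)))
        (sel4 0 0 (- 3 * f * g * \<beta> / (2 * d^6)) (f1 * g * k / (4 * d^2) - f * g * k / (4 * d^3) + g^2 * k / (4 * d^3) + f1 * g * \<beta> / (8 * d^5) - 7 * f * g * \<beta> / (8 * d^6) - 5 * g^2 * \<beta> / (8 * d^6))))
      (sel4
        (sel4 (g1 * k / (4 * f) - k / (4 * d) + g * k / (4 * d * f) + g1 * \<beta> / (8 * d^3 * f) - \<beta> / (8 * d^4) + 7 * g * \<beta> / (8 * d^4 * f)) (3 * \<beta> / (4 * d^4)) 0 0)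
        (\<lambda>_. 0)
        (sel4 0 0 (f * g1 * k / (4 * d^2) - f^2 * k / (4 * d^3) + f * g * k / (4 * d^3) + f * g1 * \<beta> / (8 * d^5) + 5 * f^2 * \<beta> / (8 * d^6) + 7 * f * g * \<beta> / (8 * d^6)) (3 * f * g * \<beta> / (2 * d^6)))
        (sel4 0 0 (9 * f * g * \<beta> / (4 * d^6)) (g * g1 * k / (2 * d^2) - f * g * k / (2 * d^3) + g^2 * k / (2 * d^3) + g * g1 * \<beta> / (4 * d^5) + f * g * \<beta> / (2 * d^6) + 7 * g^2 * \<beta> / (4 * d^6))))
      (sel4
        (sel4 (f1 * k / (2 * f) - k / (2 * d) + g * k / (2 * d * f) + f1 * \<beta> / (4 * d^3 * f) - \<beta> / (4 * d^4) - g * \<beta> / (2 * d^4 * f)) (- 3 * \<beta> / (4 * d^4)) 0 0)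
        (sel4 0 (f1 * k / (4 * g) - f * k / (4 * d * g) + k / (4 * d) + f1 * \<beta> / (8 * d^3 * g) - f * \<beta> / (8 * d^4 * g) + \<beta> / (8 * d^4)) 0 0)
        (\<lambda>_. 0)
        (sel4 0 0 (- 3 * f * g * \<beta> / (4 * d^6)) (f1 * g * k / (4 * d^2) - f * g * k / (4 * d^3) + g^2 * k / (4 * d^3) + f1 * g * \<beta> / (8 * d^5) - f * g * \<beta> / (8 * d^6) - 5 * g^2 * \<beta> / (8 * d^6))))
      (sel4
        (sel4 (g1 * k / (4 * f) - k / (4 * d) + g * k / (4 * d * f) + g1 * \<beta> / (8 * d^3 * f) - \<beta> / (8 * d^4) + g * \<beta> / (8 * d^4 * f)) 0 0 0)
        (sel4 (3 * \<beta> / (4 * d^4)) (g1 * k / (2 * g) - f * k / (2 * d * g) + k / (2 * d) + g1 * \<beta> / (4 * d^3 * g) + f * \<beta> / (2 * d^4 * g) + \<beta> / (4 * d^4)) 0 0)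
        (sel4 0 0 (f * g1 * k / (4 * d^2) - f^2 * k / (4 * d^3) + f * g * k / (4 * d^3) + f * g1 * \<beta> / (8 * d^5) + 5 * f^2 * \<beta> / (8 * d^6) + f * g * \<beta> / (8 * d^6)) (3 * f * g * \<beta> / (4 * d^6)))
        (\<lambda>_. 0)))"

lemma frame_nabla3_cotton:
  fixes d f g f1 g1 k l \<beta> u :: real
  assumes nz: "d \<noteq> 0" "f \<noteq> 0" "g \<noteq> 0"
  shows "frame_nabla3 (conn 0 d f f1 g g1) (cotton_table k \<beta> d f g) (dcotton k \<beta> d f f1 g g1) m m a c / ot_H d f g m
     = laplace_cotton k \<beta> d f f1 g g1 m a c"
proof -
  have "\<forall>m a c. frame_nabla3 (conn 0 d f f1 g g1) (cotton_table k \<beta> d f g) (dcotton k \<beta> d f f1 g g1) m m a c / ot_H d f g m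
     = laplace_cotton k \<beta> d f f1 g g1 m a c"
    unfolding forall_4 frame_nabla3_def sum_4 conn_def ot_H_def
      cotton_table_def dcotton_def cotton_form_def bv_def laplace_cotton_def
    by (intro conjI; simp add: nz; simp add: field_simps nz eval_nat_numeral)
  then show ?thesis by blast
qed

lemma sum_laplace_cotton:
  fixes d f g f1 g1 k \<beta> :: real
  assumes nz: "d \<noteq> 0" "f \<noteq> 0" "g \<noteq> 0"
  defines "q \<equiv> (f1 + g1) / d^2 - 2 * (f - g) / d^3"
  shows "(\<Sum>m\<in>UNIV. laplace_cotton k \<beta> d f f1 g g1 m a c)
    = diag4 (\<lambda>a. sel4 1 (-1) 1 (-1) a * ot_H d f g a * (q * (d * k / 2 + \<beta> / (4 * d^2)))) a c"
proof -
  have "\<forall>a c. (\<Sum>m\<in>UNIV. laplace_cotton k \<beta> d f f1 g g1 m a c)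
    = diag4 (\<lambda>a. sel4 1 (-1) 1 (-1) a * ot_H d f g a * (q * (d * k / 2 + \<beta> / (4 * d^2)))) a c"
    unfolding forall_4 sum_4 diag4_def ot_H_def laplace_cotton_def q_def
    by (intro conjI; simp add: nz; simp add: field_simps nz eval_nat_numeral)
  then show ?thesis by blast
qed

text \<open>Contraction of a Weyl-type tensor with a \<open>J\<close>-invariant diagonal form with eigenvalues \<open>L, M\<close>: being tracefree, the Weyl tensor sees only \<open>L - M\<close>.\<close>

lemma trace_riemann_table:
  fixes d f g s q L M :: real
  assumes nz: "d \<noteq> 0" "f \<noteq> 0" "g \<noteq> 0"
  shows "(\<Sum>m\<in>UNIV. sel4 L M L M m * riemann_table (s + q / 2) (s + q / 2) q (q + 2 * s) (ot_H d f g) m a m c / ot_H d f g m)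
    = diag4 (\<lambda>a. sel4 1 (-1) 1 (-1) a * ot_H d f g a * ((s + q / 2) * (L - M))) a c"
proof -
  have "\<forall>a c. (\<Sum>m\<in>UNIV. sel4 L M L M m * riemann_table (s + q / 2) (s + q / 2) q (q + 2 * s) (ot_H d f g) m a m c / ot_H d f g m)
    = diag4 (\<lambda>a. sel4 1 (-1) 1 (-1) a * ot_H d f g a * ((s + q / 2) * (L - M))) a c"
    unfolding forall_4 sum_4 diag4_def ot_H_def riemann_table_def bv_def
    by (intro conjI; simp add: nz; simp add: field_simps nz)
  then show ?thesis by blast
qed

lemma sum_schouten_weyl:
  fixes d f g k l \<beta> u s q :: real
  assumes nz: "d \<noteq> 0" "f \<noteq> 0" "g \<noteq> 0"
  shows "(\<Sum>m\<in>UNIV. (\<Sum>e\<in>UNIV. diag4 (\<lambda>a. schouten_diag k l \<beta> d u a * ot_H d f g a) m e / ot_H d f g e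
        * riemann_table (s + q / 2) (s + q / 2) q (q + 2 * s) (ot_H d f g) m a e c) / ot_H d f g m)
    = diag4 (\<lambda>a. sel4 1 (-1) 1 (-1) a * ot_H d f g a * ((s + q / 2) * (\<beta> / (2 * d^2) - d * k))) a c"
proof -
  have "ot_H d f g m \<noteq> 0" for m
    using exhaust_4[of m] nz by (auto simp: ot_H_def)
  then have "(\<Sum>e\<in>UNIV. diag4 (\<lambda>a. schouten_diag k l \<beta> d u a * ot_H d f g a) m e / ot_H d f g e * W e)
      = schouten_diag k l \<beta> d u m * W m" for m and W :: "4 \<Rightarrow> real"
    by (simp add: diag4_def if_distrib[where f = "\<lambda>z. z / _"] if_distrib[where f = "\<lambda>z. z * _"] cong: if_cong)
  moreover have "(\<beta> / d^2 - 2 * k * (u + d) - l) / 4 - (- \<beta> / d^2 - 2 * k * (u - d) - l) / 4 = \<beta> / (2 * d^2) - d * k"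
    by (simp add: field_simps)
  ultimately show ?thesis
    using trace_riemann_table[OF nz] unfolding schouten_diag_def by simp
qed

text \<open>The divergence of the Cotton tensor contributes \<open>q (d k / 2 + \<beta> / (4 d\<^sup>2))\<close> and the Weyl term \<open>(s + q / 2) (\<beta> / (2 d\<^sup>2) - d k)\<close>; in the difference \<open>q\<close> is left only with the factor \<open>k\<close>.\<close>

lemma frame_bach_table:
  fixes d f g f1 g1 k l \<beta> u :: real
  assumes nz: "d \<noteq> 0" "f \<noteq> 0" "g \<noteq> 0"
  defines "q \<equiv> (f1 + g1) / d^2 - 2 * (f - g) / d^3" and "s \<equiv> - 2 * k * u - l"
  shows "frame_bach (conn 0 d f f1 g g1) (ot_H d f g) (diag4 (\<lambda>a. schouten_diag k l \<beta> d u a * ot_H d f g a))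
      (riemann_table (s + q / 2) (s + q / 2) q (q + 2 * s) (ot_H d f g)) (cotton_table k \<beta> d f g) (dcotton k \<beta> d f f1 g g1) a c
    = diag4 (\<lambda>a. sel4 1 (-1) 1 (-1) a * ot_H d f g a * (\<beta> * s / (2 * d^2) - d * k * (q + s))) a c"
proof -
  have "frame_bach (conn 0 d f f1 g g1) (ot_H d f g) (diag4 (\<lambda>a. schouten_diag k l \<beta> d u a * ot_H d f g a))
      (riemann_table (s + q / 2) (s + q / 2) q (q + 2 * s) (ot_H d f g)) (cotton_table k \<beta> d f g) (dcotton k \<beta> d f f1 g g1) a c
    = (\<Sum>m\<in>UNIV. (\<Sum>e\<in>UNIV. diag4 (\<lambda>a. schouten_diag k l \<beta> d u a * ot_H d f g a) m e / ot_H d f g e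
        * riemann_table (s + q / 2) (s + q / 2) q (q + 2 * s) (ot_H d f g) m a e c) / ot_H d f g m)
      - (\<Sum>m\<in>UNIV. laplace_cotton k \<beta> d f f1 g g1 m a c)"
    unfolding frame_bach_def frame_nabla3_cotton[OF nz, symmetric] sum_subtractf[symmetric]
    by (simp add: add_divide_distrib diff_divide_distrib)
  also have "\<dots> = diag4 (\<lambda>a. sel4 1 (-1) 1 (-1) a * ot_H d f g a * (\<beta> * s / (2 * d^2) - d * k * (q + s))) a c"
    unfolding sum_schouten_weyl[OF nz] sum_laplace_cotton[OF nz] q_def[symmetric]
    using nz(1) by (simp add: diag4_def field_simps eval_nat_numeral)
  finally show ?thesis .
qed

section \<open>The ortho-toric coframe in coordinates\<close>

definition ot_Q :: "real^4 \<Rightarrow> 4 \<Rightarrow> 4 \<Rightarrow> real" where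
  "ot_Q y = sel4 (sel4 1 0 0 0) (sel4 0 1 0 0) (sel4 0 0 1 (y $ 2)) (sel4 0 0 1 (y $ 1))"

definition ot_P :: "real^4 \<Rightarrow> 4 \<Rightarrow> 4 \<Rightarrow> real" where
  "ot_P y = (let d = y $ 1 - y $ 2 in
     sel4 (sel4 1 0 0 0) (sel4 0 1 0 0) (sel4 0 0 (y $ 1 / d) (- y $ 2 / d)) (sel4 0 0 (- 1 / d) (1 / d)))"

definition ot_dQ :: "4 \<Rightarrow> 4 \<Rightarrow> 4 \<Rightarrow> real" where
  "ot_dQ k a i = (if (k = 2 \<and> a = 3 \<or> k = 1 \<and> a = 4) \<and> i = 4 then 1 else 0)"

lemma has_partial_two_variables:
  assumes "((\<lambda>u. \<phi> u (x $ 2)) has_real_derivative A) (at (x $ 1))"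
    and "((\<lambda>v. \<phi> (x $ 1) v) has_real_derivative B) (at (x $ 2))"
  shows "has_partial k (\<lambda>y. \<phi> (y $ 1) (y $ 2)) (sel4 A B 0 0 k) x"
proof -
  have 1: "((\<lambda>h. \<phi> (x $ 1 + h) (x $ 2)) has_real_derivative A) (at 0)"
    using DERIV_shift[of "\<lambda>u. \<phi> u (x $ 2)" A 0 "x $ 1"] assms(1) by (simp add: add.commute)
  have 2: "((\<lambda>h. \<phi> (x $ 1) (x $ 2 + h)) has_real_derivative B) (at 0)"
    using DERIV_shift[of "\<lambda>v. \<phi> (x $ 1) v" B 0 "x $ 2"] assms(2) by (simp add: add.commute)
  have "\<forall>k. has_partial k (\<lambda>y. \<phi> (y $ 1) (y $ 2)) (sel4 A B 0 0 k) x"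
    unfolding forall_4 has_partial_def using 1 2 by (simp add: axis_def)
  then show ?thesis by blast
qed

lemma pull1_ot_Q: "pull1 (ot_Q x) (sel4 A B 0 0) k = sel4 A B 0 0 k"
proof -
  have "\<forall>k. pull1 (ot_Q x) (sel4 A B 0 0) k = sel4 A B 0 0 k"
    unfolding forall_4 pull1_def sum_4 ot_Q_def by simp
  then show ?thesis by blast
qed

text \<open>A function of \<open>\<xi>, \<eta>\<close> alone has coordinate derivatives equal to its frame derivatives, because the first two frame fields are \<open>\<partial>\<^sub>\<xi>, \<partial>\<^sub>\<eta>\<close>.\<close>

lemma has_partial_frame:
  assumes "((\<lambda>u. \<phi> u (x $ 2)) has_real_derivative D 1) (at (x $ 1))"
    and "((\<lambda>v. \<phi> (x $ 1) v) has_real_derivative D 2) (at (x $ 2))"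
    and "D 3 = 0" "D 4 = 0"
  shows "has_partial k (\<lambda>y. \<phi> (y $ 1) (y $ 2)) (pull1 (ot_Q x) D k) x"
proof -
  have "D e = sel4 (D 1) (D 2) 0 0 e" for e
    using assms(3,4) exhaust_4[of e] by auto
  then have D: "D = sel4 (D 1) (D 2) 0 0"
    by (rule ext)
  show ?thesis
    by (subst D, subst pull1_ot_Q) (rule has_partial_two_variables[OF assms(1,2)])
qed

lemma dconn_12_only: "dconn e d f f1 f2 g g1 g2 3 a c b = 0" "dconn e d f f1 f2 g g1 g2 4 a c b = 0"
  by (simp_all add: dconn_def)

lemma conn_derivative_1:
  assumes nz: "D u \<noteq> 0" "F u \<noteq> 0" "g \<noteq> 0"
    and D: "(D has_real_derivative 1) (at u)"
    and F: "(F has_real_derivative F1 u) (at u)" and F1: "(F1 has_real_derivative f2) (at u)"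
  shows "((\<lambda>u. conn e (D u) (F u) (F1 u) g g1 a c b) has_real_derivative
    dconn e (D u) (F u) (F1 u) f2 g g1 g2 1 a c b) (at u)"
proof -
  have "\<forall>a c b. ((\<lambda>u. conn e (D u) (F u) (F1 u) g g1 a c b) has_real_derivative
    dconn e (D u) (F u) (F1 u) f2 g g1 g2 1 a c b) (at u)"
    unfolding forall_4 conn_def dconn_def
    by (intro conjI; simp;
        rule DERIV_cong, (auto intro!: derivative_eq_intros D F F1 simp: nz)[1]; use nz in \<open>simp add: field_simps eval_nat_numeral\<close>)
  then show ?thesis by blast
qed

lemma conn_derivative_2:
  assumes nz: "D v \<noteq> 0" "f \<noteq> 0" "G v \<noteq> 0"
    and D: "(D has_real_derivative - 1) (at v)"
    and G: "(G has_real_derivative G1 v) (at v)" and G1: "(G1 has_real_derivative g2) (at v)"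
  shows "((\<lambda>v. conn e (D v) f f1 (G v) (G1 v) a c b) has_real_derivative
    dconn e (D v) f f1 f2 (G v) (G1 v) g2 2 a c b) (at v)"
proof -
  have "\<forall>a c b. ((\<lambda>v. conn e (D v) f f1 (G v) (G1 v) a c b) has_real_derivative
    dconn e (D v) f f1 f2 (G v) (G1 v) g2 2 a c b) (at v)"
    unfolding forall_4 conn_def dconn_def
    by (intro conjI; simp;
        rule DERIV_cong, (auto intro!: derivative_eq_intros D G G1 simp: nz)[1]; use nz in \<open>simp add: field_simps eval_nat_numeral\<close>)
  then show ?thesis by blast
qed

definition dot_H :: "real \<Rightarrow> real \<Rightarrow> real \<Rightarrow> real \<Rightarrow> real \<Rightarrow> 4 \<Rightarrow> 4 \<Rightarrow> real" where
  "dot_H d f f1 g g1 = sel4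
     (sel4 (1 / f - d * f1 / f^2) (- 1 / g) (f1 / d - f / d^2) (g / d^2))
     (sel4 (- 1 / f) (1 / g + d * g1 / g^2) (f / d^2) (- g1 / d - g / d^2))
     (\<lambda>_. 0) (\<lambda>_. 0)"

lemma ot_H_derivative_1:
  assumes nz: "D u \<noteq> 0" "F u \<noteq> 0" "g \<noteq> 0"
    and D: "(D has_real_derivative 1) (at u)" and F: "(F has_real_derivative f1) (at u)"
  shows "((\<lambda>u. ot_H (D u) (F u) g a) has_real_derivative dot_H (D u) (F u) f1 g g1 1 a) (at u)"
proof -
  have "\<forall>a. ((\<lambda>u. ot_H (D u) (F u) g a) has_real_derivative dot_H (D u) (F u) f1 g g1 1 a) (at u)"
    unfolding forall_4 ot_H_def dot_H_def
    by (intro conjI; simp;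
        rule DERIV_cong, (auto intro!: derivative_eq_intros D F simp: nz)[1]; use nz in \<open>simp add: field_simps eval_nat_numeral\<close>)
  then show ?thesis by blast
qed

lemma ot_H_derivative_2:
  assumes nz: "D v \<noteq> 0" "f \<noteq> 0" "G v \<noteq> 0"
    and D: "(D has_real_derivative - 1) (at v)" and G: "(G has_real_derivative g1) (at v)"
  shows "((\<lambda>v. ot_H (D v) f (G v) a) has_real_derivative dot_H (D v) f f1 (G v) g1 2 a) (at v)"
proof -
  have "\<forall>a. ((\<lambda>v. ot_H (D v) f (G v) a) has_real_derivative dot_H (D v) f f1 (G v) g1 2 a) (at v)"
    unfolding forall_4 ot_H_def dot_H_def
    by (intro conjI; simp;
        rule DERIV_cong, (auto intro!: derivative_eq_intros D G simp: nz)[1]; use nz in \<open>simp add: field_simps eval_nat_numeral\<close>)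
  then show ?thesis by blast
qed

lemma schouten_derivative_1:
  assumes nz: "D t \<noteq> 0" "F t \<noteq> 0" "g \<noteq> 0"
    and D: "(D has_real_derivative 1) (at t)" and S: "(S has_real_derivative 1) (at t)" and F: "(F has_real_derivative f1) (at t)"
  shows "((\<lambda>t. schouten_diag k l \<beta> (D t) (S t) a * ot_H (D t) (F t) g a) has_real_derivative
    dschouten k l \<beta> (D t) (S t) (F t) f1 g g1 1 a) (at t)"
proof -
  have "\<forall>a. ((\<lambda>t. schouten_diag k l \<beta> (D t) (S t) a * ot_H (D t) (F t) g a) has_real_derivative
    dschouten k l \<beta> (D t) (S t) (F t) f1 g g1 1 a) (at t)"
    unfolding forall_4 schouten_diag_def ot_H_def dschouten_def
    by (intro conjI; simp;
        rule DERIV_cong, (auto intro!: derivative_eq_intros D S F simp: nz)[1]; use nz in \<open>simp add: field_simps eval_nat_numeral\<close>)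
  then show ?thesis by blast
qed

lemma schouten_derivative_2:
  assumes nz: "D t \<noteq> 0" "f \<noteq> 0" "G t \<noteq> 0"
    and D: "(D has_real_derivative - 1) (at t)" and S: "(S has_real_derivative 1) (at t)" and G: "(G has_real_derivative g1) (at t)"
  shows "((\<lambda>t. schouten_diag k l \<beta> (D t) (S t) a * ot_H (D t) f (G t) a) has_real_derivative
    dschouten k l \<beta> (D t) (S t) f f1 (G t) g1 2 a) (at t)"
proof -
  have "\<forall>a. ((\<lambda>t. schouten_diag k l \<beta> (D t) (S t) a * ot_H (D t) f (G t) a) has_real_derivative
    dschouten k l \<beta> (D t) (S t) f f1 (G t) g1 2 a) (at t)"
    unfolding forall_4 schouten_diag_def ot_H_def dschouten_def
    by (intro conjI; simp;
        rule DERIV_cong, (auto intro!: derivative_eq_intros D S G simp: nz)[1]; use nz in \<open>simp add: field_simps eval_nat_numeral\<close>)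
  then show ?thesis by blast
qed

lemma cotton_derivative_1:
  assumes nz: "D t \<noteq> 0" "F t \<noteq> 0" "g \<noteq> 0"
    and D: "(D has_real_derivative 1) (at t)" and F: "(F has_real_derivative f1) (at t)"
  shows "((\<lambda>t. cotton_table k \<beta> (D t) (F t) g a b c) has_real_derivative
    dcotton k \<beta> (D t) (F t) f1 g g1 1 a b c) (at t)"
proof -
  have "\<forall>a b c. ((\<lambda>t. cotton_table k \<beta> (D t) (F t) g a b c) has_real_derivative
    dcotton k \<beta> (D t) (F t) f1 g g1 1 a b c) (at t)"
    unfolding forall_4 cotton_table_def cotton_form_def bv_def dcotton_def
    by (intro conjI; simp;
        rule DERIV_cong, (auto intro!: derivative_eq_intros D F simp: nz)[1]; use nz in \<open>simp add: field_simps eval_nat_numeral\<close>)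
  then show ?thesis by blast
qed

lemma cotton_derivative_2:
  assumes nz: "D t \<noteq> 0" "f \<noteq> 0" "G t \<noteq> 0"
    and D: "(D has_real_derivative - 1) (at t)" and G: "(G has_real_derivative g1) (at t)"
  shows "((\<lambda>t. cotton_table k \<beta> (D t) f (G t) a b c) has_real_derivative
    dcotton k \<beta> (D t) f f1 (G t) g1 2 a b c) (at t)"
proof -
  have "\<forall>a b c. ((\<lambda>t. cotton_table k \<beta> (D t) f (G t) a b c) has_real_derivative
    dcotton k \<beta> (D t) f f1 (G t) g1 2 a b c) (at t)"
    unfolding forall_4 cotton_table_def cotton_form_def bv_def dcotton_def
    by (intro conjI; simp;
        rule DERIV_cong, (auto intro!: derivative_eq_intros D G simp: nz)[1]; use nz in \<open>simp add: field_simps eval_nat_numeral\<close>)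
  then show ?thesis by blast
qed

lemma conn_compatible:
  fixes e d f f1 g g1 :: real
  assumes nz: "d \<noteq> 0" "f \<noteq> 0" "g \<noteq> 0"
  shows "ot_H d f g a * conn e d f f1 g g1 a c b + ot_H d f g b * conn e d f f1 g g1 b c a
    = (if a = b then dot_H d f f1 g g1 c a + sel4 (- 2 * e / d) (2 * e / d) 0 0 c * ot_H d f g a else 0)"
proof -
  have "\<forall>a b c. ot_H d f g a * conn e d f f1 g g1 a c b + ot_H d f g b * conn e d f f1 g g1 b c a
    = (if a = b then dot_H d f f1 g g1 c a + sel4 (- 2 * e / d) (2 * e / d) 0 0 c * ot_H d f g a else 0)"
    unfolding forall_4 conn_def ot_H_def dot_H_def
    by (intro conjI; simp add: nz; simp add: field_simps nz eval_nat_numeral)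
  then show ?thesis by blast
qed

lemma conn_torsion:
  fixes e d f f1 g g1 :: real
  assumes d: "d \<noteq> 0"
  shows "conn e d f f1 g g1 a b c - conn e d f f1 g g1 a c b
    = (if a = 3 then (bv 2 3 b c - bv 2 4 b c) / d else if a = 4 then (bv 1 3 b c - bv 1 4 b c) / d else 0)"
proof -
  have "\<forall>a b c. conn e d f f1 g g1 a b c - conn e d f f1 g g1 a c b
    = (if a = 3 then (bv 2 3 b c - bv 2 4 b c) / d else if a = 4 then (bv 1 3 b c - bv 1 4 b c) / d else 0)"
    unfolding forall_4 conn_def bv_def
    by (intro conjI; simp; simp add: field_simps d)
  then show ?thesis by blast
qed

lemma ot_torsion:
  assumes "x $ 1 \<noteq> x $ 2"
  shows "ot_dQ k a i - ot_dQ i a k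
    = pull2 (ot_Q x) (\<lambda>c b. conn e (x $ 1 - x $ 2) f f1 g g1 a b c - conn e (x $ 1 - x $ 2) f f1 g g1 a c b) k i"
proof -
  define d where "d = x $ 1 - x $ 2"
  have d: "x $ 1 = x $ 2 + d" "d \<noteq> 0"
    using assms by (auto simp: d_def)
  have "\<forall>a k i. ot_dQ k a i - ot_dQ i a k
    = pull2 (ot_Q x) (\<lambda>c b. if a = 3 then (bv 2 3 b c - bv 2 4 b c) / (x $ 1 - x $ 2)
        else if a = 4 then (bv 1 3 b c - bv 1 4 b c) / (x $ 1 - x $ 2) else 0) k i"
    unfolding forall_4 ot_dQ_def pull2_def pull1_def sum_4 ot_Q_def bv_def
    by (intro conjI; simp add: d; simp add: field_simps d)
  moreover have "x $ 1 - x $ 2 \<noteq> 0" using assms by simp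
  ultimately show ?thesis unfolding conn_torsion[OF \<open>x $ 1 - x $ 2 \<noteq> 0\<close>] by blast
qed

locale ot_chart =
  fixes U :: "(real^4) set" and F F1 F2 G G1 G2 :: "real \<Rightarrow> real"
  assumes open_U: "open U"
    and distinct: "\<And>x. x \<in> U \<Longrightarrow> x $ 1 \<noteq> x $ 2"
    and F_nz: "\<And>x. x \<in> U \<Longrightarrow> F (x $ 1) \<noteq> 0" and G_nz: "\<And>x. x \<in> U \<Longrightarrow> G (x $ 2) \<noteq> 0"
    and dF: "\<And>x. x \<in> U \<Longrightarrow> (F has_real_derivative F1 (x $ 1)) (at (x $ 1))"
    and dF1: "\<And>x. x \<in> U \<Longrightarrow> (F1 has_real_derivative F2 (x $ 1)) (at (x $ 1))"
    and dG: "\<And>x. x \<in> U \<Longrightarrow> (G has_real_derivative G1 (x $ 2)) (at (x $ 2))"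
    and dG1: "\<And>x. x \<in> U \<Longrightarrow> (G1 has_real_derivative G2 (x $ 2)) (at (x $ 2))"
begin

definition oH :: "nat \<Rightarrow> real^4 \<Rightarrow> 4 \<Rightarrow> real" where
  "oH e x a = (1 / (x $ 1 - x $ 2)\<^sup>2) ^ e * ot_H (x $ 1 - x $ 2) (F (x $ 1)) (G (x $ 2)) a"

definition doH :: "nat \<Rightarrow> real^4 \<Rightarrow> 4 \<Rightarrow> 4 \<Rightarrow> real" where
  "doH e x c a = (1 / (x $ 1 - x $ 2)\<^sup>2) ^ e * (dot_H (x $ 1 - x $ 2) (F (x $ 1)) (F1 (x $ 1)) (G (x $ 2)) (G1 (x $ 2)) c a
     + sel4 (- 2 * real e / (x $ 1 - x $ 2)) (2 * real e / (x $ 1 - x $ 2)) 0 0 c * ot_H (x $ 1 - x $ 2) (F (x $ 1)) (G (x $ 2)) a)"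

definition o\<gamma> :: "nat \<Rightarrow> real^4 \<Rightarrow> 4 \<Rightarrow> 4 \<Rightarrow> 4 \<Rightarrow> real" where
  "o\<gamma> e x = conn (real e) (x $ 1 - x $ 2) (F (x $ 1)) (F1 (x $ 1)) (G (x $ 2)) (G1 (x $ 2))"

definition do\<gamma> :: "nat \<Rightarrow> real^4 \<Rightarrow> 4 \<Rightarrow> 4 \<Rightarrow> 4 \<Rightarrow> 4 \<Rightarrow> real" where
  "do\<gamma> e x = dconn (real e) (x $ 1 - x $ 2) (F (x $ 1)) (F1 (x $ 1)) (F2 (x $ 1)) (G (x $ 2)) (G1 (x $ 2)) (G2 (x $ 2))"

lemma d_nz: "x \<in> U \<Longrightarrow> x $ 1 - x $ 2 \<noteq> 0"
  using distinct by simp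

lemma ot_moving_frame: "moving_frame U ot_Q ot_P ot_dQ"
proof
  show "open U" by (rule open_U)
next
  fix x a b assume "x \<in> U"
  define d where "d = x $ 1 - x $ 2"
  have d: "x $ 1 = x $ 2 + d" "d \<noteq> 0"
    using d_nz[OF \<open>x \<in> U\<close>] by (auto simp: d_def)
  have "\<forall>a b. (\<Sum>i\<in>UNIV. ot_Q x a i * ot_P x i b) = (if a = b then 1 else 0)"
    unfolding forall_4 sum_4 ot_Q_def ot_P_def Let_def
    by (intro conjI; simp add: d; simp add: field_simps d)
  then show "(\<Sum>i\<in>UNIV. ot_Q x a i * ot_P x i b) = (if a = b then 1 else 0)" by blast
next
  fix x i j assume "x \<in> U"
  define d where "d = x $ 1 - x $ 2"
  have d: "x $ 1 = x $ 2 + d" "d \<noteq> 0"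
    using d_nz[OF \<open>x \<in> U\<close>] by (auto simp: d_def)
  have "\<forall>i j. (\<Sum>a\<in>UNIV. ot_P x i a * ot_Q x a j) = (if i = j then 1 else 0)"
    unfolding forall_4 sum_4 ot_Q_def ot_P_def Let_def
    by (intro conjI; simp add: d; simp add: field_simps d)
  then show "(\<Sum>a\<in>UNIV. ot_P x i a * ot_Q x a j) = (if i = j then 1 else 0)" by blast
next
  fix x a i k assume "x \<in> U"
  have "\<forall>k a i. has_partial k (\<lambda>y. ot_Q y a i) (ot_dQ k a i) x"
    unfolding forall_4 has_partial_def ot_Q_def ot_dQ_def
    by (intro conjI; simp add: axis_def; auto intro!: derivative_eq_intros)
  then show "has_partial k (\<lambda>y. ot_Q y a i) (ot_dQ k a i) x" by blast
next
  fix x a i k assume x: "x \<in> U"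
  define \<phi> where "\<phi> i a u v = (let d = u - v in
     sel4 (sel4 1 0 0 0) (sel4 0 1 0 0) (sel4 0 0 (u / d) (- v / d)) (sel4 0 0 (- 1 / d) (1 / d)) i a)"
    for i a :: 4 and u v :: real
  have "\<forall>i a. \<exists>A. ((\<lambda>u. \<phi> i a u (x $ 2)) has_real_derivative A) (at (x $ 1))"
    unfolding forall_4 \<phi>_def Let_def real_differentiable_def[symmetric] using d_nz[OF x]
    by (intro conjI; simp)
  moreover have "\<forall>i a. \<exists>A. ((\<lambda>v. \<phi> i a (x $ 1) v) has_real_derivative A) (at (x $ 2))"
    unfolding forall_4 \<phi>_def Let_def real_differentiable_def[symmetric] using d_nz[OF x]
    by (intro conjI; simp)
  ultimately obtain A B where "((\<lambda>u. \<phi> i a u (x $ 2)) has_real_derivative A) (at (x $ 1))"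
      "((\<lambda>v. \<phi> i a (x $ 1) v) has_real_derivative B) (at (x $ 2))" by blast
  then have "has_partial k (\<lambda>y. \<phi> i a (y $ 1) (y $ 2)) (sel4 A B 0 0 k) x"
    by (rule has_partial_two_variables)
  moreover have "\<phi> i a (y $ 1) (y $ 2) = ot_P y i a" for y :: "real^4"
    unfolding \<phi>_def ot_P_def Let_def ..
  ultimately show "\<exists>D. has_partial k (\<lambda>y. ot_P y i a) D x" by auto
qed

lemma ot_metric_frame:
  assumes e: "e = 0 \<or> e = 1"
    and g: "\<And>x. x \<in> U \<Longrightarrow> g x = (1 / (x $ 1 - x $ 2)\<^sup>2) ^ e *\<^sub>R ot_metric F G x"
  shows "metric_frame U ot_Q ot_P ot_dQ g (oH e) (doH e) (o\<gamma> e) (do\<gamma> e)"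
proof -
  interpret moving_frame U ot_Q ot_P ot_dQ by (rule ot_moving_frame)
  show ?thesis
  proof
    fix x i j assume x: "x \<in> U"
    note nz = d_nz[OF x] F_nz[OF x] G_nz[OF x]
    define d f \<kappa> where "d = x $ 1 - x $ 2" and "f = F (x $ 1)" and "\<kappa> = G (x $ 2)"
    have F': "F (x $ 1) = f" "G (x $ 2) = \<kappa>" and d: "x $ 1 = x $ 2 + d" "d \<noteq> 0" "f \<noteq> 0" "\<kappa> \<noteq> 0"
      using nz by (auto simp: d_def f_def \<kappa>_def)
    have "\<forall>i j. ot_metric F G x $ i $ j
      = (\<Sum>a\<in>UNIV. ot_H (x $ 1 - x $ 2) (F (x $ 1)) (G (x $ 2)) a * ot_Q x a i * ot_Q x a j)"
      unfolding forall_4 sum_4 ot_H_def ot_Q_def ot_metric_def Let_def tensor_sq_def F' unfolding d(1)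
      by (intro conjI; simp add: axis_def d; simp add: field_simps d)
    then show "g x $ i $ j = (\<Sum>a\<in>UNIV. oH e x a * ot_Q x a i * ot_Q x a j)"
      unfolding g[OF x] oH_def by (simp add: sum_distrib_left mult_ac)
  next
    fix x a assume x: "x \<in> U"
    show "oH e x a \<noteq> 0"
      using exhaust_4[of a] d_nz[OF x] F_nz[OF x] G_nz[OF x] by (auto simp: oH_def ot_H_def)
  next
    fix x a k assume x: "x \<in> U"
    note nz = d_nz[OF x] F_nz[OF x] G_nz[OF x]
    have w1: "((\<lambda>u. (1 / (u - x $ 2)\<^sup>2) ^ e) has_real_derivative
        (1 / (x $ 1 - x $ 2)\<^sup>2) ^ e * (- 2 * real e / (x $ 1 - x $ 2))) (at (x $ 1))"
      by (rule disjE[OF e]; simp; rule DERIV_cong, (auto intro!: derivative_eq_intros simp: distinct[OF x])[1];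
          use nz in \<open>simp add: divide_simps eval_nat_numeral\<close>)
    have w2: "((\<lambda>v. (1 / (x $ 1 - v)\<^sup>2) ^ e) has_real_derivative
        (1 / (x $ 1 - x $ 2)\<^sup>2) ^ e * (2 * real e / (x $ 1 - x $ 2))) (at (x $ 2))"
      by (rule disjE[OF e]; simp; rule DERIV_cong, (auto intro!: derivative_eq_intros simp: distinct[OF x])[1];
          use nz in \<open>simp add: divide_simps eval_nat_numeral\<close>)
    show "has_partial k (\<lambda>y. oH e y a) (pull1 (ot_Q x) (\<lambda>c. doH e x c a) k) x"
      unfolding oH_def
    proof (rule has_partial_frame)
      have "((\<lambda>u. ot_H (u - x $ 2) (F u) (G (x $ 2)) a) has_real_derivative
          dot_H (x $ 1 - x $ 2) (F (x $ 1)) (F1 (x $ 1)) (G (x $ 2)) (G1 (x $ 2)) 1 a) (at (x $ 1))"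
        by (rule ot_H_derivative_1[where D = "\<lambda>u. u - x $ 2"]) (use nz dF[OF x] in \<open>auto intro!: derivative_eq_intros\<close>)
      from DERIV_mult[OF w1 this]
      show "((\<lambda>u. (1 / (u - x $ 2)\<^sup>2) ^ e * ot_H (u - x $ 2) (F u) (G (x $ 2)) a) has_real_derivative doH e x 1 a) (at (x $ 1))"
        by (rule DERIV_cong) (simp add: doH_def algebra_simps)
      have "((\<lambda>v. ot_H (x $ 1 - v) (F (x $ 1)) (G v) a) has_real_derivative
          dot_H (x $ 1 - x $ 2) (F (x $ 1)) (F1 (x $ 1)) (G (x $ 2)) (G1 (x $ 2)) 2 a) (at (x $ 2))"
        by (rule ot_H_derivative_2[where D = "\<lambda>v. x $ 1 - v"]) (use nz dG[OF x] in \<open>auto intro!: derivative_eq_intros\<close>)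
      from DERIV_mult[OF w2 this]
      show "((\<lambda>v. (1 / (x $ 1 - v)\<^sup>2) ^ e * ot_H (x $ 1 - v) (F (x $ 1)) (G v) a) has_real_derivative doH e x 2 a) (at (x $ 2))"
        by (rule DERIV_cong) (simp add: doH_def algebra_simps)
    qed (simp_all add: doH_def dot_H_def)
  next
    fix x a b c k assume x: "x \<in> U"
    note nz = d_nz[OF x] F_nz[OF x] G_nz[OF x]
    show "has_partial k (\<lambda>y. o\<gamma> e y a c b) (pull1 (ot_Q x) (\<lambda>m. do\<gamma> e x m a c b) k) x"
      unfolding o\<gamma>_def
    proof (rule has_partial_frame)
      show "((\<lambda>u. conn (real e) (u - x $ 2) (F u) (F1 u) (G (x $ 2)) (G1 (x $ 2)) a c b) has_real_derivative do\<gamma> e x 1 a c b) (at (x $ 1))"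
        unfolding do\<gamma>_def
        by (rule conn_derivative_1[where D = "\<lambda>u. u - x $ 2"]) (use nz dF[OF x] dF1[OF x] in \<open>auto intro!: derivative_eq_intros\<close>)
      show "((\<lambda>v. conn (real e) (x $ 1 - v) (F (x $ 1)) (F1 (x $ 1)) (G v) (G1 v) a c b) has_real_derivative do\<gamma> e x 2 a c b) (at (x $ 2))"
        unfolding do\<gamma>_def
        by (rule conn_derivative_2[where D = "\<lambda>v. x $ 1 - v"]) (use nz dG[OF x] dG1[OF x] in \<open>auto intro!: derivative_eq_intros\<close>)
    qed (simp_all add: do\<gamma>_def dconn_12_only)
  next
    fix x a b c assume x: "x \<in> U"
    show "oH e x a * o\<gamma> e x a c b + oH e x b * o\<gamma> e x b c a = (if a = b then doH e x c a else 0)"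
      using conn_compatible[OF d_nz[OF x] F_nz[OF x] G_nz[OF x], of a "real e" "F1 (x $ 1)" "G1 (x $ 2)" c b]
      unfolding oH_def doH_def o\<gamma>_def by (simp add: mult.assoc flip: distrib_left)
  next
    fix x a k i assume x: "x \<in> U"
    show "ot_dQ k a i - ot_dQ i a k = pull2 (ot_Q x) (\<lambda>c b. o\<gamma> e x a b c - o\<gamma> e x a c b) k i"
      unfolding o\<gamma>_def by (rule ot_torsion[OF distinct[OF x]])
  qed
qed

end

section \<open>Curvature of ortho-toric charts\<close>

lemma ricci_riemann_table:
  fixes d f g m n q :: real
  assumes nz: "d \<noteq> 0" "f \<noteq> 0" "g \<noteq> 0"
  shows "(\<Sum>b\<in>UNIV. riemann_table m n q q (ot_H d f g) a b c b / ot_H d f g b)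
    = diag4 (\<lambda>a. sel4 (m - q / 2) (n - q / 2) (m - q / 2) (n - q / 2) a * ot_H d f g a) a c"
proof -
  have "\<forall>a c. (\<Sum>b\<in>UNIV. riemann_table m n q q (ot_H d f g) a b c b / ot_H d f g b)
    = diag4 (\<lambda>a. sel4 (m - q / 2) (n - q / 2) (m - q / 2) (n - q / 2) a * ot_H d f g a) a c"
    unfolding forall_4 sum_4 diag4_def ot_H_def riemann_table_def bv_def
    by (intro conjI; simp add: nz; simp add: field_simps nz)
  then show ?thesis by blast
qed

text \<open>For a diagonal form the Kulkarni--Nomizu product with the metric is diagonal on elementary two-forms, with the sums of eigenvalues as entries.\<close>

lemma kulkarni_nomizu_diag:
  fixes H \<sigma> :: "4 \<Rightarrow> real"
  defines "S \<equiv> diag4 (\<lambda>a. \<sigma> a * H a)" and "\<delta> \<equiv> diag4 H"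
  shows "S a c * \<delta> b e + \<delta> a c * S b e - S a e * \<delta> b c - \<delta> a e * S b c
    = (\<sigma> 1 + \<sigma> 2) * (H 1 * H 2) * (bv 1 2 a b * bv 1 2 c e) + (\<sigma> 1 + \<sigma> 3) * (H 1 * H 3) * (bv 1 3 a b * bv 1 3 c e)
    + (\<sigma> 1 + \<sigma> 4) * (H 1 * H 4) * (bv 1 4 a b * bv 1 4 c e) + (\<sigma> 2 + \<sigma> 3) * (H 2 * H 3) * (bv 2 3 a b * bv 2 3 c e)
    + (\<sigma> 2 + \<sigma> 4) * (H 2 * H 4) * (bv 2 4 a b * bv 2 4 c e) + (\<sigma> 3 + \<sigma> 4) * (H 3 * H 4) * (bv 3 4 a b * bv 3 4 c e)"
proof -
  have "\<forall>a b c e. S a c * \<delta> b e + \<delta> a c * S b e - S a e * \<delta> b c - \<delta> a e * S b c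
    = (\<sigma> 1 + \<sigma> 2) * (H 1 * H 2) * (bv 1 2 a b * bv 1 2 c e) + (\<sigma> 1 + \<sigma> 3) * (H 1 * H 3) * (bv 1 3 a b * bv 1 3 c e)
    + (\<sigma> 1 + \<sigma> 4) * (H 1 * H 4) * (bv 1 4 a b * bv 1 4 c e) + (\<sigma> 2 + \<sigma> 3) * (H 2 * H 3) * (bv 2 3 a b * bv 2 3 c e)
    + (\<sigma> 2 + \<sigma> 4) * (H 2 * H 4) * (bv 2 4 a b * bv 2 4 c e) + (\<sigma> 3 + \<sigma> 4) * (H 3 * H 4) * (bv 3 4 a b * bv 3 4 c e)"
    unfolding forall_4 S_def \<delta>_def diag4_def bv_def
    by (intro conjI; simp; simp add: algebra_simps)
  then show ?thesis by blast
qed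

lemma weyl_riemann_table:
  fixes d f g m n q :: real
  assumes nz: "d \<noteq> 0" "f \<noteq> 0" "g \<noteq> 0"
  defines "s \<equiv> (m + n - q) / 3"
  defines "S \<equiv> diag4 (\<lambda>a. (sel4 (m - q / 2) (n - q / 2) (m - q / 2) (n - q / 2) a / 2 - s / 2) * ot_H d f g a)"
    and "\<delta> \<equiv> diag4 (ot_H d f g)"
  shows "riemann_table m n q q (ot_H d f g) a b c e - (S a c * \<delta> b e + \<delta> a c * S b e - S a e * \<delta> b c - \<delta> a e * S b c)
     = riemann_table (s + q / 2) (s + q / 2) q (q + 2 * s) (ot_H d f g) a b c e"
proof -
  have H: "ot_H d f g 1 * ot_H d f g 3 = 1" "ot_H d f g 2 * ot_H d f g 4 = 1"
    using nz by (simp_all add: ot_H_def)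
  have s: "m - q / 2 = 3 * s - (n - q / 2)" by (simp add: s_def field_simps)
  have sum: "(m - q / 2) / 2 - s / 2 + ((n - q / 2) / 2 - s / 2) = s / 2"
    "(m - q / 2) / 2 - s / 2 + ((m - q / 2) / 2 - s / 2) = m - q / 2 - s"
    "(n - q / 2) / 2 - s / 2 + ((n - q / 2) / 2 - s / 2) = n - q / 2 - s"
    "(n - q / 2) / 2 - s / 2 + ((m - q / 2) / 2 - s / 2) = s / 2"
    by (simp_all add: s field_simps)
  have m: "m = 3 * s - n + q" by (simp add: s_def field_simps)
  show ?thesis
    unfolding S_def \<delta>_def kulkarni_nomizu_diag unfolding sel4_simps sum H riemann_table_def
    by (simp add: m algebra_simps add_divide_distrib)
qed

text \<open>Common quartic parts cancel up to powers of \<open>d\<close>; the substitution \<open>\<xi> = \<eta> + d\<close> makes this a polynomial identity.\<close>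

lemma quartic_curvature:
  fixes k l A B1 B2 C1 C2 \<xi> \<eta> :: real
  assumes "\<xi> \<noteq> \<eta>"
  defines "d \<equiv> \<xi> - \<eta>" and "u \<equiv> \<xi> + \<eta>"
    and "f \<equiv> k * \<xi>^4 + l * \<xi>^3 + A * \<xi>^2 + B1 * \<xi> + C1" and "f1 \<equiv> 4 * k * \<xi>^3 + 3 * l * \<xi>^2 + 2 * A * \<xi> + B1"
    and "f2 \<equiv> 12 * k * \<xi>^2 + 6 * l * \<xi> + 2 * A"
    and "g \<equiv> k * \<eta>^4 + l * \<eta>^3 + A * \<eta>^2 + B2 * \<eta> + C2" and "g1 \<equiv> 4 * k * \<eta>^3 + 3 * l * \<eta>^2 + 2 * A * \<eta> + B2"
    and "g2 \<equiv> 12 * k * \<eta>^2 + 6 * l * \<eta> + 2 * A"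
  shows "g2 - f2 = 6 * d * (- 2 * k * u - l)"
    and "(f1 + g1) / d^2 - 2 * (f - g) / d^3 = 2 * k * u + l - ((B1 - B2) * u + 2 * (C1 - C2)) / d^3"
    and "- f2 / (2 * d) + (f1 - g1) / (2 * d^2) = (3 * (- 2 * k * u - l) + (B1 - B2) / d^2 - 2 * k * d) / 2"
    and "g2 / (2 * d) - (f1 - g1) / (2 * d^2) = (3 * (- 2 * k * u - l) - (B1 - B2) / d^2 + 2 * k * d) / 2"
proof -
  have d: "d \<noteq> 0" and \<xi>: "\<xi> = \<eta> + d" and u: "u = 2 * \<eta> + d"
    using assms(1) by (auto simp: d_def u_def)
  show "g2 - f2 = 6 * d * (- 2 * k * u - l)"
    unfolding g2_def f2_def u \<xi> by algebra
  have 1: "(f1 + g1) * d - 2 * (f - g) = (2 * k * u + l) * d^3 - ((B1 - B2) * u + 2 * (C1 - C2))"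
    unfolding f1_def g1_def f_def g_def u \<xi> by algebra
  have "(f1 + g1) / d^2 - 2 * (f - g) / d^3 = ((f1 + g1) * d - 2 * (f - g)) / d^3"
    using d by (simp add: diff_divide_distrib eval_nat_numeral)
  then show "(f1 + g1) / d^2 - 2 * (f - g) / d^3 = 2 * k * u + l - ((B1 - B2) * u + 2 * (C1 - C2)) / d^3"
    unfolding 1 using d by (simp add: diff_divide_distrib)
  have 2: "- f2 * d + (f1 - g1) = 3 * (- 2 * k * u - l) * d^2 + (B1 - B2) - 2 * k * d^3"
    unfolding f1_def g1_def f2_def u \<xi> by algebra
  have "- f2 / (2 * d) + (f1 - g1) / (2 * d^2) = (- f2 * d + (f1 - g1)) / (2 * d^2)"
    using d by (simp add: add_divide_distrib diff_divide_distrib eval_nat_numeral)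
  then show "- f2 / (2 * d) + (f1 - g1) / (2 * d^2) = (3 * (- 2 * k * u - l) + (B1 - B2) / d^2 - 2 * k * d) / 2"
    unfolding 2 using d by (simp add: field_simps eval_nat_numeral)
  have 3: "g2 * d - (f1 - g1) = 3 * (- 2 * k * u - l) * d^2 - (B1 - B2) + 2 * k * d^3"
    unfolding f1_def g1_def g2_def u \<xi> by algebra
  have "g2 / (2 * d) - (f1 - g1) / (2 * d^2) = (g2 * d - (f1 - g1)) / (2 * d^2)"
    using d by (simp add: diff_divide_distrib eval_nat_numeral)
  then show "g2 / (2 * d) - (f1 - g1) / (2 * d^2) = (3 * (- 2 * k * u - l) - (B1 - B2) / d^2 + 2 * k * d) / 2"
    unfolding 3 using d by (simp add: field_simps eval_nat_numeral)
qed

locale ot_geometry = ot_chart +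
  fixes g :: matfield
  assumes g_eq: "\<And>x. x \<in> U \<Longrightarrow> g x = ot_metric F G x"
begin

sublocale K: metric_frame U ot_Q ot_P ot_dQ g "oH 0" "doH 0" "o\<gamma> 0" "do\<gamma> 0"
  by (rule ot_metric_frame) (simp_all add: g_eq)

abbreviation d where "d x \<equiv> x $ 1 - (x :: real^4) $ 2"
abbreviation f where "f x \<equiv> F ((x :: real^4) $ 1)"
abbreviation f1 where "f1 x \<equiv> F1 ((x :: real^4) $ 1)"
abbreviation f2 where "f2 x \<equiv> F2 ((x :: real^4) $ 1)"
abbreviation g0 where "g0 x \<equiv> G ((x :: real^4) $ 2)"
abbreviation g1 where "g1 x \<equiv> G1 ((x :: real^4) $ 2)"
abbreviation g2 where "g2 x \<equiv> G2 ((x :: real^4) $ 2)"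

definition q where "q x = (f1 x + g1 x) / (d x)^2 - 2 * (f x - g0 x) / (d x)^3"
definition r1 where "r1 x = - f2 x / (2 * d x) + (f1 x - g1 x) / (2 * (d x)^2)"
definition r2 where "r2 x = g2 x / (2 * d x) - (f1 x - g1 x) / (2 * (d x)^2)"

lemma oH_0: "oH 0 x = ot_H (d x) (f x) (g0 x)"
  by (simp add: oH_def fun_eq_iff)

lemma Rm_table:
  assumes x: "x \<in> U"
  shows "K.Rm x a b c e * oH 0 x e = riemann_table (r1 x + q x / 2) (r2 x + q x / 2) (q x) (q x) (oH 0 x) a b c e"
proof -
  have "- f2 x / (2 * d x) + f1 x / (d x)^2 - (f x - g0 x) / (d x)^3 = r1 x + q x / 2"
    "g2 x / (2 * d x) + g1 x / (d x)^2 - (f x - g0 x) / (d x)^3 = r2 x + q x / 2"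
    unfolding r1_def r2_def q_def by (simp_all add: add_divide_distrib diff_divide_distrib)
  then show ?thesis
    using frame_riemann_conn[OF d_nz[OF x] F_nz[OF x] G_nz[OF x], of "f1 x" "g1 x" "f2 x" "g2 x" a b c e]
    unfolding K.Rm_def oH_0 o\<gamma>_def do\<gamma>_def q_def by simp
qed

lemma Ric_diag:
  assumes x: "x \<in> U"
  shows "K.Ric x a c = diag4 (\<lambda>a. sel4 (r1 x) (r2 x) (r1 x) (r2 x) a * oH 0 x a) a c"
proof -
  have "K.Ric x a c = (\<Sum>b\<in>UNIV. K.Rm x a b c b * oH 0 x b / oH 0 x b)"
    unfolding K.Ric_def using K.H_nonzero[OF x] by simp
  also have "\<dots> = diag4 (\<lambda>a. sel4 (r1 x) (r2 x) (r1 x) (r2 x) a * oH 0 x a) a c"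
    unfolding Rm_table[OF x] unfolding oH_0 ricci_riemann_table[OF d_nz[OF x] F_nz[OF x] G_nz[OF x]] by simp
  finally show ?thesis .
qed

lemma Sc_eq: "x \<in> U \<Longrightarrow> K.Sc x = 2 * (r1 x + r2 x)"
  using K.H_nonzero[of x] unfolding K.Sc_def by (simp add: Ric_diag sum_4 diag4_def)

lemma Scal_eq:
  assumes x: "x \<in> U"
  shows "Scal g x = (g2 x - f2 x) / d x"
proof -
  have "2 * (- a / (2 * \<delta>) + c + (b / (2 * \<delta>) - c)) = (b - a) / \<delta>" for a b c \<delta> :: real
    by (cases "\<delta> = 0") (simp_all add: field_simps)
  then show ?thesis
    unfolding K.Scal_eq[OF x] Sc_eq[OF x] r1_def r2_def .
qed

lemma Sch_diag:
  assumes x: "x \<in> U"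
  shows "K.Sch x a b = diag4 (\<lambda>a. (sel4 (r1 x) (r2 x) (r1 x) (r2 x) a / 2 - (r1 x + r2 x) / 6) * oH 0 x a) a b"
  unfolding K.Sch_def Ric_diag[OF x] Sc_eq[OF x] diag4_def by (simp add: field_simps)

lemma Wl_table:
  assumes x: "x \<in> U"
  defines "s \<equiv> (r1 x + r2 x) / 3"
  shows "K.Wl x a b c e = riemann_table (s + q x / 2) (s + q x / 2) (q x) (q x + 2 * s) (oH 0 x) a b c e"
proof -
  have 1: "K.Sch x = diag4 (\<lambda>a. (sel4 (r1 x) (r2 x) (r1 x) (r2 x) a / 2 - s / 2) * ot_H (d x) (f x) (g0 x) a)"
    by (intro ext) (simp add: Sch_diag[OF x] s_def oH_0)
  have 2: "(if a = b then oH 0 x a else 0) = diag4 (ot_H (d x) (f x) (g0 x)) a b" for a b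
    by (simp add: diag4_def oH_0)
  have 3: "r1 x + q x / 2 - q x / 2 = r1 x" "r2 x + q x / 2 - q x / 2 = r2 x"
    "(r1 x + q x / 2 + (r2 x + q x / 2) - q x) / 3 = s"
    by (simp_all add: s_def)
  show ?thesis
    using weyl_riemann_table[OF d_nz[OF x] F_nz[OF x] G_nz[OF x], where m = "r1 x + q x / 2" and q = "q x" and n = "r2 x + q x / 2"
        and a = a and b = b and c = c and e = e]
    unfolding K.Wl_def Let_def Rm_table[OF x] unfolding 1 2 3 unfolding oH_0 .
qed

end

locale ot_quartic = ot_geometry +
  fixes k l A B1 B2 C1 C2 :: real
  assumes F_quartic: "\<And>x. x \<in> U \<Longrightarrow> F (x $ 1) = k * (x $ 1)^4 + l * (x $ 1)^3 + A * (x $ 1)^2 + B1 * (x $ 1) + C1"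
    and F1_quartic: "\<And>x. x \<in> U \<Longrightarrow> F1 (x $ 1) = 4 * k * (x $ 1)^3 + 3 * l * (x $ 1)^2 + 2 * A * (x $ 1) + B1"
    and F2_quartic: "\<And>x. x \<in> U \<Longrightarrow> F2 (x $ 1) = 12 * k * (x $ 1)^2 + 6 * l * (x $ 1) + 2 * A"
    and G_quartic: "\<And>x. x \<in> U \<Longrightarrow> G (x $ 2) = k * (x $ 2)^4 + l * (x $ 2)^3 + A * (x $ 2)^2 + B2 * (x $ 2) + C2"
    and G1_quartic: "\<And>x. x \<in> U \<Longrightarrow> G1 (x $ 2) = 4 * k * (x $ 2)^3 + 3 * l * (x $ 2)^2 + 2 * A * (x $ 2) + B2"
    and G2_quartic: "\<And>x. x \<in> U \<Longrightarrow> G2 (x $ 2) = 12 * k * (x $ 2)^2 + 6 * l * (x $ 2) + 2 * A"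
begin

abbreviation u where "u x \<equiv> x $ 1 + (x :: real^4) $ 2"
abbreviation s where "s x \<equiv> - 2 * k * u x - l"

lemma quartic_invariants:
  assumes x: "x \<in> U"
  shows "g2 x - f2 x = 6 * d x * s x"
    and "q x = 2 * k * u x + l - ((B1 - B2) * u x + 2 * (C1 - C2)) / (d x)^3"
    and "r1 x = (3 * s x + (B1 - B2) / (d x)^2 - 2 * k * d x) / 2"
    and "r2 x = (3 * s x - (B1 - B2) / (d x)^2 + 2 * k * d x) / 2"
  unfolding q_def r1_def r2_def F_quartic[OF x] F1_quartic[OF x] F2_quartic[OF x]
    G_quartic[OF x] G1_quartic[OF x] G2_quartic[OF x]
  by (rule quartic_curvature[OF distinct[OF x]])+

lemma nscal_quartic:
  assumes x: "x \<in> U"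
  shows "nscal g x = s x"
proof -
  have "6 * \<delta> * t / \<delta> / 6 = t" if "\<delta> \<noteq> 0" for \<delta> t :: real
    using that by simp
  from this[OF d_nz[OF x]] show ?thesis
    unfolding nscal_def Scal_eq[OF x] quartic_invariants(1)[OF x] .
qed

lemma Sch_quartic:
  assumes x: "x \<in> U"
  shows "K.Sch x a b = diag4 (\<lambda>a. schouten_diag k l (B1 - B2) (d x) (u x) a * ot_H (d x) (f x) (g0 x) a) a b"
proof -
  define b where "b = (B1 - B2) / (d x)^2"
  have "- (B1 - B2) / (d x)^2 = - b" by (simp add: b_def minus_divide_left)
  then have "\<forall>a. sel4 (r1 x) (r2 x) (r1 x) (r2 x) a / 2 - (r1 x + r2 x) / 6 = schouten_diag k l (B1 - B2) (d x) (u x) a"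
    unfolding forall_4 schouten_diag_def quartic_invariants(3,4)[OF x] b_def[symmetric] by (simp add: field_simps)
  then show ?thesis unfolding Sch_diag[OF x] oH_0 by simp
qed

lemma bach_quartic:
  assumes x: "x \<in> U"
  shows "bach g i j x = pull2 (ot_Q x) (diag4 (\<lambda>a. sel4 1 (-1) 1 (-1) a * oH 0 x a *
     ((4 * k * (C1 - C2) - (B1 - B2) * l) / (2 * (d x)^2)))) i j"
proof -
  define \<beta> where "\<beta> = B1 - B2"
  note nz = d_nz F_nz G_nz
  have b: "bach g i j x = pull2 (ot_Q x) (frame_bach (o\<gamma> 0 x) (oH 0 x)
      (diag4 (\<lambda>a. schouten_diag k l \<beta> (d x) (u x) a * ot_H (d x) (f x) (g0 x) a)) (K.Wl x)
      (cotton_table k \<beta> (d x) (f x) (g0 x)) (dcotton k \<beta> (d x) (f x) (f1 x) (g0 x) (g1 x))) i j"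
  proof (rule K.bach_eq[OF x, where h = "\<lambda>y. diag4 (\<lambda>a. schouten_diag k l \<beta> (d y) (u y) a * ot_H (d y) (f y) (g0 y) a)"
        and dh = "\<lambda>y c. diag4 (dschouten k l \<beta> (d y) (u y) (f y) (f1 y) (g0 y) (g1 y) c)"
        and C = "\<lambda>y. cotton_table k \<beta> (d y) (f y) (g0 y)"])
    fix y a b assume "y \<in> U"
    then show "K.Sch y a b = diag4 (\<lambda>a. schouten_diag k l \<beta> (d y) (u y) a * ot_H (d y) (f y) (g0 y) a) a b"
      unfolding \<beta>_def by (rule Sch_quartic)
  next
    fix y k' a b assume y: "y \<in> U"
    show "has_partial k' (\<lambda>y. diag4 (\<lambda>a. schouten_diag k l \<beta> (d y) (u y) a * ot_H (d y) (f y) (g0 y) a) a b)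
        (pull1 (ot_Q y) (\<lambda>c. diag4 (dschouten k l \<beta> (d y) (u y) (f y) (f1 y) (g0 y) (g1 y) c) a b) k') y"
    proof (cases "a = b")
      case True
      have "has_partial k' (\<lambda>y. schouten_diag k l \<beta> (d y) (u y) a * ot_H (d y) (f y) (g0 y) a)
        (pull1 (ot_Q y) (\<lambda>c. dschouten k l \<beta> (d y) (u y) (f y) (f1 y) (g0 y) (g1 y) c a) k') y"
      proof (rule has_partial_frame)
        show "((\<lambda>t. schouten_diag k l \<beta> (t - y $ 2) (t + y $ 2) a * ot_H (t - y $ 2) (F t) (g0 y) a) has_real_derivative
          dschouten k l \<beta> (d y) (u y) (f y) (f1 y) (g0 y) (g1 y) 1 a) (at (y $ 1))"
          by (rule schouten_derivative_1[where D = "\<lambda>t. t - y $ 2" and S = "\<lambda>t. t + y $ 2"])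
            (use nz[OF y] dF[OF y] in \<open>auto intro!: derivative_eq_intros\<close>)
        show "((\<lambda>t. schouten_diag k l \<beta> (y $ 1 - t) (y $ 1 + t) a * ot_H (y $ 1 - t) (f y) (G t) a) has_real_derivative
          dschouten k l \<beta> (d y) (u y) (f y) (f1 y) (g0 y) (g1 y) 2 a) (at (y $ 2))"
          by (rule schouten_derivative_2[where D = "\<lambda>t. y $ 1 - t" and S = "\<lambda>t. y $ 1 + t"])
            (use nz[OF y] dG[OF y] in \<open>auto intro!: derivative_eq_intros\<close>)
      qed (simp_all add: dschouten_def)
      then show ?thesis using True by (simp add: diag4_def)
    next
      case False
      then show ?thesis by (simp add: diag4_def pull1_zero has_partial_const)
    qed
  next
    fix y a b c assume y: "y \<in> U"
    show "cotton_table k \<beta> (d y) (f y) (g0 y) a b c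
      = - frame_nabla2 (o\<gamma> 0 y) (diag4 (\<lambda>a. schouten_diag k l \<beta> (d y) (u y) a * ot_H (d y) (f y) (g0 y) a))
          (\<lambda>c. diag4 (dschouten k l \<beta> (d y) (u y) (f y) (f1 y) (g0 y) (g1 y) c)) a b c
        + frame_nabla2 (o\<gamma> 0 y) (diag4 (\<lambda>a. schouten_diag k l \<beta> (d y) (u y) a * ot_H (d y) (f y) (g0 y) a))
          (\<lambda>c. diag4 (dschouten k l \<beta> (d y) (u y) (f y) (f1 y) (g0 y) (g1 y) c)) b a c"
      unfolding o\<gamma>_def using cotton_table_eq[OF nz(1)[OF y] nz(2)[OF y] nz(3)[OF y]] by simp
  next
    fix k' a b c
    show "has_partial k' (\<lambda>y. cotton_table k \<beta> (d y) (f y) (g0 y) a b c)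
       (pull1 (ot_Q x) (\<lambda>m. dcotton k \<beta> (d x) (f x) (f1 x) (g0 x) (g1 x) m a b c) k') x"
    proof (rule has_partial_frame)
      show "((\<lambda>t. cotton_table k \<beta> (t - x $ 2) (F t) (g0 x) a b c) has_real_derivative
        dcotton k \<beta> (d x) (f x) (f1 x) (g0 x) (g1 x) 1 a b c) (at (x $ 1))"
        by (rule cotton_derivative_1[where D = "\<lambda>t. t - x $ 2"])
          (use nz[OF x] dF[OF x] in \<open>auto intro!: derivative_eq_intros\<close>)
      show "((\<lambda>t. cotton_table k \<beta> (x $ 1 - t) (f x) (G t) a b c) has_real_derivative
        dcotton k \<beta> (d x) (f x) (f1 x) (g0 x) (g1 x) 2 a b c) (at (x $ 2))"
        by (rule cotton_derivative_2[where D = "\<lambda>t. x $ 1 - t"])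
          (use nz[OF x] dG[OF x] in \<open>auto intro!: derivative_eq_intros\<close>)
    qed (simp_all add: dcotton_def)
  qed
  have s: "(r1 x + r2 x) / 3 = s x"
    unfolding quartic_invariants(3,4)[OF x] by (simp add: add_divide_distrib diff_divide_distrib)
  have W: "K.Wl x = riemann_table (s x + q x / 2) (s x + q x / 2) (q x) (q x + 2 * s x) (oH 0 x)"
    using Wl_table[OF x] unfolding s by (intro ext) simp
  have factor: "\<beta> * s x / (2 * (d x)^2) - d x * k * (q x + s x) = (4 * k * (C1 - C2) - (B1 - B2) * l) / (2 * (d x)^2)"
    unfolding quartic_invariants(2)[OF x] \<beta>_def using nz(1)[OF x]
    by (simp add: divide_simps) (simp add: algebra_simps eval_nat_numeral)
  have "frame_bach (o\<gamma> 0 x) (oH 0 x)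
      (diag4 (\<lambda>a. schouten_diag k l \<beta> (d x) (u x) a * ot_H (d x) (f x) (g0 x) a)) (K.Wl x)
      (cotton_table k \<beta> (d x) (f x) (g0 x)) (dcotton k \<beta> (d x) (f x) (f1 x) (g0 x) (g1 x))
    = diag4 (\<lambda>a. sel4 1 (-1) 1 (-1) a * oH 0 x a * ((4 * k * (C1 - C2) - (B1 - B2) * l) / (2 * (d x)^2)))"
    using frame_bach_table[OF nz(1)[OF x] nz(2)[OF x] nz(3)[OF x], where k = k and l = l and \<beta> = \<beta> and u = "u x" and ?f1.0 = "f1 x" and ?g1.0 = "g1 x"]
    unfolding W o\<gamma>_def oH_0 factor[symmetric] q_def by (intro ext) simp
  then show ?thesis unfolding b by simp
qed

lemma bach_flat_at_iff:
  assumes x: "x \<in> U"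
  shows "(\<forall>i j. bach g i j x = 0) \<longleftrightarrow> 4 * k * (C1 - C2) = (B1 - B2) * l"
proof -
  have "(\<forall>i j. bach g i j x = 0) \<longleftrightarrow>
    (\<forall>a b. diag4 (\<lambda>a. sel4 1 (-1) 1 (-1) a * oH 0 x a * ((4 * k * (C1 - C2) - (B1 - B2) * l) / (2 * (d x)^2))) a b = 0)"
    unfolding bach_quartic[OF x] by (rule K.pull2_eq_0_iff[OF x])
  also have "\<dots> \<longleftrightarrow> 4 * k * (C1 - C2) = (B1 - B2) * l"
    using K.H_nonzero[OF x] d_nz[OF x] unfolding forall_4 diag4_def by simp
  finally show ?thesis .
qed

end

section \<open>Volume form and the self-dual Weyl tensor\<close>

lemma det_4:
  fixes A :: "real^4^4"
  shows "det A =
    A$1$1 * (A$2$2 * (A$3$3 * A$4$4 - A$3$4 * A$4$3) - A$2$3 * (A$3$2 * A$4$4 - A$3$4 * A$4$2) + A$2$4 * (A$3$2 * A$4$3 - A$3$3 * A$4$2))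
  - A$1$2 * (A$2$1 * (A$3$3 * A$4$4 - A$3$4 * A$4$3) - A$2$3 * (A$3$1 * A$4$4 - A$3$4 * A$4$1) + A$2$4 * (A$3$1 * A$4$3 - A$3$3 * A$4$1))
  + A$1$3 * (A$2$1 * (A$3$2 * A$4$4 - A$3$4 * A$4$2) - A$2$2 * (A$3$1 * A$4$4 - A$3$4 * A$4$1) + A$2$4 * (A$3$1 * A$4$2 - A$3$2 * A$4$1))
  - A$1$4 * (A$2$1 * (A$3$2 * A$4$3 - A$3$3 * A$4$2) - A$2$2 * (A$3$1 * A$4$3 - A$3$3 * A$4$1) + A$2$3 * (A$3$1 * A$4$2 - A$3$2 * A$4$1))"
proof -
  have f1234: "finite {2::4, 3, 4}" "1 \<notin> {2::4, 3, 4}" by auto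
  have f234: "finite {3::4, 4}" "2 \<notin> {3::4, 4}" by auto
  have f34: "finite {4::4}" "3 \<notin> {4::4}" by auto
  show ?thesis
    unfolding det_def UNIV_4
    unfolding sum_over_permutations_insert[OF f1234]
    unfolding sum_over_permutations_insert[OF f234]
    unfolding sum_over_permutations_insert[OF f34]
    unfolding permutes_sing
    by (simp add: sign_swap_id permutation_swap_id permutation_compose sign_compose sign_id swap_id_eq) (simp add: algebra_simps)
qed

lemma vector_4 [simp]:
  "(vector [a, b, c, e] :: 'a::zero^4) $ 1 = a" "(vector [a, b, c, e] :: 'a^4) $ 2 = b"
  "(vector [a, b, c, e] :: 'a^4) $ 3 = c" "(vector [a, b, c, e] :: 'a^4) $ 4 = e"
  unfolding vector_def by simp_all

definition rows4 :: "real^4 \<Rightarrow> real^4 \<Rightarrow> real^4 \<Rightarrow> real^4 \<Rightarrow> real" where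
  "rows4 a b c e = det (vector [a, b, c, e] :: real^4^4)"

definition eps :: "4 \<Rightarrow> 4 \<Rightarrow> 4 \<Rightarrow> 4 \<Rightarrow> real" where
  "eps i j k l = rows4 (axis i 1) (axis j 1) (axis k 1) (axis l 1)"

lemma rows4_sum1: "rows4 (\<Sum>i\<in>UNIV. (f i :: real) *\<^sub>R v i) b c e = (\<Sum>i\<in>(UNIV::4 set). f i * rows4 (v i) b c e)"
  unfolding rows4_def det_4 sum_4 by (simp add: algebra_simps)

lemma rows4_sum2: "rows4 a (\<Sum>i\<in>UNIV. (f i :: real) *\<^sub>R v i) c e = (\<Sum>i\<in>(UNIV::4 set). f i * rows4 a (v i) c e)"
  unfolding rows4_def det_4 sum_4 by (simp add: algebra_simps)

lemma rows4_sum3: "rows4 a b (\<Sum>i\<in>UNIV. (f i :: real) *\<^sub>R v i) e = (\<Sum>i\<in>(UNIV::4 set). f i * rows4 a b (v i) e)"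
  unfolding rows4_def det_4 sum_4 by (simp add: algebra_simps)

lemma rows4_sum4: "rows4 a b c (\<Sum>i\<in>UNIV. (f i :: real) *\<^sub>R v i) = (\<Sum>i\<in>(UNIV::4 set). f i * rows4 a b c (v i))"
  unfolding rows4_def det_4 sum_4 by (simp add: algebra_simps)

lemma rows4_matrix: "rows4 (M $ a) (M $ b) (M $ c) (M $ e) = eps a b c e * det M"
proof -
  have "(vector [M $ a, M $ b, M $ c, M $ e] :: real^4^4)
    = vector [axis a 1, axis b 1, axis c 1, axis e 1] ** M"
    unfolding vec_eq_iff forall_4 matrix_matrix_mult_def
    by (simp add: axis_def if_distrib[where f = "\<lambda>z. z * _"] cong: if_cong)
  then show ?thesis unfolding rows4_def eps_def by (simp add: det_mul)
qed

lemma eps_values: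
  "eps 1 2 m n = bv 3 4 m n" "eps 1 3 m n = - bv 2 4 m n" "eps 1 4 m n = bv 2 3 m n"
  "eps 2 3 m n = bv 1 4 m n" "eps 2 4 m n = - bv 1 3 m n" "eps 3 4 m n = bv 1 2 m n"
proof -
  have "\<forall>m n. eps 1 2 m n = bv 3 4 m n \<and> eps 1 3 m n = - bv 2 4 m n \<and> eps 1 4 m n = bv 2 3 m n \<and>
    eps 2 3 m n = bv 1 4 m n \<and> eps 2 4 m n = - bv 1 3 m n \<and> eps 3 4 m n = bv 1 2 m n"
    unfolding forall_4 eps_def rows4_def det_4 bv_def by (intro conjI; simp add: axis_def)
  then show "eps 1 2 m n = bv 3 4 m n" "eps 1 3 m n = - bv 2 4 m n" "eps 1 4 m n = bv 2 3 m n"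
    "eps 2 3 m n = bv 1 4 m n" "eps 2 4 m n = - bv 1 3 m n" "eps 3 4 m n = bv 1 2 m n" by blast+
qed

lemma eps_swap: "eps b a m n = - eps a b m n"
  unfolding eps_def rows4_def det_4 by (simp add: algebra_simps)

context metric_frame
begin

definition detP :: "real^4 \<Rightarrow> real" where
  "detP x = det (\<chi> a i. P x i a)"

text \<open>The volume form is multilinear, so on frame vectors it is \<open>det P\<close> times the permutation symbol, and the coframe converts back to coordinates.\<close>

lemma vol_frame:
  assumes x: "x \<in> U"
  shows "(\<Sum>p\<in>UNIV. \<Sum>r\<in>UNIV. P x p c * P x r e * eps p r i j) = pull2 (Q x) (\<lambda>m n. detP x * eps c e m n) i j"
proof -
  define M :: "real^4^4" where "M = (\<chi> a i. P x i a)"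
  have M: "M $ a = (\<Sum>p\<in>UNIV. P x p a *\<^sub>R axis p 1)" for a
    unfolding M_def vec_eq_iff by (simp add: axis_def if_distrib[where f = "\<lambda>z. _ * z"] cong: if_cong)
  have ax: "axis i 1 = (\<Sum>m\<in>UNIV. Q x m i *\<^sub>R M $ m)" for i
  proof -
    have "(\<Sum>m\<in>UNIV. Q x m i * P x k m) = (if k = i then 1 else 0)" for k
      using PQ[OF x, of k i] by (simp add: mult.commute)
    then show ?thesis unfolding vec_eq_iff M_def by (simp add: axis_def)
  qed
  have "(\<Sum>p\<in>UNIV. \<Sum>r\<in>UNIV. P x p c * P x r e * eps p r i j) = rows4 (M $ c) (M $ e) (axis i 1) (axis j 1)"
    unfolding M unfolding rows4_sum1 unfolding rows4_sum2 eps_def by (simp add: sum_distrib_left mult_ac)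
  also have "\<dots> = (\<Sum>m\<in>UNIV. Q x m i * (\<Sum>n\<in>UNIV. Q x n j * rows4 (M $ c) (M $ e) (M $ m) (M $ n)))"
    unfolding ax[of i] ax[of j] unfolding rows4_sum3 unfolding rows4_sum4 ..
  also have "\<dots> = pull2 (Q x) (\<lambda>m n. detP x * eps c e m n) i j"
    unfolding rows4_matrix pull2_def pull1_def detP_def M_def by (simp add: mult.commute)
  finally show ?thesis .
qed

lemma raise_indices:
  assumes x: "x \<in> U"
  shows "(\<Sum>a\<in>UNIV. \<Sum>b\<in>UNIV. matrix_inv (g x) $ p $ a * matrix_inv (g x) $ r $ b * pull2 (Q x) \<tau> a b)
    = (\<Sum>c\<in>UNIV. \<Sum>e\<in>UNIV. P x p c * P x r e * (\<tau> c e / (H x c * H x e)))"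
proof -
  have one: "(\<Sum>a\<in>UNIV. matrix_inv (g x) $ p $ a * pull1 (Q x) s a) = (\<Sum>c\<in>UNIV. P x p c * (s c / H x c))" for p s
  proof -
    have "(\<Sum>a\<in>UNIV. matrix_inv (g x) $ p $ a * pull1 (Q x) s a)
      = (\<Sum>a\<in>UNIV. \<Sum>c\<in>UNIV. P x p c / H x c * (P x a c * pull1 (Q x) s a))"
      unfolding matrix_inv_g(1)[OF x] sum_distrib_right by (simp add: mult_ac)
    also have "\<dots> = (\<Sum>c\<in>UNIV. P x p c / H x c * (\<Sum>a\<in>UNIV. P x a c * pull1 (Q x) s a))"
      by (subst sum.swap) (simp add: sum_distrib_left)
    finally show ?thesis unfolding contract_pull1[OF x] by simp
  qed
  have "(\<Sum>a\<in>UNIV. \<Sum>b\<in>UNIV. matrix_inv (g x) $ p $ a * matrix_inv (g x) $ r $ b * pull2 (Q x) \<tau> a b)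
    = (\<Sum>a\<in>UNIV. matrix_inv (g x) $ p $ a * (\<Sum>b\<in>UNIV. matrix_inv (g x) $ r $ b * pull1 (Q x) (\<lambda>e. pull1 (Q x) (\<lambda>c. \<tau> c e) a) b))"
    unfolding pull2_def sum_distrib_left by (subst pull1_swap) (simp add: mult_ac)
  also have "\<dots> = (\<Sum>a\<in>UNIV. matrix_inv (g x) $ p $ a * pull1 (Q x) (\<lambda>c. \<Sum>e\<in>UNIV. P x r e * (\<tau> c e / H x e)) a)"
  proof -
    have "(\<Sum>b\<in>UNIV. matrix_inv (g x) $ r $ b * pull1 (Q x) (\<lambda>e. pull1 (Q x) (\<lambda>c. \<tau> c e) a) b)
      = pull1 (Q x) (\<lambda>c. \<Sum>e\<in>UNIV. P x r e * (\<tau> c e / H x e)) a" for a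
      unfolding one[of r] divide_inverse by (simp only: pull_linear)
    then show ?thesis by (simp only:)
  qed
  also have "\<dots> = (\<Sum>c\<in>UNIV. \<Sum>e\<in>UNIV. P x p c * P x r e * (\<tau> c e / (H x c * H x e)))"
    unfolding one by (simp add: sum_distrib_left sum_divide_distrib mult_ac)
  finally show ?thesis .
qed

lemma hodge_frame:
  assumes x: "x \<in> U" and \<alpha>: "\<And>a b. \<alpha> a b x = pull2 (Q x) \<tau> a b"
  shows "hodge g \<sigma> \<alpha> i j x = pull2 (Q x) (\<lambda>m n. (1/2) * (\<Sum>c\<in>UNIV. \<Sum>e\<in>UNIV.
     \<tau> c e / (H x c * H x e) * (\<sigma> x * sqrt (det (g x)) * detP x * eps c e m n))) i j"
proof -
  define w where "w = \<sigma> x * sqrt (det (g x))"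
  have "hodge g \<sigma> \<alpha> i j x = (1/2) * (\<Sum>p\<in>UNIV. \<Sum>r\<in>UNIV. \<Sum>c\<in>UNIV. \<Sum>e\<in>UNIV.
      \<tau> c e / (H x c * H x e) * w * (P x p c * P x r e * eps p r i j))"
    unfolding hodge_def \<alpha> raise_indices[OF x] vol_form_def eps_def rows4_def w_def
    by (simp add: sum_distrib_left sum_distrib_right mult_ac)
  also have "(\<Sum>p\<in>UNIV. \<Sum>r\<in>UNIV. \<Sum>c\<in>UNIV. \<Sum>e\<in>UNIV.
      \<tau> c e / (H x c * H x e) * w * (P x p c * P x r e * eps p r i j))
    = (\<Sum>c\<in>UNIV. \<Sum>e\<in>UNIV. \<Sum>p\<in>UNIV. \<Sum>r\<in>UNIV.
      \<tau> c e / (H x c * H x e) * w * (P x p c * P x r e * eps p r i j))"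
  proof -
    have swap4: "(\<Sum>p\<in>UNIV. \<Sum>r\<in>UNIV. \<Sum>c\<in>UNIV. \<Sum>e\<in>UNIV. T p r c e) = (\<Sum>c\<in>UNIV. \<Sum>e\<in>UNIV. \<Sum>p\<in>UNIV. \<Sum>r\<in>UNIV. T p r c e)"
      for T :: "4 \<Rightarrow> 4 \<Rightarrow> 4 \<Rightarrow> 4 \<Rightarrow> real"
    proof -
      have "(\<Sum>p\<in>UNIV. \<Sum>r\<in>UNIV. \<Sum>c\<in>UNIV. \<Sum>e\<in>UNIV. T p r c e) = (\<Sum>p\<in>UNIV. \<Sum>c\<in>UNIV. \<Sum>r\<in>UNIV. \<Sum>e\<in>UNIV. T p r c e)"
        by (rule sum.cong[OF refl], rule sum.swap)
      also have "\<dots> = (\<Sum>c\<in>UNIV. \<Sum>p\<in>UNIV. \<Sum>r\<in>UNIV. \<Sum>e\<in>UNIV. T p r c e)"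
        by (rule sum.swap)
      also have "\<dots> = (\<Sum>c\<in>UNIV. \<Sum>p\<in>UNIV. \<Sum>e\<in>UNIV. \<Sum>r\<in>UNIV. T p r c e)"
        by (rule sum.cong[OF refl], rule sum.cong[OF refl], rule sum.swap)
      also have "\<dots> = (\<Sum>c\<in>UNIV. \<Sum>e\<in>UNIV. \<Sum>p\<in>UNIV. \<Sum>r\<in>UNIV. T p r c e)"
        by (rule sum.cong[OF refl], rule sum.swap)
      finally show ?thesis .
    qed
    show ?thesis by (rule swap4)
  qed
  also have "\<dots> = (\<Sum>c\<in>UNIV. \<Sum>e\<in>UNIV. \<tau> c e / (H x c * H x e) * w * pull2 (Q x) (\<lambda>m n. detP x * eps c e m n) i j)"
    unfolding vol_frame[OF x, symmetric] by (simp add: sum_distrib_left)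
  also have "(1/2) * \<dots> = pull2 (Q x) (\<lambda>m n. (1/2) * (\<Sum>c\<in>UNIV. \<Sum>e\<in>UNIV.
     \<tau> c e / (H x c * H x e) * (w * detP x * eps c e m n))) i j"
    unfolding pull2_def by (simp only: pull_linear mult.assoc)
  finally show ?thesis unfolding w_def .
qed

lemma weyl_plus_frame:
  assumes x: "x \<in> U" and v: "\<sigma> x * sqrt (det (g x)) * detP x = v"
  shows "weyl_plus g \<sigma> i j k l x = pull4 (Q x) (\<lambda>m n c e. (1/2) * (Wl x m n c e + (1/2) * (\<Sum>a\<in>UNIV. \<Sum>b\<in>UNIV.
     Wl x a b c e / (H x a * H x b) * (v * eps a b m n)))) i j k l"
proof -
  have W: "weyl g a b k l x = pull2 (Q x) (\<lambda>a b. pull2 (Q x) (Wl x a b) k l) a b" for a b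
    unfolding weyl_eq[OF x] pull_defs ..
  have "weyl_plus g \<sigma> i j k l x = (1/2) * (pull2 (Q x) (\<lambda>m n. pull2 (Q x) (Wl x m n) k l) i j
     + pull2 (Q x) (\<lambda>m n. (1/2) * (\<Sum>a\<in>UNIV. \<Sum>b\<in>UNIV.
     pull2 (Q x) (Wl x a b) k l / (H x a * H x b) * (v * eps a b m n))) i j)"
    unfolding weyl_plus_def hodge_frame[OF x, of "\<lambda>a b. weyl g a b k l" "\<lambda>a b. pull2 (Q x) (Wl x a b) k l", OF W] v W ..
  then show ?thesis
    unfolding pull_defs divide_inverse by (simp only: pull_linear)
qed

end

lemma hodge_bv:
  fixes H :: "4 \<Rightarrow> real" and v :: real
  assumes "p \<noteq> r"
  shows "(\<Sum>a\<in>UNIV. \<Sum>b\<in>UNIV. bv p r a b / (H a * H b) * (v * eps a b m n)) = 2 * v * eps p r m n / (H p * H r)"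
proof -
  have "bv p r a b = (if a = p then (if b = r then 1 else 0) else 0) - (if a = r then (if b = p then 1 else 0) else 0)" for a b
    using assms by (auto simp: bv_def)
  then have "(\<Sum>a\<in>UNIV. \<Sum>b\<in>UNIV. bv p r a b / (H a * H b) * (v * eps a b m n))
     = (\<Sum>a\<in>UNIV. \<Sum>b\<in>UNIV. if a = p then if b = r then v * eps a b m n / (H a * H b) else 0 else 0)
     - (\<Sum>a\<in>UNIV. \<Sum>b\<in>UNIV. if a = r then if b = p then v * eps a b m n / (H a * H b) else 0 else 0)"
    unfolding sum_subtractf[symmetric] by (intro sum.cong refl) simp
  also have "\<dots> = 1 / (H p * H r) * (v * eps p r m n) - 1 / (H r * H p) * (v * eps r p m n)"
  proof -
    have "(\<Sum>a\<in>UNIV. \<Sum>b\<in>UNIV. if a = i then if b = j then K a b else 0 else 0) = K i j"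
      for i j :: 4 and K :: "4 \<Rightarrow> 4 \<Rightarrow> real"
    proof -
      have "(\<Sum>b\<in>UNIV. if a = i then if b = j then K a b else 0 else 0) = (if a = i then K a j else 0)" for a
        by simp
      then show ?thesis by simp
    qed
    then show ?thesis by simp
  qed
  finally show ?thesis unfolding eps_swap[of r p] by (simp add: mult.commute)
qed

text \<open>The Hodge star exchanges the two members of each pairing \<open>13|24\<close>, \<open>12|34\<close>, \<open>14|23\<close>, so \<open>q\<close> cancels in \<open>W + *W\<close>. The factor \<open>- 1\<close> is the value of the volume form on the frame found in \<open>volume_sign\<close>.\<close>

lemma selfdual_riemann_table:
  fixes H :: "4 \<Rightarrow> real" and s q :: real
  assumes nz: "\<And>a. H a \<noteq> 0" and H: "H 1 * H 3 = 1" "H 2 * H 4 = 1"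
  defines "W \<equiv> riemann_table (s + q / 2) (s + q / 2) q (q + 2 * s) H"
  shows "(1/2) * (W m n c e + (1/2) * (\<Sum>a\<in>UNIV. \<Sum>b\<in>UNIV. W a b c e / (H a * H b) * (- 1 * eps a b m n)))
    = riemann_table (s / 2) (s / 2) (- s) s H m n c e"
proof -
  define St where "St p r = (\<Sum>a\<in>UNIV. \<Sum>b\<in>UNIV. bv p r a b / (H a * H b) * (- 1 * eps a b m n))" for p r :: 4
  have H3: "H 3 = 1 / H 1" and H4: "H 4 = 1 / H 2"
    using H nz[of 1] nz[of 2] by (auto simp: field_simps)
  have St: "St 1 2 = - 2 * bv 3 4 m n / (H 1 * H 2)" "St 1 3 = 2 * bv 2 4 m n" "St 1 4 = - 2 * bv 2 3 m n / (H 1 * H 4)"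
    "St 2 3 = - 2 * bv 1 4 m n / (H 2 * H 3)" "St 2 4 = 2 * bv 1 3 m n" "St 3 4 = - 2 * bv 1 2 m n / (H 3 * H 4)"
    unfolding St_def by (subst hodge_bv; simp add: eps_values H)+
  have "(\<Sum>a\<in>UNIV. \<Sum>b\<in>UNIV. W a b c e / (H a * H b) * (- 1 * eps a b m n)) =
     (s + q / 2) * bv 1 3 c e * St 1 3 + (s + q / 2) * bv 2 4 c e * St 2 4
     - q / 2 * (bv 2 4 c e * St 1 3 + bv 1 3 c e * St 2 4)
     - q / 4 * (bv 3 4 c e * St 1 2 + bv 1 2 c e * St 3 4 + bv 2 3 c e * St 1 4 + bv 1 4 c e * St 2 3)
     - (q + 2 * s) / 4 * (H 1 * H 2 * bv 1 2 c e * St 1 2 + H 3 * H 4 * bv 3 4 c e * St 3 4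
              + H 1 * H 4 * bv 1 4 c e * St 1 4 + H 2 * H 3 * bv 2 3 c e * St 2 3)"
    unfolding W_def riemann_table_def St_def sum_distrib_left sum.distrib[symmetric] sum_subtractf[symmetric]
    by (intro sum.cong refl) (simp add: add_divide_distrib diff_divide_distrib algebra_simps)
  then show ?thesis
    unfolding St W_def riemann_table_def H3 H4 using nz[of 1] nz[of 2] by (simp add: field_simps)
qed

section \<open>Complex structures, hamiltonian fields and the conformal metric\<close>

lemma (in metric_frame) ham_field_frame:
  assumes x: "x \<in> U" and J: "\<And>i j. J x $ i $ j = (\<Sum>a\<in>UNIV. P x i a * pull1 (Q x) (\<iota> a) j)"
  shows "ham_field g J \<phi> x $ i
    = (\<Sum>a\<in>UNIV. P x i a * (\<Sum>b\<in>UNIV. \<iota> a b * ((\<Sum>j\<in>UNIV. P x j b * partial j \<phi> x) / H x b)))"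
proof -
  define E where "E b = (\<Sum>j\<in>UNIV. P x j b * partial j \<phi> x) / H x b" for b
  have grad: "gradient g \<phi> x $ j = (\<Sum>b\<in>UNIV. P x j b * E b)" for j
  proof -
    have "gradient g \<phi> x $ j = (\<Sum>l\<in>UNIV. \<Sum>b\<in>UNIV. P x j b / H x b * (P x l b * partial l \<phi> x))"
      unfolding gradient_def differential_def matrix_vector_mult_def matrix_inv_g(1)[OF x]
      by (simp add: sum_distrib_left sum_distrib_right mult_ac)
    also have "\<dots> = (\<Sum>b\<in>UNIV. P x j b / H x b * (\<Sum>l\<in>UNIV. P x l b * partial l \<phi> x))"
      by (subst sum.swap) (simp add: sum_distrib_left)
    finally show ?thesis unfolding E_def by simp
  qed
  have JP: "(\<Sum>j\<in>UNIV. J x $ i $ j * P x j b) = (\<Sum>a\<in>UNIV. P x i a * \<iota> a b)" for b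
  proof -
    have "(\<Sum>j\<in>UNIV. J x $ i $ j * P x j b) = (\<Sum>j\<in>UNIV. \<Sum>a\<in>UNIV. P x i a * (P x j b * pull1 (Q x) (\<iota> a) j))"
      unfolding J sum_distrib_right by (simp add: sum_distrib_left sum_distrib_right mult_ac)
    also have "\<dots> = (\<Sum>a\<in>UNIV. P x i a * (\<Sum>j\<in>UNIV. P x j b * pull1 (Q x) (\<iota> a) j))"
      by (subst sum.swap) (simp add: sum_distrib_left)
    finally show ?thesis unfolding contract_pull1[OF x] .
  qed
  have "ham_field g J \<phi> x $ i = (\<Sum>b\<in>UNIV. (\<Sum>j\<in>UNIV. J x $ i $ j * P x j b) * E b)"
    unfolding ham_field_def matrix_vector_mult_def[of "J x"] grad
    by (simp add: sum_distrib_left sum_distrib_right mult_ac) (rule sum.swap)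
  also have "\<dots> = (\<Sum>a\<in>UNIV. P x i a * (\<Sum>b\<in>UNIV. \<iota> a b * E b))"
    unfolding JP sum_distrib_left sum_distrib_right by (subst sum.swap) (simp add: mult_ac)
  finally show ?thesis unfolding E_def .
qed

lemma partial_two_variables:
  assumes "open U" "x \<in> U" "\<And>y. y \<in> U \<Longrightarrow> \<phi> y = \<psi> (y $ 1) (y $ 2)"
  shows "partial 3 \<phi> x = 0" "partial 4 \<phi> x = 0"
    "((\<lambda>u. \<psi> u (x $ 2)) has_real_derivative A) (at (x $ 1)) \<Longrightarrow> partial 1 \<phi> x = A"
    "((\<lambda>v. \<psi> (x $ 1) v) has_real_derivative B) (at (x $ 2)) \<Longrightarrow> partial 2 \<phi> x = B"
proof -
  have eq: "partial k \<phi> x = partial k (\<lambda>y. \<psi> (y $ 1) (y $ 2)) x" for k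
    by (rule partial_cong[OF assms(1,2)]) (rule assms(3))
  have "has_partial 3 (\<lambda>y. \<psi> (y $ 1) (y $ 2)) 0 x" "has_partial 4 (\<lambda>y. \<psi> (y $ 1) (y $ 2)) 0 x"
    by (simp_all add: has_partial_def axis_def)
  then show "partial 3 \<phi> x = 0" "partial 4 \<phi> x = 0"
    unfolding eq by (auto dest: has_partial_imp_partial)
  show "partial 1 \<phi> x = A" if A: "((\<lambda>u. \<psi> u (x $ 2)) has_real_derivative A) (at (x $ 1))"
  proof -
    have "has_partial 1 (\<lambda>y. \<psi> (y $ 1) (y $ 2)) A x"
      using DERIV_shift[of "\<lambda>u. \<psi> u (x $ 2)" A 0 "x $ 1"] A
      by (simp add: has_partial_def axis_def add.commute)
    then show ?thesis unfolding eq by (rule has_partial_imp_partial)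
  qed
  show "partial 2 \<phi> x = B" if B: "((\<lambda>v. \<psi> (x $ 1) v) has_real_derivative B) (at (x $ 2))"
  proof -
    have "has_partial 2 (\<lambda>y. \<psi> (y $ 1) (y $ 2)) B x"
      using DERIV_shift[of "\<lambda>v. \<psi> (x $ 1) v" B 0 "x $ 2"] B
      by (simp add: has_partial_def axis_def add.commute)
    then show ?thesis unfolding eq by (rule has_partial_imp_partial)
  qed
qed

text \<open>Frame matrix of \<open>J\<close> for \<open>\<tau> = 1\<close> and of \<open>I\<close> for \<open>\<tau> = - 1\<close>: the sign affects only the plane of \<open>\<theta>\<^sub>2, \<theta>\<^sub>4\<close>.\<close>

definition iota :: "real \<Rightarrow> real \<Rightarrow> real \<Rightarrow> real \<Rightarrow> 4 \<Rightarrow> 4 \<Rightarrow> real" where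
  "iota \<tau> d f g = sel4 (sel4 0 0 (- f / d) 0) (sel4 0 0 0 (\<tau> * g / d)) (sel4 (d / f) 0 0 0) (sel4 0 (- \<tau> * d / g) 0 0)"

definition diota :: "real \<Rightarrow> real \<Rightarrow> real \<Rightarrow> real \<Rightarrow> real \<Rightarrow> real \<Rightarrow> 4 \<Rightarrow> 4 \<Rightarrow> 4 \<Rightarrow> real" where
  "diota \<tau> d f f1 g g1 = sel4
    (sel4 (sel4 0 0 (- f1 / d + f / d^2) 0) (sel4 0 0 0 (- \<tau> * g / d^2)) (sel4 (1 / f - d * f1 / f^2) 0 0 0) (sel4 0 (- \<tau> / g) 0 0))
    (sel4 (sel4 0 0 (- f / d^2) 0) (sel4 0 0 0 (\<tau> * g1 / d + \<tau> * g / d^2)) (sel4 (- 1 / f) 0 0 0) (sel4 0 (\<tau> / g + \<tau> * d * g1 / g^2) 0 0))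
    (\<lambda>_ _. 0) (\<lambda>_ _. 0)"

lemma iota_derivative_1:
  assumes nz: "D t \<noteq> 0" "F t \<noteq> 0" "g \<noteq> 0"
    and D: "(D has_real_derivative 1) (at t)" and F: "(F has_real_derivative f1) (at t)"
  shows "((\<lambda>t. iota \<tau> (D t) (F t) g a b) has_real_derivative diota \<tau> (D t) (F t) f1 g g1 1 a b) (at t)"
proof -
  have "\<forall>a b. ((\<lambda>t. iota \<tau> (D t) (F t) g a b) has_real_derivative diota \<tau> (D t) (F t) f1 g g1 1 a b) (at t)"
    unfolding forall_4 iota_def diota_def
    by (intro conjI; simp;
        rule DERIV_cong, (auto intro!: derivative_eq_intros D F simp: nz)[1]; use nz in \<open>simp add: field_simps eval_nat_numeral\<close>)
  then show ?thesis by blast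
qed

lemma iota_derivative_2:
  assumes nz: "D t \<noteq> 0" "f \<noteq> 0" "G t \<noteq> 0"
    and D: "(D has_real_derivative - 1) (at t)" and G: "(G has_real_derivative g1) (at t)"
  shows "((\<lambda>t. iota \<tau> (D t) f (G t) a b) has_real_derivative diota \<tau> (D t) f f1 (G t) g1 2 a b) (at t)"
proof -
  have "\<forall>a b. ((\<lambda>t. iota \<tau> (D t) f (G t) a b) has_real_derivative diota \<tau> (D t) f f1 (G t) g1 2 a b) (at t)"
    unfolding forall_4 iota_def diota_def
    by (intro conjI; simp;
        rule DERIV_cong, (auto intro!: derivative_eq_intros D G simp: nz)[1]; use nz in \<open>simp add: field_simps eval_nat_numeral\<close>)
  then show ?thesis by blast
qed

text \<open>The conformal factor \<open>d\<^sup>-\<^sup>2\<close> is exactly what makes \<open>I\<close> parallel.\<close>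

lemma iota_parallel:
  fixes d f g f1 g1 :: real
  assumes nz: "d \<noteq> 0" "f \<noteq> 0" "g \<noteq> 0"
  shows "diota (-1) d f f1 g g1 c a b + (\<Sum>e\<in>UNIV. conn 1 d f f1 g g1 a c e * iota (-1) d f g e b)
     - (\<Sum>e\<in>UNIV. conn 1 d f f1 g g1 e c b * iota (-1) d f g a e) = 0"
proof -
  have "\<forall>c a b. diota (-1) d f f1 g g1 c a b + (\<Sum>e\<in>UNIV. conn 1 d f f1 g g1 a c e * iota (-1) d f g e b)
     - (\<Sum>e\<in>UNIV. conn 1 d f f1 g g1 e c b * iota (-1) d f g a e) = 0"
    unfolding forall_4 sum_4 conn_def iota_def diota_def
    by (intro conjI; simp add: nz; simp add: field_simps nz eval_nat_numeral)
  then show ?thesis by blast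
qed

locale ot_structures = ot_geometry +
  fixes J I :: matfield and \<sigma> :: scalar
  assumes form: "\<And>x. x \<in> U \<Longrightarrow> fundamental_form g J x = ot_form x"
    and I_square: "\<And>x. x \<in> U \<Longrightarrow> I x ** I x = - mat 1"
    and I_row1: "\<And>x. x \<in> U \<Longrightarrow> I x $ 1 = J x $ 1" and I_row2: "\<And>x. x \<in> U \<Longrightarrow> I x $ 2 = - J x $ 2"
    and positive: "\<And>x v. x \<in> U \<Longrightarrow> v \<noteq> 0 \<Longrightarrow> v \<bullet> (g x *v v) > 0"
    and oriented: "\<And>x u v. x \<in> U \<Longrightarrow> rows4 u (J x *v u) v (J x *v v) \<noteq> 0 \<Longrightarrow>
          sgn (rows4 u (J x *v u) v (J x *v v)) = \<sigma> x"
begin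

text \<open>\<open>J\<close> is recovered from the fundamental form by raising an index, which the diagonal metric makes explicit.\<close>

lemma J_coframe:
  assumes x: "x \<in> U"
  shows "(\<Sum>i\<in>UNIV. ot_Q x a i * J x $ i $ j) = pull1 (ot_Q x) (iota 1 (d x) (f x) (g0 x) a) j"
proof -
  define X where "X a i = (\<Sum>k\<in>UNIV. ot_Q x a k * J x $ k $ i)" for a i
  define w :: "4 \<Rightarrow> 4 \<Rightarrow> real" where "w a b = bv 1 3 a b + bv 2 4 a b" for a b
  have ax: "(A *v axis i (1::real)) $ k = A $ k $ i" for A :: "real^4^4" and i k
    by (simp add: matrix_vector_mult_def axis_def if_distrib[where f = "\<lambda>z. _ * z"] cong: if_cong)
  have "fundamental_form g J x $ i $ j = (\<Sum>k\<in>UNIV. J x $ k $ i * g x $ k $ j)" for i j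
    unfolding fundamental_form_def by (simp add: inner_vec_def ax)
  also have "(\<Sum>k\<in>UNIV. J x $ k $ i * g x $ k $ j) = pull1 (ot_Q x) (\<lambda>a. X a i * oH 0 x a) j" for i j
    unfolding K.g[OF x] X_def pull1_def sum_distrib_left sum_distrib_right by (subst sum.swap) (simp add: mult_ac)
  finally have L: "fundamental_form g J x $ i $ j = pull1 (ot_Q x) (\<lambda>a. X a i * oH 0 x a) j" for i j .
  have "\<forall>i j. ot_form x $ i $ j = pull1 (ot_Q x) (\<lambda>a. pull1 (ot_Q x) (\<lambda>b. w b a) i) j"
    unfolding forall_4 pull1_def sum_4 ot_form_def Let_def wedge_def ot_Q_def w_def bv_def by (simp add: axis_def)
  then have "pull1 (ot_Q x) (\<lambda>a. X a i * oH 0 x a) j = pull1 (ot_Q x) (\<lambda>a. pull1 (ot_Q x) (\<lambda>b. w b a) i) j" for i j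
    using L form[OF x] by metis
  then have "X a i * oH 0 x a = pull1 (ot_Q x) (\<lambda>b. w b a) i" for a i
    using K.contract_pull1[OF x, of a "\<lambda>a. X a i * oH 0 x a"] K.contract_pull1[OF x, of a "\<lambda>a. pull1 (ot_Q x) (\<lambda>b. w b a) i"]
    by simp
  then have "X a i = pull1 (ot_Q x) (\<lambda>b. w b a / oH 0 x a) i" for a i
    using K.H_nonzero[OF x, of a] unfolding divide_inverse pull1_multc
    by (simp add: nonzero_eq_divide_eq flip: divide_inverse)
  moreover have "\<forall>a b. w b a / ot_H \<delta> p r a = iota 1 \<delta> p r a b" for \<delta> p r
    unfolding forall_4 w_def bv_def ot_H_def iota_def by simp
  then have "w b a / oH 0 x a = iota 1 (d x) (f x) (g0 x) a b" for a b
    unfolding oH_0 by blast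
  ultimately show ?thesis unfolding X_def by simp
qed

text \<open>The action on \<open>d\<xi>\<close> and \<open>d\<eta>\<close> gives the first two rows, and \<open>I\<^sup>2 = -1\<close> the other two.\<close>

lemma I_coframe:
  assumes x: "x \<in> U"
  shows "(\<Sum>i\<in>UNIV. ot_Q x a i * I x $ i $ j) = pull1 (ot_Q x) (iota (-1) (d x) (f x) (g0 x) a) j"
proof -
  note nz = d_nz[OF x] F_nz[OF x] G_nz[OF x]
  have J1: "J x $ 1 $ j = pull1 (ot_Q x) (iota 1 (d x) (f x) (g0 x) 1) j" for j
    using J_coframe[OF x, of 1 j] by (simp add: ot_Q_def sum_4)
  have J2: "J x $ 2 $ j = pull1 (ot_Q x) (iota 1 (d x) (f x) (g0 x) 2) j" for j
    using J_coframe[OF x, of 2 j] by (simp add: ot_Q_def sum_4)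
  have I1: "I x $ 1 $ j = - f x / d x * ot_Q x 3 j" for j
    unfolding I_row1[OF x] J1 by (simp add: pull1_def sum_4 iota_def)
  have I2: "I x $ 2 $ j = - g0 x / d x * ot_Q x 4 j" for j
    unfolding I_row2[OF x] vector_uminus_component J2 by (simp add: pull1_def sum_4 iota_def)
  have sq: "(\<Sum>k\<in>UNIV. I x $ i $ k * I x $ k $ j) = (if i = j then -1 else 0)" for i j
    using arg_cong[OF I_square[OF x], of "\<lambda>M. M $ i $ j"] by (simp add: matrix_matrix_mult_def mat_def)
  have inv: "Y = (if b then \<delta> / p else 0)"
    if "- p / \<delta> * Y = (if b then -1 else 0)" "\<delta> \<noteq> 0" "p \<noteq> 0" for Y p \<delta> :: real and b
    using that by (cases b) (auto simp: field_simps)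
  have "- f x / d x * (\<Sum>k\<in>UNIV. ot_Q x 3 k * I x $ k $ j) = (if 1 = j then -1 else 0)" for j
    using sq[of 1 j] unfolding I1 by (simp add: sum_distrib_left mult.assoc)
  then have 3: "(\<Sum>k\<in>UNIV. ot_Q x 3 k * I x $ k $ j) = (if 1 = j then d x / f x else 0)" for j
    by (rule inv[OF _ nz(1,2)])
  have "- g0 x / d x * (\<Sum>k\<in>UNIV. ot_Q x 4 k * I x $ k $ j) = (if 2 = j then -1 else 0)" for j
    using sq[of 2 j] unfolding I2 by (simp add: sum_distrib_left mult.assoc)
  then have 4: "(\<Sum>k\<in>UNIV. ot_Q x 4 k * I x $ k $ j) = (if 2 = j then d x / g0 x else 0)" for j
    by (rule inv[OF _ nz(1,3)])
  have "\<forall>a j. (\<Sum>i\<in>UNIV. ot_Q x a i * I x $ i $ j) = pull1 (ot_Q x) (iota (-1) (d x) (f x) (g0 x) a) j"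
  proof (intro allI)
    fix a j
    have rows: "(\<Sum>i\<in>UNIV. ot_Q x 1 i * I x $ i $ j) = I x $ 1 $ j" "(\<Sum>i\<in>UNIV. ot_Q x 2 i * I x $ i $ j) = I x $ 2 $ j"
      by (simp_all add: sum_4 ot_Q_def)
    have "\<forall>a. (\<Sum>i\<in>UNIV. ot_Q x a i * I x $ i $ j) = pull1 (ot_Q x) (iota (-1) (d x) (f x) (g0 x) a) j"
      unfolding forall_4 rows I1 I2 3 4 using exhaust_4[of j]
      by (intro conjI; auto simp: pull1_def sum_4 iota_def ot_Q_def)
    then show "(\<Sum>i\<in>UNIV. ot_Q x a i * I x $ i $ j) = pull1 (ot_Q x) (iota (-1) (d x) (f x) (g0 x) a) j" by blast
  qed
  then show ?thesis by blast
qed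

lemma J_eq: "x \<in> U \<Longrightarrow> J x $ i $ j = (\<Sum>a\<in>UNIV. ot_P x i a * pull1 (ot_Q x) (iota 1 (d x) (f x) (g0 x) a) j)"
  using K.contract_PQ[of x i "\<lambda>l. J x $ l $ j"] by (simp add: J_coframe)

lemma I_eq: "x \<in> U \<Longrightarrow> I x $ i $ j = (\<Sum>a\<in>UNIV. ot_P x i a * pull1 (ot_Q x) (iota (-1) (d x) (f x) (g0 x) a) j)"
  using K.contract_PQ[of x i "\<lambda>l. I x $ l $ j"] by (simp add: I_coframe)

lemma H_positive:
  assumes x: "x \<in> U"
  shows "d x / f x > 0" "d x / g0 x < 0"
proof -
  have ax: "axis i 1 \<bullet> (g x *v axis i 1) = g x $ i $ i" for i
    unfolding inner_axis' by (simp add: matrix_vector_mult_def axis_def if_distrib[where f = "\<lambda>z. _ * z"] cong: if_cong)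
  have "g x $ 1 $ 1 = d x / f x" "g x $ 2 $ 2 = - d x / g0 x"
    unfolding K.g[OF x] oH_0 by (simp_all add: sum_4 ot_Q_def ot_H_def)
  moreover have "g x $ i $ i > 0" for i
    using positive[OF x, of "axis i 1"] unfolding ax by simp
  ultimately have "d x / f x > 0" "- d x / g0 x > 0" by metis+
  then show "d x / f x > 0" "d x / g0 x < 0"
    by (simp_all only: minus_divide_left[symmetric] neg_0_less_iff_less)
qed

text \<open>Since \<open>F G < 0\<close>, the orientation sign is \<open>- sgn d\<close>, while \<open>sqrt (det g) = \<bar>d\<bar>\<close> and \<open>det P = 1 / d\<close>.\<close>

lemma volume_sign:
  assumes x: "x \<in> U"
  shows "\<sigma> x * sqrt (det (g x)) * K.detP x = - 1"
proof -
  note nz = d_nz[OF x] F_nz[OF x] G_nz[OF x]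
  define \<delta> \<kappa> where "\<delta> = d x" and "\<kappa> = f x"
  define \<mu> where "\<mu> = g0 x"
  have x1: "x $ 1 = x $ 2 + \<delta>" and nz': "\<delta> \<noteq> 0" "\<kappa> \<noteq> 0" "\<mu> \<noteq> 0" and F': "F (x $ 1) = \<kappa>" "G (x $ 2) = \<mu>"
    using nz by (auto simp: \<delta>_def \<kappa>_def \<mu>_def)
  have "det (g x) = \<delta>^2"
    unfolding det_4 K.g[OF x] oH_0 F' sum_4 ot_Q_def ot_H_def unfolding x1
    using nz' by (simp add: field_simps) (simp add: algebra_simps eval_nat_numeral)?
  then have s: "sqrt (det (g x)) = \<bar>\<delta>\<bar>" by simp
  have P: "K.detP x = 1 / \<delta>"
    unfolding K.detP_def det_4 ot_P_def Let_def \<delta>_def[symmetric] unfolding x1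
    using nz' by (simp add: field_simps)
  have "rows4 (axis 1 1) (J x *v axis 1 1) (axis 2 1) (J x *v axis 2 1) = \<delta> / (\<kappa> * \<mu>)"
    unfolding rows4_def det_4 vector_4 matrix_vector_mult_def J_eq[OF x] pull1_def sum_4 ot_Q_def ot_P_def iota_def Let_def
      F' \<delta>_def[symmetric] unfolding x1
    using nz' by (simp add: axis_def) (simp add: field_simps)?
  then have "\<sigma> x = sgn (\<delta> / (\<kappa> * \<mu>))"
    using oriented[OF x, of "axis 1 1" "axis 2 1"] nz' by simp
  moreover have "\<delta> / \<kappa> > 0" "\<delta> / \<mu> < 0"
    using H_positive[OF x] unfolding \<delta>_def \<kappa>_def \<mu>_def .
  ultimately have "\<sigma> x = - sgn \<delta>"
    by (auto simp: sgn_if zero_less_divide_iff divide_less_0_iff zero_less_mult_iff mult_less_0_iff)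
  then show ?thesis unfolding s P using nz' by (auto simp: sgn_if abs_if)
qed

lemma weyl_plus_at_iff:
  assumes x: "x \<in> U"
  shows "(\<forall>i j k l. weyl_plus g \<sigma> i j k l x = 0) \<longleftrightarrow> Scal g x = 0"
proof -
  define s where "s = (r1 x + r2 x) / 3"
  have "ot_H \<delta> p r 1 * ot_H \<delta> p r 3 = 1" "ot_H \<delta> p r 2 * ot_H \<delta> p r 4 = 1"
    if "\<delta> \<noteq> 0" "p \<noteq> 0" "r \<noteq> 0" for \<delta> p r
    using that by (simp_all add: ot_H_def)
  from this[OF d_nz[OF x] F_nz[OF x] G_nz[OF x]]
  have H: "oH 0 x 1 * oH 0 x 3 = 1" "oH 0 x 2 * oH 0 x 4 = 1"
    unfolding oH_0 by blast+
  have W: "K.Wl x = riemann_table (s + q x / 2) (s + q x / 2) (q x) (q x + 2 * s) (oH 0 x)"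
    unfolding s_def by (intro ext) (rule Wl_table[OF x])
  have "weyl_plus g \<sigma> i j k l x = pull4 (ot_Q x) (riemann_table (s / 2) (s / 2) (- s) s (oH 0 x)) i j k l" for i j k l
    unfolding K.weyl_plus_frame[OF x, of \<sigma>, OF volume_sign[OF x]] W selfdual_riemann_table[OF K.H_nonzero[OF x] H] ..
  then have "(\<forall>i j k l. weyl_plus g \<sigma> i j k l x = 0) \<longleftrightarrow> (\<forall>a b c e. riemann_table (s / 2) (s / 2) (- s) s (oH 0 x) a b c e = 0)"
    using K.pull4_eq_0_iff[OF x] by simp
  also have "\<dots> \<longleftrightarrow> s = 0"
  proof
    assume "\<forall>a b c e. riemann_table (s / 2) (s / 2) (- s) s (oH 0 x) a b c e = 0"
    then have "riemann_table (s / 2) (s / 2) (- s) s (oH 0 x) 1 3 1 3 = 0" by blast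
    then show "s = 0" by (simp add: riemann_table_def bv_def)
  qed (simp add: riemann_table_def)
  also have "\<dots> \<longleftrightarrow> Scal g x = 0"
    unfolding s_def K.Scal_eq[OF x] Sc_eq[OF x] by auto
  finally show ?thesis .
qed

lemma ham_field_J:
  assumes x: "x \<in> U" and "partial 3 \<phi> x = 0" "partial 4 \<phi> x = 0"
  shows "ham_field g J \<phi> x $ 1 = 0" "ham_field g J \<phi> x $ 2 = 0"
    "ham_field g J \<phi> x $ 3 = (x $ 1 * partial 1 \<phi> x - x $ 2 * partial 2 \<phi> x) / d x"
    "ham_field g J \<phi> x $ 4 = (partial 2 \<phi> x - partial 1 \<phi> x) / d x"
proof -
  define \<delta> where "\<delta> = d x"
  have nz: "\<delta> \<noteq> 0" using d_nz[OF x] by (simp add: \<delta>_def)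
  show "ham_field g J \<phi> x $ 1 = 0" "ham_field g J \<phi> x $ 2 = 0"
    "ham_field g J \<phi> x $ 3 = (x $ 1 * partial 1 \<phi> x - x $ 2 * partial 2 \<phi> x) / d x"
    "ham_field g J \<phi> x $ 4 = (partial 2 \<phi> x - partial 1 \<phi> x) / d x"
    unfolding K.ham_field_frame[of x J, OF x J_eq[OF x]] sum_4 assms(2,3) oH_0 ot_P_def Let_def \<delta>_def[symmetric]
    using nz F_nz[OF x] G_nz[OF x]
    by (simp_all add: iota_def ot_H_def diff_divide_distrib)
qed

end

locale ot_conformal = ot_structures +
  fixes gc :: matfield
  assumes gc: "\<And>x. x \<in> U \<Longrightarrow> gc x = (1 / (x $ 1 - x $ 2)\<^sup>2) *\<^sub>R g x"
begin

sublocale C: metric_frame U ot_Q ot_P ot_dQ gc "oH 1" "doH 1" "o\<gamma> 1" "do\<gamma> 1"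
  by (rule ot_metric_frame) (simp_all add: g_eq gc)

lemma oH_1: "oH 1 x a = ot_H (d x) (f x) (g0 x) a / (d x)^2"
  by (simp add: oH_def)

lemma Scal_conformal:
  assumes x: "x \<in> U"
  shows "Scal gc x = (d x)^2 * ((g2 x - f2 x) / d x + 6 * q x)"
proof -
  have "C.Sc x = (d x)^2 * (\<Sum>a\<in>UNIV. (\<Sum>b\<in>UNIV. C.Rm x a b a b) / ot_H (d x) (f x) (g0 x) a)"
    unfolding C.Sc_def C.Ric_def oH_1 sum_distrib_left by (intro sum.cong refl) simp
  then show ?thesis
    unfolding C.Scal_eq[OF x] C.Rm_def o\<gamma>_def do\<gamma>_def of_nat_1 q_def
      frame_riemann_trace_conformal[OF d_nz[OF x] F_nz[OF x] G_nz[OF x]]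
    by (simp add: algebra_simps)
qed

lemma nabla_I:
  assumes x: "x \<in> U"
  shows "nabla_endo gc I k i j x = 0"
proof (rule C.nabla_endo_frame[OF x, where \<iota> = "\<lambda>y. iota (-1) (d y) (f y) (g0 y)"
      and d\<iota> = "diota (-1) (d x) (f x) (f1 x) (g0 x) (g1 x)"])
  fix y i j assume "y \<in> U"
  then show "I y $ i $ j = (\<Sum>a\<in>UNIV. ot_P y i a * pull1 (ot_Q y) (iota (-1) (d y) (f y) (g0 y) a) j)"
    by (rule I_eq)
next
  fix k a b
  note nz = d_nz[OF x] F_nz[OF x] G_nz[OF x]
  show "has_partial k (\<lambda>y. iota (-1) (d y) (f y) (g0 y) a b)
      (pull1 (ot_Q x) (\<lambda>c. diota (-1) (d x) (f x) (f1 x) (g0 x) (g1 x) c a b) k) x"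
  proof (rule has_partial_frame)
    show "((\<lambda>t. iota (-1) (t - x $ 2) (F t) (g0 x) a b) has_real_derivative
        diota (-1) (d x) (f x) (f1 x) (g0 x) (g1 x) 1 a b) (at (x $ 1))"
      by (rule iota_derivative_1[where D = "\<lambda>t. t - x $ 2"])
        (use nz dF[OF x] in \<open>auto intro!: derivative_eq_intros\<close>)
    show "((\<lambda>t. iota (-1) (x $ 1 - t) (f x) (G t) a b) has_real_derivative
        diota (-1) (d x) (f x) (f1 x) (g0 x) (g1 x) 2 a b) (at (x $ 2))"
      by (rule iota_derivative_2[where D = "\<lambda>t. x $ 1 - t"])
        (use nz dG[OF x] in \<open>auto intro!: derivative_eq_intros\<close>)
  qed (simp_all add: diota_def)
next
  fix c a b
  show "diota (-1) (d x) (f x) (f1 x) (g0 x) (g1 x) c a b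
      + (\<Sum>e\<in>UNIV. o\<gamma> 1 x a c e * iota (-1) (d x) (f x) (g0 x) e b)
      - (\<Sum>e\<in>UNIV. o\<gamma> 1 x e c b * iota (-1) (d x) (f x) (g0 x) a e) = 0"
    unfolding o\<gamma>_def of_nat_1 by (rule iota_parallel[OF d_nz[OF x] F_nz[OF x] G_nz[OF x]])
qed

lemma nijenhuis_I: "x \<in> U \<Longrightarrow> nijenhuis I i j k x = 0"
  by (rule nijenhuis_eq_0[where g = gc]) (simp_all add: nabla_I C.christoffel_sym)

lemma ham_field_I:
  assumes x: "x \<in> U" and "partial 3 \<phi> x = 0" "partial 4 \<phi> x = 0"
  shows "ham_field gc I \<phi> x $ 1 = 0" "ham_field gc I \<phi> x $ 2 = 0"
    "ham_field gc I \<phi> x $ 3 = d x * (x $ 1 * partial 1 \<phi> x + x $ 2 * partial 2 \<phi> x)"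
    "ham_field gc I \<phi> x $ 4 = - d x * (partial 1 \<phi> x + partial 2 \<phi> x)"
proof -
  define \<delta> where "\<delta> = d x"
  have nz: "\<delta> \<noteq> 0" using d_nz[OF x] by (simp add: \<delta>_def)
  show "ham_field gc I \<phi> x $ 1 = 0" "ham_field gc I \<phi> x $ 2 = 0"
    "ham_field gc I \<phi> x $ 3 = d x * (x $ 1 * partial 1 \<phi> x + x $ 2 * partial 2 \<phi> x)"
    "ham_field gc I \<phi> x $ 4 = - d x * (partial 1 \<phi> x + partial 2 \<phi> x)"
    unfolding C.ham_field_frame[of x I, OF x I_eq[OF x]] sum_4 assms(2,3) oH_1 ot_P_def Let_def \<delta>_def[symmetric]
    using nz F_nz[OF x] G_nz[OF x]
    by (simp_all add: iota_def ot_H_def field_simps eval_nat_numeral)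
qed

end

lemma lie_metric_constant:
  assumes "open U" "x \<in> U"
    and g: "\<And>y i j. y \<in> U \<Longrightarrow> g y $ i $ j = \<psi> i j (y $ 1) (y $ 2)"
    and K: "\<And>y. y \<in> U \<Longrightarrow> K y = v" and v: "v $ 1 = 0" "v $ 2 = 0"
  shows "lie_metric K g i j x = 0"
proof -
  have K0: "partial i (\<lambda>y. K y $ k) x = 0" for i k
  proof -
    have "partial i (\<lambda>y. K y $ k) x = partial i (\<lambda>y. v $ k) x"
      by (rule partial_cong[OF assms(1,2)]) (simp add: K)
    then show ?thesis using has_partial_imp_partial[OF has_partial_const] by simp
  qed
  have "partial 3 (\<lambda>y. g y $ i $ j) x = 0" "partial 4 (\<lambda>y. g y $ i $ j) x = 0"
    using partial_two_variables(1,2)[OF assms(1,2), of "\<lambda>y. g y $ i $ j" "\<psi> i j"] g by blast+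
  then show ?thesis
    unfolding lie_metric_def K0 sum_4 K[OF assms(2)] by (simp add: v)
qed

text \<open>The mixed components of the Lie derivative say that the metric annihilates \<open>\<partial>\<^sub>m K\<close>, and the metric is nondegenerate.\<close>

lemma killing_imp_constant:
  assumes "open U" "x \<in> U"
    and g: "\<And>y i j. y \<in> U \<Longrightarrow> g y $ i $ j = \<psi> i j (y $ 1) (y $ 2)"
    and block: "\<And>y i j. y \<in> U \<Longrightarrow> i \<in> {1, 2} \<Longrightarrow> j \<in> {3, 4} \<Longrightarrow> g y $ i $ j = 0 \<and> g y $ j $ i = 0"
    and inv: "matrix_inv (g x) ** g x = mat 1" and sym: "\<And>i j. g x $ i $ j = g x $ j $ i"
    and K: "\<And>y k. y \<in> U \<Longrightarrow> K y $ k = \<kappa> k (y $ 1) (y $ 2)"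
    and K12: "\<And>y. y \<in> U \<Longrightarrow> K y $ 1 = 0 \<and> K y $ 2 = 0"
    and lie: "\<And>i j. lie_metric K g i j x = 0" and m: "m = 1 \<or> m = 2"
  shows "partial m (\<lambda>y. K y $ k) x = 0"
proof -
  have zero: "partial i (\<lambda>y. \<phi> y) x = 0" if "\<And>y. y \<in> U \<Longrightarrow> \<phi> y = 0" for i \<phi>
  proof -
    have "partial i (\<lambda>y. \<phi> y) x = partial i (\<lambda>y. 0) x"
      by (rule partial_cong[OF assms(1,2)]) (simp add: that)
    then show ?thesis using has_partial_imp_partial[OF has_partial_const] by simp
  qed
  define w :: "real^4" where "w = (\<chi> k. partial m (\<lambda>y. K y $ k) x)"
  have w12: "w $ 1 = 0" "w $ 2 = 0"
    unfolding w_def by (simp_all add: zero K12)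
  have K34: "partial 3 (\<lambda>y. K y $ k) x = 0" "partial 4 (\<lambda>y. K y $ k) x = 0" for k
    using partial_two_variables(1,2)[OF assms(1,2), of "\<lambda>y. K y $ k" "\<kappa> k"] K by blast+
  have g34: "partial 3 (\<lambda>y. g y $ i $ j) x = 0" "partial 4 (\<lambda>y. g y $ i $ j) x = 0" for i j
    using partial_two_variables(1,2)[OF assms(1,2), of "\<lambda>y. g y $ i $ j" "\<psi> i j"] g by blast+
  have Kx: "K x $ 1 = 0" "K x $ 2 = 0" using K12[OF assms(2)] by auto
  have "(\<Sum>k\<in>UNIV. g x $ k $ j * w $ k) = 0" if "j = 3 \<or> j = 4" for j
  proof -
    have "partial j (\<lambda>y. K y $ k) x = 0" for k using that K34 by auto
    then show ?thesis
      using lie[of m j] unfolding lie_metric_def sum_4 by (simp add: Kx g34 w_def)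
  qed
  moreover have "(\<Sum>k\<in>UNIV. g x $ k $ j * w $ k) = 0" if "j = 1 \<or> j = 2" for j
    using that block[OF assms(2)] unfolding sum_4 w12 by auto
  ultimately have "(\<Sum>k\<in>UNIV. g x $ k $ j * w $ k) = 0" for j
    using exhaust_4[of j] by blast
  then have "g x *v w = 0"
    unfolding vec_eq_iff matrix_vector_mult_def using sym by simp
  then have "matrix_inv (g x) ** g x *v w = 0"
    by (simp add: matrix_vector_mul_assoc[symmetric])
  then have "w = 0" unfolding inv by simp
  then show ?thesis unfolding w_def by (simp add: vec_eq_iff)
qed

section \<open>Smooth functions and the planar differential equations\<close>

lemma differentiable_imp_has_partial:
  assumes "f differentiable (at x)"
  shows "has_partial i f (partial i f x) x"
proof -
  obtain D where D: "(f has_derivative D) (at x)"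
    using assms unfolding differentiable_def by blast
  have "((\<lambda>h. x + h *\<^sub>R axis i (1::real)) has_derivative (\<lambda>h. h *\<^sub>R axis i 1)) (at 0)"
    by (auto intro!: derivative_eq_intros)
  from diff_chain_at[OF this, of f D] D
  have "((\<lambda>h. f (x + h *\<^sub>R axis i 1)) has_derivative (\<lambda>h. D (h *\<^sub>R axis i 1))) (at 0)"
    by (simp add: o_def)
  moreover have "(\<lambda>h. D (h *\<^sub>R axis i 1)) = (*) (D (axis i 1))"
    using has_derivative_linear[OF D] by (auto simp: fun_eq_iff linear_cmul)
  ultimately have "has_partial i f (D (axis i 1)) x"
    unfolding has_partial_def has_field_derivative_def by simp
  then show ?thesis using has_partial_imp_partial by metis
qed

lemma differentiable_cong_open:
  assumes "open U" "x \<in> U" "\<And>y. y \<in> U \<Longrightarrow> f y = h y" "h differentiable (at x)"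
  shows "f differentiable (at x)"
  using assms unfolding differentiable_def by (metis has_derivative_transform_within_open)

text \<open>Smoothness by coinduction: a class of differentiable functions that is closed, on \<open>U\<close>, under partial derivatives consists of smooth functions.\<close>

lemma smooth_on_coinduct:
  assumes U: "open U" and f: "f \<in> \<P>"
    and diff: "\<And>f x. f \<in> \<P> \<Longrightarrow> x \<in> U \<Longrightarrow> f differentiable (at x)"
    and closed: "\<And>f i. f \<in> \<P> \<Longrightarrow> \<exists>h\<in>\<P>. \<forall>x\<in>U. partial i f x = h x"
  shows "smooth_on U f"
proof -
  have "\<exists>h\<in>\<P>. \<forall>x\<in>U. foldr partial is f x = h x" for "is"
  proof (induction "is")
    case Nil
    then show ?case using f by auto
  next
    case (Cons i "is")
    then obtain h where h: "h \<in> \<P>" "\<And>x. x \<in> U \<Longrightarrow> foldr partial is f x = h x" by blast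
    then obtain h' where h': "h' \<in> \<P>" "\<And>x. x \<in> U \<Longrightarrow> partial i h x = h' x" using closed by blast
    have "foldr partial (i # is) f x = h' x" if "x \<in> U" for x
      using partial_cong[OF U that, of "foldr partial is f" h i] h(2) h'(2)[OF that] by simp
    then show ?case using h'(1) by blast
  qed
  then show ?thesis
    unfolding smooth_on_def using differentiable_cong_open[OF U] diff by metis
qed

lemma smooth_on_partial:
  assumes "smooth_on U f"
  shows "smooth_on U (partial i f)"
proof -
  have "foldr partial is (partial i f) = foldr partial (is @ [i]) f" for "is" by simp
  then show ?thesis using assms unfolding smooth_on_def by metis
qed

inductive_set smooth_algebra :: "(real^4) set \<Rightarrow> scalar set" for U where
  base: "smooth_on U f \<Longrightarrow> f \<in> smooth_algebra U"
| add: "f \<in> smooth_algebra U \<Longrightarrow> h \<in> smooth_algebra U \<Longrightarrow> (\<lambda>x. f x + h x) \<in> smooth_algebra U"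
| mult: "f \<in> smooth_algebra U \<Longrightarrow> h \<in> smooth_algebra U \<Longrightarrow> (\<lambda>x. f x * h x) \<in> smooth_algebra U"

lemma smooth_on_mult:
  assumes U: "open U" and "smooth_on U f" "smooth_on U h"
  shows "smooth_on U (\<lambda>x. f x * h x)"
proof (rule smooth_on_coinduct[OF U, where \<P> = "smooth_algebra U"])
  show "(\<lambda>x. f x * h x) \<in> smooth_algebra U"
    by (intro smooth_algebra.intros assms)
  have diff: "f differentiable (at x)" if "f \<in> smooth_algebra U" "x \<in> U" for f x
    using that
  proof induction
    case (base f)
    then have "foldr partial [] f differentiable (at x)" unfolding smooth_on_def by blast
    then show ?case by simp
  qed (auto intro: differentiable_add differentiable_mult)
  then show "f differentiable (at x)" if "f \<in> smooth_algebra U" "x \<in> U" for f x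
    using that by blast
  show "\<exists>h\<in>smooth_algebra U. \<forall>x\<in>U. partial i f x = h x" if "f \<in> smooth_algebra U" for f i
    using that
  proof induction
    case (base f)
    then show ?case using smooth_on_partial smooth_algebra.base by blast
  next
    case (add f h)
    then obtain f' h' where "f' \<in> smooth_algebra U" "\<forall>x\<in>U. partial i f x = f' x"
      "h' \<in> smooth_algebra U" "\<forall>x\<in>U. partial i h x = h' x" by blast
    moreover have "partial i (\<lambda>x. f x + h x) x = partial i f x + partial i h x" if "x \<in> U" for x
      by (intro has_partial_imp_partial has_partial_add differentiable_imp_has_partial diff add.hyps that)
    ultimately show ?case
      by (intro bexI[of _ "\<lambda>x. f' x + h' x"]) (auto intro: smooth_algebra.intros)
  next
    case (mult f h)
    then obtain f' h' where "f' \<in> smooth_algebra U" "\<forall>x\<in>U. partial i f x = f' x"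
      "h' \<in> smooth_algebra U" "\<forall>x\<in>U. partial i h x = h' x" by blast
    moreover have "partial i (\<lambda>x. f x * h x) x = partial i f x * h x + f x * partial i h x" if "x \<in> U" for x
      by (intro has_partial_imp_partial has_partial_mult differentiable_imp_has_partial diff mult.hyps that)
    ultimately show ?case
      using smooth_algebra.add[OF smooth_algebra.mult[of f' U h] smooth_algebra.mult[of f U h']] mult.hyps
      by (intro bexI[of _ "\<lambda>x. f' x * h x + f x * h' x"]) auto
  qed
qed

lemma smooth_on_cong:
  assumes U: "open U" and eq: "\<And>x. x \<in> U \<Longrightarrow> f x = h x" and h: "smooth_on U h"
  shows "smooth_on U f"
proof -
  have eqs: "\<forall>x\<in>U. foldr partial is f x = foldr partial is h x" for "is"
  proof (induction "is")
    case (Cons i "is")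
    then have "partial i (foldr partial is f) x = partial i (foldr partial is h) x" if "x \<in> U" for x
      by (intro partial_cong[OF U that]) blast
    then show ?case by simp
  qed (simp add: eq)
  show ?thesis
    unfolding smooth_on_def
  proof (intro allI ballI)
    fix "is" x assume x: "x \<in> U"
    have d: "foldr partial is h differentiable (at x)"
      using h x unfolding smooth_on_def by blast
    show "foldr partial is f differentiable (at x)"
      by (rule differentiable_cong_open[OF U x _ d]) (rule eqs[rule_format])
  qed
qed

lemma smooth_on_inverse_power:
  assumes U: "open U" and distinct: "\<And>x. x \<in> U \<Longrightarrow> x $ 1 \<noteq> x $ 2"
  shows "smooth_on U (\<lambda>x. c / (x $ 1 - x $ 2) ^ n)"
proof (rule smooth_on_coinduct[OF U, where \<P> = "{\<lambda>x. c / (x $ 1 - x $ 2) ^ n |c n. True}"])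
  show "(\<lambda>x. c / (x $ 1 - x $ 2) ^ n) \<in> {\<lambda>x. c / (x $ 1 - x $ 2) ^ n |c n. True}" by blast
next
  fix f :: scalar and x assume "f \<in> {\<lambda>x. c / (x $ 1 - x $ 2) ^ n |c n. True}" and x: "x \<in> U"
  then obtain c n where f: "f = (\<lambda>x. c / (x $ 1 - x $ 2) ^ n)" by blast
  have comp: "(\<lambda>x::real^4. x $ i) differentiable (at x)" for i
    by (intro bounded_linear_imp_differentiable bounded_linear_vec_nth)
  show "f differentiable (at x)"
    unfolding f using distinct[OF x]
    by (intro differentiable_divide differentiable_power differentiable_diff comp differentiable_const) simp
next
  fix f :: scalar and i assume "f \<in> {\<lambda>x. c / (x $ 1 - x $ 2) ^ n |c n. True}"
  then obtain c n where f: "f = (\<lambda>x. c / (x $ 1 - x $ 2) ^ n)" by blast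
  have "partial i f x = sel4 (- real n * c) (real n * c) 0 0 i / (x $ 1 - x $ 2) ^ (n + 1)" if x: "x \<in> U" for x
  proof -
    have nz: "x $ 1 - x $ 2 \<noteq> 0" using distinct[OF x] by simp
    have D: "((\<lambda>t. c / t ^ n) has_real_derivative (- real n * c / t ^ (n + 1))) (at t)" if "t \<noteq> 0" for t
    proof (cases n)
      case (Suc m)
      show ?thesis
        unfolding Suc by (rule DERIV_cong, (auto intro!: derivative_eq_intros simp: that)[1])
          (use that in \<open>cases m; simp add: field_simps\<close>)
    qed simp
    have "has_partial i (\<lambda>y. c / (y $ 1 - y $ 2) ^ n)
        (sel4 (- real n * c / (x $ 1 - x $ 2) ^ (n + 1)) (real n * c / (x $ 1 - x $ 2) ^ (n + 1)) 0 0 i) x"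
    proof (rule has_partial_two_variables[where \<phi> = "\<lambda>u v. c / (u - v) ^ n"])
      show "((\<lambda>u. c / (u - x $ 2) ^ n) has_real_derivative - real n * c / (x $ 1 - x $ 2) ^ (n + 1)) (at (x $ 1))"
      proof -
        have "((\<lambda>u. u - x $ 2) has_real_derivative 1) (at (x $ 1))"
          by (auto intro!: derivative_eq_intros)
        from DERIV_chain2[where f = "\<lambda>t. c / t ^ n" and g = "\<lambda>u. u - x $ 2", OF D[OF nz] this]
        show ?thesis by simp
      qed
      have "((\<lambda>v. x $ 1 - v) has_real_derivative - 1) (at (x $ 2))"
        by (auto intro!: derivative_eq_intros)
      from DERIV_chain2[where f = "\<lambda>t. c / t ^ n" and g = "\<lambda>v. x $ 1 - v", OF D[OF nz] this]
      show "((\<lambda>v. c / (x $ 1 - v) ^ n) has_real_derivative real n * c / (x $ 1 - x $ 2) ^ (n + 1)) (at (x $ 2))"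
        by simp
    qed
    from has_partial_imp_partial[OF this]
    have "partial i f x = sel4 (- real n * c / (x $ 1 - x $ 2) ^ (n + 1)) (real n * c / (x $ 1 - x $ 2) ^ (n + 1)) 0 0 i"
      unfolding f .
    also have "\<forall>i. sel4 (p / r) (q / r) 0 0 i = sel4 p q 0 0 i / r" for p q r :: real
      unfolding forall_4 by simp
    note this[rule_format]
    finally show ?thesis .
  qed
  then show "\<exists>h\<in>{\<lambda>x. c / (x $ 1 - x $ 2) ^ n |c n. True}. \<forall>x\<in>U. partial i f x = h x"
    by (intro bexI[of _ "\<lambda>x. sel4 (- real n * c) (real n * c) 0 0 i / (x $ 1 - x $ 2) ^ (n + 1)"]) blast+
qed

lemma constant_of_zero_derivative:
  fixes \<phi> :: "real \<Rightarrow> real"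
  assumes "convex S" "\<And>t. t \<in> S \<Longrightarrow> (\<phi> has_real_derivative 0) (at t)" "s \<in> S" "t \<in> S"
  shows "\<phi> s = \<phi> t"
proof -
  have "\<exists>c. \<forall>x\<in>S. \<phi> x = c"
  proof (rule has_derivative_zero_constant[OF assms(1)])
    fix t assume "t \<in> S"
    from assms(2)[OF this] have "(\<phi> has_derivative (\<lambda>h. 0)) (at t)"
      unfolding has_field_derivative_def by (simp add: lambda_zero)
    then show "(\<phi> has_derivative (\<lambda>h. 0)) (at t within S)" by (rule has_derivative_at_withinI)
  qed
  then show ?thesis using assms(3,4) by auto
qed

text \<open>Vanishing partial derivatives make the function constant on boxes and connectedness does the rest.\<close>

lemma planar_constant:
  fixes \<phi> :: "real \<Rightarrow> real \<Rightarrow> real"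
  assumes W: "open W" "connected W"
    and 1: "\<And>u v. (u, v) \<in> W \<Longrightarrow> ((\<lambda>t. \<phi> t v) has_real_derivative 0) (at u)"
    and 2: "\<And>u v. (u, v) \<in> W \<Longrightarrow> ((\<lambda>t. \<phi> u t) has_real_derivative 0) (at v)"
  obtains c where "\<And>u v. (u, v) \<in> W \<Longrightarrow> \<phi> u v = c"
proof -
  have "\<forall>p\<in>W. \<forall>\<^sub>F p' in at p within W. \<phi> (fst p) (snd p) = \<phi> (fst p') (snd p')"
  proof
    fix p assume "p \<in> W"
    then obtain A B where AB: "open A" "open B" "fst p \<in> A" "snd p \<in> B" "A \<times> B \<subseteq> W"
      using open_prod_elim[OF W(1)] by (metis mem_Times_iff)
    obtain e where e: "e > 0" "ball (fst p) e \<subseteq> A"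
      using AB(1,3) open_contains_ball by blast
    obtain e' where e': "e' > 0" "ball (snd p) e' \<subseteq> B"
      using AB(2,4) open_contains_ball by blast
    have sub: "(u, v) \<in> W" if "u \<in> ball (fst p) e" "v \<in> ball (snd p) e'" for u v
      using that e(2) e'(2) AB(5) by blast
    have "\<phi> (fst p) (snd p) = \<phi> u v" if "u \<in> ball (fst p) e" "v \<in> ball (snd p) e'" for u v
    proof -
      have "\<phi> (fst p) (snd p) = \<phi> u (snd p)"
        by (rule constant_of_zero_derivative[where S = "ball (fst p) e" and \<phi> = "\<lambda>t. \<phi> t (snd p)"])
          (use that e(1) e'(1) 1 sub in auto)
      also have "\<dots> = \<phi> u v"
        by (rule constant_of_zero_derivative[where S = "ball (snd p) e'"]) (use that e(1) e'(1) 2 sub in auto)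
      finally show ?thesis .
    qed
    moreover have "\<forall>\<^sub>F p' in at p within W. p' \<in> ball (fst p) e \<times> ball (snd p) e'"
      by (rule eventually_at_topological[THEN iffD2])
        (rule exI[of _ "ball (fst p) e \<times> ball (snd p) e'"], use e(1) e'(1) in \<open>auto intro!: open_Times simp: mem_Times_iff\<close>)
    ultimately show "\<forall>\<^sub>F p' in at p within W. \<phi> (fst p) (snd p) = \<phi> (fst p') (snd p')"
      by (auto elim!: eventually_mono)
  qed
  then have "\<phi> (fst p) (snd p) = \<phi> (fst p') (snd p')" if "p \<in> W" "p' \<in> W" for p p'
    using connected_local_const[OF W(2) that, of "\<lambda>p. \<phi> (fst p) (snd p)"] by blast
  then have "\<exists>c. \<forall>u v. (u, v) \<in> W \<longrightarrow> \<phi> u v = c"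
    by (metis fst_conv snd_conv)
  then show ?thesis using that by blast
qed

text \<open>\<open>S1\<close> and \<open>S2\<close> are the partial derivatives of the normalized scalar curvature \<open>(G'' - F'') / (6 (\<xi> - \<eta>))\<close>, and the two quotients in the hypotheses are the components of \<open>J grad s\<close> along \<open>\<partial>\<^sub>t\<close> and \<open>\<partial>\<^sub>z\<close>.\<close>

lemma affine_scalar_imp_quadratic:
  fixes F2 F3 G2 G3 :: "real \<Rightarrow> real" and W :: "(real \<times> real) set"
  assumes W: "open W" "connected W" "W \<noteq> {}" and distinct: "\<And>u v. (u, v) \<in> W \<Longrightarrow> u \<noteq> v"
    and F: "\<And>u v. (u, v) \<in> W \<Longrightarrow> (F2 has_real_derivative F3 u) (at u)"
    and G: "\<And>u v. (u, v) \<in> W \<Longrightarrow> (G2 has_real_derivative G3 v) (at v)"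
  defines "S1 \<equiv> \<lambda>u v. - F3 u / (6 * (u - v)) - (G2 v - F2 u) / (6 * (u - v)^2)"
    and "S2 \<equiv> \<lambda>u v. G3 v / (6 * (u - v)) + (G2 v - F2 u) / (6 * (u - v)^2)"
  assumes a1: "\<And>u v. (u, v) \<in> W \<Longrightarrow> ((\<lambda>t. (t * S1 t v - v * S2 t v) / (t - v)) has_real_derivative 0) (at u)"
    and a2: "\<And>u v. (u, v) \<in> W \<Longrightarrow> ((\<lambda>t. (u * S1 u t - t * S2 u t) / (u - t)) has_real_derivative 0) (at v)"
    and b1: "\<And>u v. (u, v) \<in> W \<Longrightarrow> ((\<lambda>t. (S2 t v - S1 t v) / (t - v)) has_real_derivative 0) (at u)"
    and b2: "\<And>u v. (u, v) \<in> W \<Longrightarrow> ((\<lambda>t. (S2 u t - S1 u t) / (u - t)) has_real_derivative 0) (at v)"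
  obtains k l A where "\<And>u v. (u, v) \<in> W \<Longrightarrow> F2 u = 12 * k * u^2 + 6 * l * u + 2 * A"
    "\<And>u v. (u, v) \<in> W \<Longrightarrow> G2 v = 12 * k * v^2 + 6 * l * v + 2 * A"
proof -
  obtain a where a: "\<And>u v. (u, v) \<in> W \<Longrightarrow> (u * S1 u v - v * S2 u v) / (u - v) = a"
    by (rule planar_constant[OF W(1,2) a1 a2]) auto
  obtain b where b: "\<And>u v. (u, v) \<in> W \<Longrightarrow> (S2 u v - S1 u v) / (u - v) = b"
    by (rule planar_constant[OF W(1,2) b1 b2]) auto
  have S: "S1 u v = a + v * b" "S2 u v = a + u * b" if "(u, v) \<in> W" for u v
  proof -
    have "u * S1 u v - v * S2 u v = a * (u - v)" "S2 u v - S1 u v = b * (u - v)"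
      using a[OF that] b[OF that] distinct[OF that] by (auto simp: field_simps)
    then have "(S1 u v - (a + v * b)) * (u - v) = 0" "(S2 u v - (a + u * b)) * (u - v) = 0"
      by algebra+
    then show "S1 u v = a + v * b" "S2 u v = a + u * b" using distinct[OF that] by auto
  qed
  \<comment> \<open>The scalar curvature minus the affine function of \<open>u + v\<close> and \<open>u v\<close> with the same gradient.\<close>
  define \<Phi> where "\<Phi> u v = (G2 v - F2 u) / (6 * (u - v)) - a * (u + v) - b * u * v" for u v
  have "((\<lambda>t. \<Phi> t v) has_real_derivative 0) (at u)" "((\<lambda>t. \<Phi> u t) has_real_derivative 0) (at v)"
    if uv: "(u, v) \<in> W" for u v
  proof -
    have nz: "u - v \<noteq> 0" using distinct[OF uv] by simp
    have D1: "((\<lambda>t. (G2 v - F2 t) / (6 * (t - v))) has_real_derivative S1 u v) (at u)"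
      unfolding S1_def
      by (rule DERIV_cong, (auto intro!: derivative_eq_intros F[OF uv] simp: distinct[OF uv])[1])
        (use nz in \<open>simp add: divide_simps\<close>, simp add: algebra_simps eval_nat_numeral)
    show "((\<lambda>t. \<Phi> t v) has_real_derivative 0) (at u)"
      unfolding \<Phi>_def
      by (rule DERIV_cong, (rule derivative_intros D1 refl)+) (simp add: S[OF uv])
    have D2: "((\<lambda>t. (G2 t - F2 u) / (6 * (u - t))) has_real_derivative S2 u v) (at v)"
      unfolding S2_def
      by (rule DERIV_cong, (auto intro!: derivative_eq_intros G[OF uv] simp: distinct[OF uv])[1])
        (use nz in \<open>simp add: divide_simps\<close>, simp add: algebra_simps eval_nat_numeral)
    show "((\<lambda>t. \<Phi> u t) has_real_derivative 0) (at v)"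
      unfolding \<Phi>_def
      by (rule DERIV_cong, (rule derivative_intros D2 refl)+) (simp add: S[OF uv])
  qed
  then obtain c where c: "\<And>u v. (u, v) \<in> W \<Longrightarrow> \<Phi> u v = c"
    by (rule planar_constant[OF W(1,2)]) auto
  have diff: "G2 v - F2 u = 6 * (u - v) * (a * (u + v) + b * u * v + c)" if "(u, v) \<in> W" for u v
    using c[OF that] distinct[OF that] unfolding \<Phi>_def by (auto simp: field_simps)
  have F3: "F3 u = - 6 * (2 * a * u + b * (2 * u * v - v^2) + c)" if uv: "(u, v) \<in> W" for u v
  proof -
    have nz: "u - v \<noteq> 0" using distinct[OF uv] by simp
    have "(- p / (6 * \<delta>) - r / (6 * \<delta>^2)) * (6 * \<delta>) = - p - r / \<delta>" if "\<delta> \<noteq> 0" for p r \<delta> :: real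
      using that by (simp add: field_simps eval_nat_numeral)
    from this[OF nz] have "S1 u v * (6 * (u - v)) = - F3 u - (G2 v - F2 u) / (u - v)"
      unfolding S1_def .
    also have "(G2 v - F2 u) / (u - v) = 6 * (a * (u + v) + b * u * v + c)"
    proof -
      have "6 * \<delta> * r / \<delta> = 6 * r" if "\<delta> \<noteq> 0" for \<delta> r :: real
        using that by simp
      from this[OF nz] show ?thesis unfolding diff[OF uv] .
    qed
    finally show ?thesis unfolding S[OF uv] by algebra
  qed
  obtain u0 v0 where uv0: "(u0, v0) \<in> W" using W(3) by auto
  \<comment> \<open>The third derivative of \<open>F\<close> does not depend on \<open>v\<close>; differentiating in \<open>v\<close> leaves only the \<open>b\<close>-term.\<close>
  have b0: "b = 0"
  proof -
    have ev: "\<forall>\<^sub>F t in nhds v0. (u0, t) \<in> W"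
    proof -
      obtain A B where "open A" "open B" "u0 \<in> A" "v0 \<in> B" "A \<times> B \<subseteq> W"
        using open_prod_elim[OF W(1) uv0] by (metis mem_Sigma_iff)
      then show ?thesis unfolding eventually_nhds by blast
    qed
    have "((\<lambda>t. - 6 * (2 * a * u0 + b * (2 * u0 * t - t^2) + c)) has_real_derivative - 6 * (b * (2 * u0 - 2 * v0))) (at v0)"
      by (auto intro!: derivative_eq_intros)
    moreover have "((\<lambda>t. - 6 * (2 * a * u0 + b * (2 * u0 * t - t^2) + c)) has_real_derivative 0) (at v0)"
      using DERIV_cong_ev[OF refl _ refl, of "\<lambda>t. F3 u0" "\<lambda>t. - 6 * (2 * a * u0 + b * (2 * u0 * t - t^2) + c)" v0 0]
        eventually_mono[OF ev F3] by auto
    ultimately have "- 6 * (b * (2 * u0 - 2 * v0)) = 0" by (rule DERIV_unique)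
    then show ?thesis using distinct[OF uv0] by auto
  qed
  have E: "F2 u + 6 * (a * u^2 + c * u) = G2 v + 6 * (a * v^2 + c * v)" if "(u, v) \<in> W" for u v
    using diff[OF that] unfolding b0 by algebra
  define \<Psi> where "\<Psi> u v = F2 u + 6 * (a * u^2 + c * u)" for u v :: real
  have "((\<lambda>t. \<Psi> t v) has_real_derivative 0) (at u)" "((\<lambda>t. \<Psi> u t) has_real_derivative 0) (at v)"
    if uv: "(u, v) \<in> W" for u v
    unfolding \<Psi>_def
    by (auto intro!: derivative_eq_intros F[OF uv] simp: F3[OF uv] b0)
  then obtain e where e: "\<And>u v. (u, v) \<in> W \<Longrightarrow> \<Psi> u v = e"
    by (rule planar_constant[OF W(1,2)]) auto
  show ?thesis
  proof (rule that[of "- a / 2" "- c" "e / 2"])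
    fix u v assume uv: "(u, v) \<in> W"
    show "F2 u = 12 * (- a / 2) * u^2 + 6 * (- c) * u + 2 * (e / 2)"
      using e[OF uv] unfolding \<Psi>_def by (simp add: algebra_simps)
    show "G2 v = 12 * (- a / 2) * v^2 + 6 * (- c) * v + 2 * (e / 2)"
      using e[OF uv] E[OF uv] unfolding \<Psi>_def by (simp add: algebra_simps)
  qed
qed

lemma quartic_of_second_derivative:
  fixes F F1 F2 :: "real \<Rightarrow> real"
  assumes S: "convex S" "S \<noteq> {}"
    and F: "\<And>x. x \<in> S \<Longrightarrow> (F has_real_derivative F1 x) (at x)"
    and F1: "\<And>x. x \<in> S \<Longrightarrow> (F1 has_real_derivative F2 x) (at x)"
    and F2: "\<And>x. x \<in> S \<Longrightarrow> F2 x = 12 * k * x^2 + 6 * l * x + 2 * A"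
  obtains B C where "\<And>x. x \<in> S \<Longrightarrow> F x = k * x^4 + l * x^3 + A * x^2 + B * x + C"
proof -
  obtain x0 where x0: "x0 \<in> S" using S(2) by blast
  define h where "h x = F1 x - (4 * k * x^3 + 3 * l * x^2 + 2 * A * x)" for x
  have "(h has_real_derivative 0) (at x)" if "x \<in> S" for x
    unfolding h_def by (rule DERIV_cong, (rule derivative_intros F1[OF that] refl)+) (simp add: F2[OF that])
  then have h: "h x = h x0" if "x \<in> S" for x
    using constant_of_zero_derivative[OF S(1) _ that x0, of h] by blast
  define r where "r x = F x - (k * x^4 + l * x^3 + A * x^2 + h x0 * x)" for x
  have "(r has_real_derivative 0) (at x)" if "x \<in> S" for x
    unfolding r_def
    by (rule DERIV_cong, (rule derivative_intros F[OF that] refl)+) (simp add: h[OF that, symmetric], simp add: h_def)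
  then have r: "r x = r x0" if "x \<in> S" for x
    using constant_of_zero_derivative[OF S(1) _ that x0, of r] by blast
  show ?thesis
    by (rule that[of "h x0" "r x0"]) (simp add: r[symmetric], simp add: r_def)
qed

section \<open>Ortho-toric Kaehler surfaces\<close>

lemma scalar_derivative_1:
  assumes "(F2 has_real_derivative f3) (at u)" "u \<noteq> v"
  shows "((\<lambda>t. (r - F2 t) / (6 * (t - v))) has_real_derivative - f3 / (6 * (u - v)) - (r - F2 u) / (6 * (u - v)^2)) (at u)"
proof -
  have nz: "u - v \<noteq> 0" using assms(2) by simp
  show ?thesis
    by (rule DERIV_cong, (auto intro!: derivative_eq_intros assms(1) simp: assms(2))[1])
      (use nz in \<open>simp add: divide_simps\<close>, simp add: algebra_simps eval_nat_numeral)
qed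

lemma scalar_derivative_2:
  assumes "(G2 has_real_derivative g3) (at v)" "u \<noteq> v"
  shows "((\<lambda>t. (G2 t - r) / (6 * (u - t))) has_real_derivative g3 / (6 * (u - v)) + (G2 v - r) / (6 * (u - v)^2)) (at v)"
proof -
  have nz: "u - v \<noteq> 0" using assms(2) by simp
  show ?thesis
    by (rule DERIV_cong, (auto intro!: derivative_eq_intros assms(1) simp: assms(2))[1])
      (use nz in \<open>simp add: divide_simps\<close>, simp add: algebra_simps eval_nat_numeral)
qed

lemma smooth_real_derivative:
  assumes "smooth_real_on S F" "x \<in> S"
  shows "((deriv ^^ n) F has_real_derivative (deriv ^^ Suc n) F x) (at x)"
  using assms unfolding smooth_real_on_def by (simp add: DERIV_deriv_iff_real_differentiable)

lemma deriv_eq_on_open: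
  assumes "open S" "x \<in> S" "\<And>t. t \<in> S \<Longrightarrow> F t = (p :: real \<Rightarrow> real) t" "(p has_real_derivative D) (at x)"
  shows "deriv F x = D"
  by (rule DERIV_imp_deriv, rule has_field_derivative_transform_within_open[OF assms(4,1,2)]) (simp add: assms(3))

lemma continuous_map_of_charts:
  assumes atlas: "smooth_atlas X \<A>" and T: "\<And>V. open V \<Longrightarrow> open (T -` V)"
    and f: "\<And>c p. c \<in> \<A> \<Longrightarrow> p \<in> cdom c \<Longrightarrow> f p = T (cmap c p)"
  shows "continuous_map X euclidean f"
  unfolding continuous_map_def
proof (intro conjI allI impI)
  fix V :: "'b set" assume "openin euclidean V"
  then have V: "open (T -` V)" using T by simp
  have "openin X {p \<in> cdom c. cmap c p \<in> T -` V}" if c: "c \<in> \<A>" for c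
  proof -
    have dom: "openin X (cdom c)" and hom: "homeomorphic_map (subtopology X (cdom c)) (top_of_set (cimg c)) (cmap c)"
      using atlas c unfolding smooth_atlas_def by auto
    have top: "topspace (subtopology X (cdom c)) = cdom c"
      using openin_subset[OF dom] by auto
    have "openin (subtopology X (cdom c)) {p \<in> topspace (subtopology X (cdom c)). cmap c p \<in> cimg c \<inter> T -` V}"
      by (rule openin_continuous_map_preimage[OF homeomorphic_imp_continuous_map[OF hom]]) (simp add: openin_open_Int V)
    moreover have "{p \<in> topspace (subtopology X (cdom c)). cmap c p \<in> cimg c \<inter> T -` V} = {p \<in> cdom c. cmap c p \<in> T -` V}"
      unfolding top by auto
    ultimately show ?thesis using openin_trans_full dom by metis
  qed
  then have "openin X (\<Union>c\<in>\<A>. {p \<in> cdom c. cmap c p \<in> T -` V})" by blast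
  moreover have "(\<Union>c\<in>\<A>. {p \<in> cdom c. cmap c p \<in> T -` V}) = {p \<in> topspace X. f p \<in> V}"
  proof -
    have U: "(\<Union>c\<in>\<A>. cdom c) = topspace X"
      using atlas unfolding smooth_atlas_def by blast
    have "{p \<in> cdom c. cmap c p \<in> T -` V} = {p \<in> cdom c. f p \<in> V}" if "c \<in> \<A>" for c
      using f[OF that] by auto
    then have "(\<Union>c\<in>\<A>. {p \<in> cdom c. cmap c p \<in> T -` V}) = (\<Union>c\<in>\<A>. {p \<in> cdom c. f p \<in> V})"
      by simp
    also have "\<dots> = {p \<in> topspace X. f p \<in> V}" using U by blast
    finally show ?thesis .
  qed
  ultimately show "openin X {p \<in> topspace X. f p \<in> V}" by simp
qed simp

lemma open_image_two_coordinates: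
  assumes "open U"
  shows "open ((\<lambda>x::real^4. (x $ 1, x $ 2)) ` U)"
proof (rule open_surjective_linear_image[OF assms])
  show "linear (\<lambda>x::real^4. (x $ 1, x $ 2))"
    by (rule linearI) auto
  have "p \<in> range (\<lambda>x::real^4. (x $ 1, x $ 2))" for p
    by (rule range_eqI[of _ _ "vector [fst p, snd p, 0, 0]"]) simp
  then show "surj (\<lambda>x::real^4. (x $ 1, x $ 2))" by blast
qed

lemma ot_metric_two_variables: "ot_metric F G y $ i $ j = ot_metric F G (vector [y $ 1, y $ 2, 0, 0]) $ i $ j"
  unfolding ot_metric_def by simp

locale ortho_toric_surface =
  fixes X :: "'a topology" and \<A> :: "'a chart set" and \<sigma> :: "'a chart \<Rightarrow> scalar"
    and g J I :: "'a chart \<Rightarrow> matfield" and \<xi> \<eta> :: "'a \<Rightarrow> real" and F G :: "real \<Rightarrow> real"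
  assumes manifold: "smooth_manifold X \<A>" "connected_space X" "topspace X \<noteq> {}"
    and kaehler: "kaehler_surface \<A> \<sigma> g J"
    and smooth: "smooth_real_on (\<xi> ` topspace X) F" "smooth_real_on (\<eta> ` topspace X) G"
    and ansatz: "ortho_toric_form \<A> g J \<xi> \<eta> F G"
    and opposite: "opposite_structure \<A> \<sigma> g J \<xi> \<eta> I"
begin

definition gbar where "gbar = conformal_metric (\<lambda>p. 1 / (\<xi> p - \<eta> p)\<^sup>2) g"

lemma atlas: "smooth_atlas X \<A>"
  using manifold(1) unfolding smooth_manifold_def by blast

lemma open_cimg: "c \<in> \<A> \<Longrightarrow> open (cimg c)"
  using atlas unfolding smooth_atlas_def by blast

lemma cinv_cmap:
  assumes c: "c \<in> \<A>" and p: "p \<in> cdom c"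
  shows "cinv c (cmap c p) = p"
proof -
  have dom: "openin X (cdom c)" and hom: "homeomorphic_map (subtopology X (cdom c)) (top_of_set (cimg c)) (cmap c)"
    using atlas c unfolding smooth_atlas_def by auto
  have "inj_on (cmap c) (topspace (subtopology X (cdom c)))"
    using homeomorphic_imp_injective_map[OF hom] .
  moreover have "topspace (subtopology X (cdom c)) = cdom c"
    using openin_subset[OF dom] by auto
  ultimately show ?thesis
    unfolding cinv_def using p by (simp add: the_inv_into_f_f)
qed

lemma chart_of_point: "p \<in> topspace X \<Longrightarrow> \<exists>c\<in>\<A>. p \<in> cdom c"
  using atlas unfolding smooth_atlas_def by blast

lemma coordinates:
  assumes c: "c \<in> \<A>" and p: "p \<in> cdom c"
  shows "cmap c p $ 1 = \<xi> p" "cmap c p $ 2 = \<eta> p" "p \<in> topspace X"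
  using ansatz c p atlas unfolding ortho_toric_form_def smooth_atlas_def by blast+

lemma in_chart_eq:
  assumes c: "c \<in> \<A>" and x: "x \<in> cimg c"
  shows "in_chart \<xi> c x = x $ 1" "in_chart \<eta> c x = x $ 2"
    "x $ 1 \<in> \<xi> ` topspace X" "x $ 2 \<in> \<eta> ` topspace X"
    "in_chart (\<lambda>p. 1 / (\<xi> p - \<eta> p)\<^sup>2) c x = 1 / (x $ 1 - x $ 2)\<^sup>2"
proof -
  obtain p where p: "p \<in> cdom c" "x = cmap c p" using x by blast
  show "in_chart \<xi> c x = x $ 1" "in_chart \<eta> c x = x $ 2"
    "in_chart (\<lambda>p. 1 / (\<xi> p - \<eta> p)\<^sup>2) c x = 1 / (x $ 1 - x $ 2)\<^sup>2"
    unfolding in_chart_def p(2) cinv_cmap[OF c p(1)] coordinates[OF c p(1)] by simp_all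
  show "x $ 1 \<in> \<xi> ` topspace X" "x $ 2 \<in> \<eta> ` topspace X"
    unfolding p(2) coordinates(1,2)[OF c p(1)] using coordinates(3)[OF c p(1)] by auto
qed

lemma chart_geometry:
  assumes c: "c \<in> \<A>"
  shows "ot_conformal (cimg c) F (deriv F) (deriv (deriv F)) G (deriv G) (deriv (deriv G)) (g c) (J c) (I c) (\<sigma> c) (gbar c)"
proof -
  have g: "g c x = ot_metric F G x" and form: "fundamental_form (g c) (J c) x = ot_form x" if "x \<in> cimg c" for x
    using ansatz c that unfolding ortho_toric_form_def by auto
  have pos: "v \<bullet> (g c x *v v) > 0" if "x \<in> cimg c" "v \<noteq> 0" for x v
    using kaehler c that unfolding kaehler_surface_def riemannian_metric_def by blast
  have ax: "axis i 1 \<bullet> (A *v axis i 1) = A $ i $ i" for A :: "real^4^4" and i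
    unfolding inner_axis' by (simp add: matrix_vector_mult_def axis_def if_distrib[where f = "\<lambda>z. _ * z"] cong: if_cong)
  have diag: "ot_metric F G x $ i $ i > 0" if "x \<in> cimg c" for x i
    using pos[OF that, of "axis i 1"] unfolding ax g[OF that] by simp
  have 1: "(x $ 1 - x $ 2) * (1 / F (x $ 1)) > 0" if "x \<in> cimg c" for x
    using diag[OF that, of 1] by (simp add: ot_metric_def Let_def tensor_sq_def axis_def)
  have 2: "(x $ 1 - x $ 2) * (- (1 / G (x $ 2))) > 0" if "x \<in> cimg c" for x
    using diag[OF that, of 2] by (simp add: ot_metric_def Let_def tensor_sq_def axis_def)
  show ?thesis
  proof
    show "open (cimg c)" by (rule open_cimg[OF c])
    fix x assume x: "x \<in> cimg c"
    show "x $ 1 \<noteq> x $ 2" "F (x $ 1) \<noteq> 0" "G (x $ 2) \<noteq> 0"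
      using 1[OF x] 2[OF x] by auto
    show "(F has_real_derivative deriv F (x $ 1)) (at (x $ 1))"
      "(deriv F has_real_derivative deriv (deriv F) (x $ 1)) (at (x $ 1))"
      using smooth_real_derivative[OF smooth(1) in_chart_eq(3)[OF c x], of 0]
        smooth_real_derivative[OF smooth(1) in_chart_eq(3)[OF c x], of 1] by simp_all
    show "(G has_real_derivative deriv G (x $ 2)) (at (x $ 2))"
      "(deriv G has_real_derivative deriv (deriv G) (x $ 2)) (at (x $ 2))"
      using smooth_real_derivative[OF smooth(2) in_chart_eq(4)[OF c x], of 0]
        smooth_real_derivative[OF smooth(2) in_chart_eq(4)[OF c x], of 1] by simp_all
    show "g c x = ot_metric F G x" by (rule g[OF x])
    show "fundamental_form (g c) (J c) x = ot_form x" by (rule form[OF x])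
    show "I c x ** I c x = - mat 1"
      using opposite c x unfolding opposite_structure_def almost_complex_structure_def by blast
    have \<alpha>: "differential (in_chart \<xi> c) x = axis 1 1" and \<beta>: "differential (in_chart \<eta> c) x = axis 2 1"
    proof -
      have "\<forall>j. partial j (in_chart \<xi> c) x = axis 1 1 $ j"
        unfolding forall_4
        using partial_two_variables(1,2)[OF open_cimg[OF c] x, of "in_chart \<xi> c" "\<lambda>u v. u"]
          partial_two_variables(3)[OF open_cimg[OF c] x, of "in_chart \<xi> c" "\<lambda>u v. u" 1]
          partial_two_variables(4)[OF open_cimg[OF c] x, of "in_chart \<xi> c" "\<lambda>u v. u" 0] in_chart_eq(1)[OF c]
        by (simp add: axis_def)
      then show "differential (in_chart \<xi> c) x = axis 1 1"
        unfolding differential_def vec_eq_iff by simp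
      have "\<forall>j. partial j (in_chart \<eta> c) x = axis 2 1 $ j"
        unfolding forall_4
        using partial_two_variables(1,2)[OF open_cimg[OF c] x, of "in_chart \<eta> c" "\<lambda>u v. v"]
          partial_two_variables(3)[OF open_cimg[OF c] x, of "in_chart \<eta> c" "\<lambda>u v. v" 0]
          partial_two_variables(4)[OF open_cimg[OF c] x, of "in_chart \<eta> c" "\<lambda>u v. v" 1] in_chart_eq(2)[OF c]
        by (simp add: axis_def)
      then show "differential (in_chart \<eta> c) x = axis 2 1"
        unfolding differential_def vec_eq_iff by simp
    qed
    have act: "act_form A (axis i 1) = - A $ i" for A :: "real^4^4" and i
      unfolding act_form_def vector_matrix_mult_def vec_eq_iff
      by (simp add: axis_def if_distrib[where f = "\<lambda>z. _ * z"] if_distrib[where f = "\<lambda>z. z * _"] cong: if_cong)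
    have "act_form (I c x) (axis 1 1) = act_form (J c x) (axis 1 1)" "act_form (I c x) (axis 2 1) = - act_form (J c x) (axis 2 1)"
      using opposite c x unfolding opposite_structure_def Let_def \<alpha>[symmetric] \<beta>[symmetric] by blast+
    then have rows: "- I c x $ 1 = - J c x $ 1" "- I c x $ 2 = - (- J c x $ 2)"
      unfolding act by blast+
    show "I c x $ 1 = J c x $ 1" by (rule neg_equal_iff_equal[THEN iffD1, OF rows(1)])
    show "I c x $ 2 = - J c x $ 2" by (rule neg_equal_iff_equal[THEN iffD1, OF rows(2)])
    show "v \<bullet> (g c x *v v) > 0" if "v \<noteq> 0" for v by (rule pos[OF x that])
    show "sgn (rows4 u (J c x *v u) v (J c x *v v)) = \<sigma> c x" if "rows4 u (J c x *v u) v (J c x *v v) \<noteq> 0" for u v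
      using kaehler c x that unfolding kaehler_surface_def induces_orientation_def Let_def rows4_def by blast
    show "gbar c x = (1 / (x $ 1 - x $ 2)\<^sup>2) *\<^sub>R g c x"
      unfolding gbar_def conformal_metric_def in_chart_eq(5)[OF c x] ..
  qed
qed

text \<open>The momentum image in the plane; an open connected set on which all invariant functions live.\<close>

definition W where "W = (\<lambda>p. (\<xi> p, \<eta> p)) ` topspace X"

lemma W_chart:
  assumes "(u, v) \<in> W"
  obtains c x where "c \<in> \<A>" "x \<in> cimg c" "u = x $ 1" "v = x $ 2"
proof -
  obtain p where p: "p \<in> topspace X" "u = \<xi> p" "v = \<eta> p" using assms unfolding W_def by auto
  obtain c where c: "c \<in> \<A>" "p \<in> cdom c" using chart_of_point[OF p(1)] by blast
  show ?thesis
    by (rule that[OF c(1), of "cmap c p"]) (use c p coordinates[OF c] in auto)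
qed

lemma open_W: "open W"
proof -
  have "W = (\<Union>c\<in>\<A>. (\<lambda>x::real^4. (x $ 1, x $ 2)) ` cimg c)"
  proof (intro equalityI subsetI)
    fix p assume p: "p \<in> W"
    obtain u v where uv: "p = (u, v)" by (cases p)
    obtain c x where "c \<in> \<A>" "x \<in> cimg c" "u = x $ 1" "v = x $ 2"
      by (rule W_chart[OF p[unfolded uv]])
    then show "p \<in> (\<Union>c\<in>\<A>. (\<lambda>x::real^4. (x $ 1, x $ 2)) ` cimg c)"
      unfolding uv by blast
  next
    fix p assume "p \<in> (\<Union>c\<in>\<A>. (\<lambda>x::real^4. (x $ 1, x $ 2)) ` cimg c)"
    then obtain c a where "c \<in> \<A>" "a \<in> cdom c" "p = (cmap c a $ 1, cmap c a $ 2)" by blast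
    then show "p \<in> W" unfolding W_def using coordinates[of c a] by auto
  qed
  then show ?thesis using open_cimg open_image_two_coordinates by auto
qed

lemma connected_W: "connected W"
proof -
  have "continuous_map X euclidean (\<lambda>p. (\<xi> p, \<eta> p))"
  proof (rule continuous_map_of_charts[OF atlas, where T = "\<lambda>x. (x $ 1, x $ 2)"])
    fix V :: "(real \<times> real) set" assume "open V"
    then show "open ((\<lambda>x::real^4. (x $ 1, x $ 2)) -` V)"
      by (rule open_vimage) (auto intro!: continuous_intros)
  qed (use coordinates in auto)
  then show ?thesis
    unfolding W_def using connectedin_continuous_map_image[of X euclidean _ "topspace X"] manifold(2)
    by (simp add: connectedin_topspace)
qed

lemma W_nonempty: "W \<noteq> {}"
  using manifold(3) unfolding W_def by blast

lemma W_images: "fst ` W = \<xi> ` topspace X" "snd ` W = \<eta> ` topspace X"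
  unfolding W_def by (force, force)

lemma open_images: "open (\<xi> ` topspace X)" "open (\<eta> ` topspace X)"
  unfolding W_images[symmetric] by (simp_all add: open_image_fst open_image_snd open_W)

lemma convex_images: "convex (\<xi> ` topspace X)" "convex (\<eta> ` topspace X)"
proof -
  have "connected (fst ` W)" "connected (snd ` W)"
    by (intro connected_continuous_image connected_W continuous_intros)+
  then show "convex (\<xi> ` topspace X)" "convex (\<eta> ` topspace X)"
    unfolding W_images by (simp_all flip: is_interval_connected_1 add: is_interval_convex_1)
qed

lemma extremal_imp_affine:
  assumes ext: "extremal \<A> g J" and uv: "(u, v) \<in> W"
  defines "S1 \<equiv> \<lambda>u v. - deriv (deriv (deriv F)) u / (6 * (u - v)) - (deriv (deriv G) v - deriv (deriv F) u) / (6 * (u - v)^2)"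
    and "S2 \<equiv> \<lambda>u v. deriv (deriv (deriv G)) v / (6 * (u - v)) + (deriv (deriv G) v - deriv (deriv F) u) / (6 * (u - v)^2)"
  defines "a \<equiv> \<lambda>u v. (u * S1 u v - v * S2 u v) / (u - v)" and "b \<equiv> \<lambda>u v. (S2 u v - S1 u v) / (u - v)"
  shows "((\<lambda>t. a t v) has_real_derivative 0) (at u)" "((\<lambda>t. a u t) has_real_derivative 0) (at v)"
    "((\<lambda>t. b t v) has_real_derivative 0) (at u)" "((\<lambda>t. b u t) has_real_derivative 0) (at v)"
proof -
  obtain c x where c: "c \<in> \<A>" and x: "x \<in> cimg c" and u: "u = x $ 1" and v: "v = x $ 2"
    using W_chart[OF uv] by blast
  define U where "U = cimg c"
  have xU: "x \<in> U" using x by (simp add: U_def)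
  interpret ot_conformal U F "deriv F" "deriv (deriv F)" G "deriv G" "deriv (deriv G)" "g c" "J c" "I c" "\<sigma> c" "gbar c"
    unfolding U_def by (rule chart_geometry[OF c])
  have DF: "(deriv (deriv F) has_real_derivative deriv (deriv (deriv F)) (y $ 1)) (at (y $ 1))"
    "(deriv (deriv (deriv F)) has_real_derivative deriv (deriv (deriv (deriv F))) (y $ 1)) (at (y $ 1))" if "y \<in> U" for y
    using smooth_real_derivative[OF smooth(1) in_chart_eq(3)[OF c that[unfolded U_def]], of 2]
      smooth_real_derivative[OF smooth(1) in_chart_eq(3)[OF c that[unfolded U_def]], of 3]
    by (simp_all add: eval_nat_numeral)
  have DG: "(deriv (deriv G) has_real_derivative deriv (deriv (deriv G)) (y $ 2)) (at (y $ 2))"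
    "(deriv (deriv (deriv G)) has_real_derivative deriv (deriv (deriv (deriv G))) (y $ 2)) (at (y $ 2))" if "y \<in> U" for y
    using smooth_real_derivative[OF smooth(2) in_chart_eq(4)[OF c that[unfolded U_def]], of 2]
      smooth_real_derivative[OF smooth(2) in_chart_eq(4)[OF c that[unfolded U_def]], of 3]
    by (simp_all add: eval_nat_numeral)
  define S where "S u v = (deriv (deriv G) v - deriv (deriv F) u) / (6 * (u - v))" for u v
  have nscal: "nscal (g c) y = S (y $ 1) (y $ 2)" if "y \<in> U" for y
    unfolding nscal_def Scal_eq[OF that] S_def by simp
  define K where "K = ham_field (g c) (J c) (nscal (g c))"
  have Kk: "K y $ k = sel4 (\<lambda>_ _. 0) (\<lambda>_ _. 0) a b k (y $ 1) (y $ 2)" if y: "y \<in> U" for y k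
  proof -
    note pt = partial_two_variables[OF open_U y, of "nscal (g c)" S, OF nscal]
    have "partial 1 (nscal (g c)) y = S1 (y $ 1) (y $ 2)" "partial 2 (nscal (g c)) y = S2 (y $ 1) (y $ 2)"
      unfolding S1_def S2_def
      by (rule pt(3), assumption, unfold S_def, rule scalar_derivative_1[OF DF(1)[OF y] distinct[OF y]])
        (rule pt(4), assumption, unfold S_def, rule scalar_derivative_2[OF DG(1)[OF y] distinct[OF y]])
    then show ?thesis
      using ham_field_J[OF y pt(1,2)] exhaust_4[of k] unfolding K_def a_def b_def by auto
  qed
  have lie: "lie_metric K (g c) i j x = 0" for i j
    using ext c x unfolding extremal_def killing_def K_def by blast
  have const: "partial m (\<lambda>y. K y $ k) x = 0" if m: "m = 1 \<or> m = 2" for m k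
  proof (rule killing_imp_constant[OF open_U xU, where g = "g c" and K = K and m = m and k = k
        and \<psi> = "\<lambda>i j u v. ot_metric F G (vector [u, v, 0, 0]) $ i $ j" and \<kappa> = "sel4 (\<lambda>_ _. 0) (\<lambda>_ _. 0) a b"])
    show "g c y $ i $ j = ot_metric F G (vector [y $ 1, y $ 2, 0, 0]) $ i $ j" if "y \<in> U" for y i j
      unfolding g_eq[OF that] by (rule ot_metric_two_variables)
    show "g c y $ i $ j = 0 \<and> g c y $ j $ i = 0" if "y \<in> U" "i \<in> {1, 2}" "j \<in> {3, 4}" for y i j
      using that(2,3) unfolding K.g[OF that(1)] sum_4 ot_Q_def by auto
    show "matrix_inv (g c x) ** g c x = mat 1" by (rule K.matrix_inv_g(2)[OF xU])
    show "g c x $ i $ j = g c x $ j $ i" for i j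
      unfolding K.g[OF xU] by (simp add: mult_ac)
    show "K y $ k = sel4 (\<lambda>_ _. 0) (\<lambda>_ _. 0) a b k (y $ 1) (y $ 2)" if "y \<in> U" for y k
      by (rule Kk[OF that])
    show "K y $ 1 = 0 \<and> K y $ 2 = 0" if "y \<in> U" for y
      using Kk[OF that] by simp
  qed (use lie m in auto)
  have nz: "x $ 1 \<noteq> x $ 2" by (rule distinct[OF xU])
  have df: "deriv (deriv F) differentiable (at (x $ 1))" "deriv (deriv (deriv F)) differentiable (at (x $ 1))"
    and dg: "deriv (deriv G) differentiable (at (x $ 2))" "deriv (deriv (deriv G)) differentiable (at (x $ 2))"
    unfolding real_differentiable_def using DF[OF xU] DG[OF xU] by blast+
  have "(\<lambda>t. a t (x $ 2)) differentiable (at (x $ 1))" "(\<lambda>t. b t (x $ 2)) differentiable (at (x $ 1))"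
    unfolding a_def b_def S1_def S2_def using nz by (simp_all add: df)
  then obtain A1 B1 where A1: "((\<lambda>t. a t (x $ 2)) has_real_derivative A1) (at (x $ 1))"
      "((\<lambda>t. b t (x $ 2)) has_real_derivative B1) (at (x $ 1))"
    unfolding real_differentiable_def by blast
  have "(\<lambda>t. a (x $ 1) t) differentiable (at (x $ 2))" "(\<lambda>t. b (x $ 1) t) differentiable (at (x $ 2))"
    unfolding a_def b_def S1_def S2_def using nz by (simp_all add: dg)
  then obtain A2 B2 where A2: "((\<lambda>t. a (x $ 1) t) has_real_derivative A2) (at (x $ 2))"
      "((\<lambda>t. b (x $ 1) t) has_real_derivative B2) (at (x $ 2))"
    unfolding real_differentiable_def by blast
  have K3: "K y $ 3 = a (y $ 1) (y $ 2)" and K4: "K y $ 4 = b (y $ 1) (y $ 2)" if "y \<in> U" for y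
    using Kk[OF that] by simp_all
  have "A1 = 0" "A2 = 0"
    using partial_two_variables(3)[OF open_U xU, of "\<lambda>y. K y $ 3" a, OF K3 A1(1)] const[of 1 3]
      partial_two_variables(4)[OF open_U xU, of "\<lambda>y. K y $ 3" a, OF K3 A2(1)] const[of 2 3] by simp_all
  moreover have "B1 = 0" "B2 = 0"
    using partial_two_variables(3)[OF open_U xU, of "\<lambda>y. K y $ 4" b, OF K4 A1(2)] const[of 1 4]
      partial_two_variables(4)[OF open_U xU, of "\<lambda>y. K y $ 4" b, OF K4 A2(2)] const[of 2 4] by simp_all
  ultimately show "((\<lambda>t. a t v) has_real_derivative 0) (at u)" "((\<lambda>t. a u t) has_real_derivative 0) (at v)"
    "((\<lambda>t. b t v) has_real_derivative 0) (at u)" "((\<lambda>t. b u t) has_real_derivative 0) (at v)"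
    using A1 A2 unfolding u v by simp_all
qed

lemma extremal_imp_quartic:
  assumes ext: "extremal \<A> g J"
  shows "\<exists>k l A B1 B2 C1 C2. quartic_form (\<xi> ` topspace X) (\<eta> ` topspace X) F G k l A B1 B2 C1 C2"
proof -
  have D: "(deriv (deriv F) has_real_derivative deriv (deriv (deriv F)) u) (at u)"
    "(deriv (deriv G) has_real_derivative deriv (deriv (deriv G)) v) (at v)" "u \<noteq> v" if uv: "(u, v) \<in> W" for u v
  proof -
    obtain c x where c: "c \<in> \<A>" "x \<in> cimg c" "u = x $ 1" "v = x $ 2" using W_chart[OF uv] by blast
    interpret ot_conformal "cimg c" F "deriv F" "deriv (deriv F)" G "deriv G" "deriv (deriv G)" "g c" "J c" "I c" "\<sigma> c" "gbar c"
      by (rule chart_geometry[OF c(1)])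
    show "(deriv (deriv F) has_real_derivative deriv (deriv (deriv F)) u) (at u)"
      "(deriv (deriv G) has_real_derivative deriv (deriv (deriv G)) v) (at v)" "u \<noteq> v"
      using smooth_real_derivative[OF smooth(1) in_chart_eq(3)[OF c(1,2)], of 2]
        smooth_real_derivative[OF smooth(2) in_chart_eq(4)[OF c(1,2)], of 2] distinct[OF c(2)]
      by (simp_all add: eval_nat_numeral c(3,4))
  qed
  obtain k l A where q: "\<And>u v. (u, v) \<in> W \<Longrightarrow> deriv (deriv F) u = 12 * k * u^2 + 6 * l * u + 2 * A"
    "\<And>u v. (u, v) \<in> W \<Longrightarrow> deriv (deriv G) v = 12 * k * v^2 + 6 * l * v + 2 * A"
    by (rule affine_scalar_imp_quadratic[OF open_W connected_W W_nonempty D(3) D(1) D(2)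
          extremal_imp_affine(1)[OF ext] extremal_imp_affine(2)[OF ext]
          extremal_imp_affine(3)[OF ext] extremal_imp_affine(4)[OF ext]]) blast+
  have F2: "deriv (deriv F) t = 12 * k * t^2 + 6 * l * t + 2 * A" if "t \<in> \<xi> ` topspace X" for t
    using that q(1) unfolding W_def by blast
  have G2: "deriv (deriv G) t = 12 * k * t^2 + 6 * l * t + 2 * A" if "t \<in> \<eta> ` topspace X" for t
    using that q(2) unfolding W_def by blast
  have ne: "\<xi> ` topspace X \<noteq> {}" "\<eta> ` topspace X \<noteq> {}" using manifold(3) by auto
  obtain B1 C1 where F: "\<And>t. t \<in> \<xi> ` topspace X \<Longrightarrow> F t = k * t^4 + l * t^3 + A * t^2 + B1 * t + C1"
    by (rule quartic_of_second_derivative[OF convex_images(1) ne(1), of F "deriv F" "deriv (deriv F)" k l A])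
      (use smooth_real_derivative[OF smooth(1), of _ 0] smooth_real_derivative[OF smooth(1), of _ 1] F2 in auto)
  obtain B2 C2 where G: "\<And>t. t \<in> \<eta> ` topspace X \<Longrightarrow> G t = k * t^4 + l * t^3 + A * t^2 + B2 * t + C2"
    by (rule quartic_of_second_derivative[OF convex_images(2) ne(2), of G "deriv G" "deriv (deriv G)" k l A])
      (use smooth_real_derivative[OF smooth(2), of _ 0] smooth_real_derivative[OF smooth(2), of _ 1] G2 in auto)
  show ?thesis using F G unfolding quartic_form_def by blast
qed

lemma chart_quartic:
  assumes c: "c \<in> \<A>"
    and q: "quartic_form (\<xi> ` topspace X) (\<eta> ` topspace X) F G k l A B1 B2 C1 C2"
  shows "ot_quartic (cimg c) F (deriv F) (deriv (deriv F)) G (deriv G) (deriv (deriv G)) (g c) k l A B1 B2 C1 C2"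
proof -
  interpret ot_conformal "cimg c" F "deriv F" "deriv (deriv F)" G "deriv G" "deriv (deriv G)" "g c" "J c" "I c" "\<sigma> c" "gbar c"
    by (rule chart_geometry[OF c])
  have F: "F t = k * t^4 + l * t^3 + A * t^2 + B1 * t + C1" if "t \<in> \<xi> ` topspace X" for t
    using q that unfolding quartic_form_def by blast
  have G: "G t = k * t^4 + l * t^3 + A * t^2 + B2 * t + C2" if "t \<in> \<eta> ` topspace X" for t
    using q that unfolding quartic_form_def by blast
  have p1: "((\<lambda>t. k * t^4 + l * t^3 + A * t^2 + B * t + C) has_real_derivative 4 * k * t^3 + 3 * l * t^2 + 2 * A * t + B) (at t)"
    for B C t :: real
    by (rule DERIV_cong, (rule derivative_intros refl)+) simp
  have p2: "((\<lambda>t. 4 * k * t^3 + 3 * l * t^2 + 2 * A * t + B) has_real_derivative 12 * k * t^2 + 6 * l * t + 2 * A) (at t)"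
    for B t :: real
    by (rule DERIV_cong, (rule derivative_intros refl)+) simp
  have F1: "deriv F t = 4 * k * t^3 + 3 * l * t^2 + 2 * A * t + B1" if "t \<in> \<xi> ` topspace X" for t
    by (rule deriv_eq_on_open[OF open_images(1) that F p1])
  have G1: "deriv G t = 4 * k * t^3 + 3 * l * t^2 + 2 * A * t + B2" if "t \<in> \<eta> ` topspace X" for t
    by (rule deriv_eq_on_open[OF open_images(2) that G p1])
  have F2: "deriv (deriv F) t = 12 * k * t^2 + 6 * l * t + 2 * A" if "t \<in> \<xi> ` topspace X" for t
    by (rule deriv_eq_on_open[OF open_images(1) that F1 p2])
  have G2: "deriv (deriv G) t = 12 * k * t^2 + 6 * l * t + 2 * A" if "t \<in> \<eta> ` topspace X" for t
    by (rule deriv_eq_on_open[OF open_images(2) that G1 p2])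
  show ?thesis
    by unfold_locales (use in_chart_eq(3,4)[OF c] F F1 F2 G G1 G2 in blast)+
qed

lemma kaehler_gbar: "kaehler_surface \<A> (\<lambda>c x. - \<sigma> c x) gbar I"
proof -
  have orient: "orientation \<A> \<sigma>" and metric: "riemannian_metric \<A> g"
    using kaehler unfolding kaehler_surface_def by blast+
  have I: "almost_complex_structure \<A> I" "orthogonal_structure \<A> g I" "induces_orientation \<A> (\<lambda>c x. - \<sigma> c x) I"
    using opposite unfolding opposite_structure_def by blast+
  have geo: "ot_conformal (cimg c) F (deriv F) (deriv (deriv F)) G (deriv G) (deriv (deriv G)) (g c) (J c) (I c) (\<sigma> c) (gbar c)"
    if "c \<in> \<A>" for c by (rule chart_geometry[OF that])
  have gbar: "gbar c x = (1 / (x $ 1 - x $ 2)\<^sup>2) *\<^sub>R g c x" if "c \<in> \<A>" "x \<in> cimg c" for c x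
    unfolding gbar_def conformal_metric_def in_chart_eq(5)[OF that] ..
  have distinct: "x $ 1 \<noteq> x $ 2" if "c \<in> \<A>" "x \<in> cimg c" for c x
    using ot_conformal.axioms(1)[OF geo[OF that(1)], THEN ot_structures.axioms(1), THEN ot_geometry.axioms(1), THEN ot_chart.distinct] that(2)
    by blast
  have "orientation \<A> (\<lambda>c x. - \<sigma> c x)"
    using orient unfolding orientation_def by (auto intro!: continuous_intros)
  moreover have "riemannian_metric \<A> gbar"
    unfolding riemannian_metric_def bilinear_field_def
  proof (intro conjI ballI allI)
    fix c i j assume c: "c \<in> \<A>"
    have "smooth_on (cimg c) (\<lambda>x. 1 / (x $ 1 - x $ 2) ^ 2 * g c x $ i $ j)"
      using metric c distinct[OF c] unfolding riemannian_metric_def bilinear_field_def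
      by (intro smooth_on_mult smooth_on_inverse_power open_cimg) auto
    then show "smooth_on (cimg c) (\<lambda>x. gbar c x $ i $ j)"
      by (rule smooth_on_cong[OF open_cimg[OF c], rotated]) (simp add: gbar[OF c])
  next
    fix c e x assume c: "c \<in> \<A>" "e \<in> \<A>" and x: "x \<in> overlap c e"
    define D where "D = jacobian (transition c e) (at x)"
    obtain p where p: "p \<in> cdom c" "p \<in> cdom e" "x = cmap c p" using x unfolding overlap_def by blast
    have tr: "transition c e x = cmap e p"
      unfolding transition_def p(3) cinv_cmap[OF c(1) p(1)] ..
    have "g c x = transpose D ** g e (transition c e x) ** D"
      using metric c x unfolding riemannian_metric_def bilinear_field_def Let_def D_def by blast
    moreover have "gbar c x = (1 / (\<xi> p - \<eta> p)\<^sup>2) *\<^sub>R g c x" "gbar e (transition c e x) = (1 / (\<xi> p - \<eta> p)\<^sup>2) *\<^sub>R g e (transition c e x)"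
      unfolding tr unfolding p(3) using gbar[OF c(1), of "cmap c p"] gbar[OF c(2), of "cmap e p"] p
      by (simp_all add: coordinates(1,2)[OF c(1) p(1)] coordinates(1,2)[OF c(2) p(2)])
    moreover have "transpose D ** (r *\<^sub>R M) ** D = r *\<^sub>R (transpose D ** M ** D)" for r and M :: "real^4^4"
      by (simp add: vec_eq_iff matrix_matrix_mult_def sum_distrib_left sum_distrib_right mult_ac)
    ultimately show "let D = jacobian (transition c e) (at x) in gbar c x = transpose D ** gbar e (transition c e x) ** D"
      unfolding Let_def D_def[symmetric] by simp
  next
    fix c x assume c: "c \<in> \<A>" and x: "x \<in> cimg c"
    have sym: "transpose (g c x) = g c x" and pos: "v \<noteq> 0 \<Longrightarrow> v \<bullet> (g c x *v v) > 0" for v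
      using metric c x unfolding riemannian_metric_def by blast+
    show "transpose (gbar c x) = gbar c x"
      using sym unfolding gbar[OF c x] transpose_def vec_eq_iff by simp
    fix v :: "real^4" show "v \<noteq> 0 \<longrightarrow> 0 < v \<bullet> (gbar c x *v v)"
      using pos distinct[OF c x] unfolding gbar[OF c x]
      by (auto simp: scaleR_matrix_vector_assoc[symmetric] intro!: divide_pos_pos)
  qed
  moreover have "orthogonal_structure \<A> gbar I"
    unfolding orthogonal_structure_def
  proof (intro ballI)
    fix c x assume c: "c \<in> \<A>" "x \<in> cimg c"
    have "transpose D ** (r *\<^sub>R M) ** D = r *\<^sub>R (transpose D ** M ** D)" for r and M D :: "real^4^4"
      by (simp add: vec_eq_iff matrix_matrix_mult_def sum_distrib_left sum_distrib_right mult_ac)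
    moreover have "transpose (I c x) ** g c x ** I c x = g c x"
      using I(2) c unfolding orthogonal_structure_def by blast
    ultimately show "transpose (I c x) ** gbar c x ** I c x = gbar c x"
      unfolding gbar[OF c] by simp
  qed
  moreover have "nijenhuis (I c) i j k x = 0" "nabla_endo (gbar c) (I c) k i j x = 0" if c: "c \<in> \<A>" "x \<in> cimg c" for c x i j k
    by (rule ot_conformal.nijenhuis_I[OF geo[OF c(1)] c(2)], rule ot_conformal.nabla_I[OF geo[OF c(1)] c(2)])
  ultimately show ?thesis
    unfolding kaehler_surface_def using I by blast
qed

context
  fixes k l A B1 B2 C1 C2 :: real
  assumes q: "quartic_form (\<xi> ` topspace X) (\<eta> ` topspace X) F G k l A B1 B2 C1 C2"
begin

lemma nscal_eq: "c \<in> \<A> \<Longrightarrow> x \<in> cimg c \<Longrightarrow> nscal (g c) x = - 2 * k * (x $ 1 + x $ 2) - l"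
  using ot_quartic.nscal_quartic[OF chart_quartic[OF _ q]] by blast

lemma nscal_partials:
  assumes c: "c \<in> \<A>" and x: "x \<in> cimg c"
  shows "partial 1 (nscal (g c)) x = - 2 * k" "partial 2 (nscal (g c)) x = - 2 * k"
    "partial 3 (nscal (g c)) x = 0" "partial 4 (nscal (g c)) x = 0"
proof -
  have D: "((\<lambda>t. - 2 * k * (t + v) - l) has_real_derivative - 2 * k) (at u)"
    "((\<lambda>t. - 2 * k * (u + t) - l) has_real_derivative - 2 * k) (at v)" for u v :: real
    by (auto intro!: derivative_eq_intros)
  note pt = partial_two_variables[OF open_cimg[OF c] x, of "nscal (g c)" "\<lambda>u v. - 2 * k * (u + v) - l", OF nscal_eq[OF c]]
  show "partial 1 (nscal (g c)) x = - 2 * k" "partial 2 (nscal (g c)) x = - 2 * k"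
    "partial 3 (nscal (g c)) x = 0" "partial 4 (nscal (g c)) x = 0"
    by (rule pt(3)[OF _ D(1)] pt(4)[OF _ D(2)] pt(1) pt(2), assumption)+
qed

lemma extremal_of_quartic: "extremal \<A> g J"
  unfolding extremal_def killing_def
proof (intro ballI allI)
  fix c x i j assume c: "c \<in> \<A>" and x: "x \<in> cimg c"
  interpret ot_conformal "cimg c" F "deriv F" "deriv (deriv F)" G "deriv G" "deriv (deriv G)" "g c" "J c" "I c" "\<sigma> c" "gbar c"
    by (rule chart_geometry[OF c])
  show "lie_metric (ham_field (g c) (J c) (nscal (g c))) (g c) i j x = 0"
  proof (rule lie_metric_constant[OF open_U x, where v = "vector [0, 0, - 2 * k, 0]"
        and \<psi> = "\<lambda>i j u v. ot_metric F G (vector [u, v, 0, 0]) $ i $ j"])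
    fix y assume y: "y \<in> cimg c"
    show "g c y $ i $ j = ot_metric F G (vector [y $ 1, y $ 2, 0, 0]) $ i $ j" for i j
      unfolding g_eq[OF y] by (rule ot_metric_two_variables)
    note p = nscal_partials[OF c y]
    have "(u * t - v * t) / (u - v) = t" if "u \<noteq> v" for u v t :: real
      using that by (simp add: left_diff_distrib[symmetric])
    note e = this[OF distinct[OF y]]
    show "ham_field (g c) (J c) (nscal (g c)) y = vector [0, 0, - 2 * k, 0]"
      unfolding vec_eq_iff forall_4 ham_field_J[OF y p(3,4)] p(1,2) e by simp
  qed simp_all
qed

lemma nscal_gbar:
  assumes c: "c \<in> \<A>" and x: "x \<in> cimg c"
  shows "nscal (gbar c) x = - ((B1 - B2) * (x $ 1 + x $ 2) + 2 * (C1 - C2)) / (x $ 1 - x $ 2)"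
proof -
  interpret ot_conformal "cimg c" F "deriv F" "deriv (deriv F)" G "deriv G" "deriv (deriv G)" "g c" "J c" "I c" "\<sigma> c" "gbar c"
    by (rule chart_geometry[OF c])
  interpret Q: ot_quartic "cimg c" F "deriv F" "deriv (deriv F)" G "deriv G" "deriv (deriv G)" "g c" k l A B1 B2 C1 C2
    by (rule chart_quartic[OF c q])
  have "\<delta>^2 * (6 * \<delta> * (- 2 * k * t - l) / \<delta> + 6 * (2 * k * t + l - r / \<delta>^3)) / 6 = - r / \<delta>"
    if "\<delta> \<noteq> 0" for \<delta> t r :: real
    using that by (simp add: field_simps eval_nat_numeral)
  from this[OF d_nz[OF x]] show ?thesis
    unfolding nscal_def Scal_conformal[OF x] Q.quartic_invariants(1,2)[OF x] .
qed

lemma extremal_gbar: "extremal \<A> gbar I"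
  unfolding extremal_def killing_def
proof (intro ballI allI)
  fix c x i j assume c: "c \<in> \<A>" and x: "x \<in> cimg c"
  interpret ot_conformal "cimg c" F "deriv F" "deriv (deriv F)" G "deriv G" "deriv (deriv G)" "g c" "J c" "I c" "\<sigma> c" "gbar c"
    by (rule chart_geometry[OF c])
  define \<beta> \<kappa> where "\<beta> = B1 - B2" and "\<kappa> = 2 * (C1 - C2)"
  define S where "S u v = - (\<beta> * (u + v) + \<kappa>) / (u - v)" for u v :: real
  have S: "nscal (gbar c) y = S (y $ 1) (y $ 2)" if "y \<in> cimg c" for y
    unfolding S_def \<beta>_def \<kappa>_def by (rule nscal_gbar[OF c that])
  show "lie_metric (ham_field (gbar c) (I c) (nscal (gbar c))) (gbar c) i j x = 0"
  proof (rule lie_metric_constant[OF open_U x, where v = "vector [0, 0, \<kappa>, 2 * \<beta>]"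
        and \<psi> = "\<lambda>i j u v. 1 / (u - v)\<^sup>2 * ot_metric F G (vector [u, v, 0, 0]) $ i $ j"])
    fix y assume y: "y \<in> cimg c"
    show "gbar c y $ i $ j = 1 / (y $ 1 - y $ 2)\<^sup>2 * ot_metric F G (vector [y $ 1, y $ 2, 0, 0]) $ i $ j" for i j
      unfolding gc[OF y] g_eq[OF y] by (simp add: ot_metric_two_variables[of F G y])
    have D: "((\<lambda>t. S t v) has_real_derivative - \<beta> / (u - v) + (\<beta> * (u + v) + \<kappa>) / (u - v)^2) (at u)"
      "((\<lambda>t. S u t) has_real_derivative - \<beta> / (u - v) - (\<beta> * (u + v) + \<kappa>) / (u - v)^2) (at v)" if "u \<noteq> v" for u v
    proof -
      have nz: "u - v \<noteq> 0" using that by simp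
      show "((\<lambda>t. S t v) has_real_derivative - \<beta> / (u - v) + (\<beta> * (u + v) + \<kappa>) / (u - v)^2) (at u)"
        unfolding S_def by (rule DERIV_cong, (auto intro!: derivative_eq_intros simp: that)[1])
          (use nz in \<open>simp add: divide_simps\<close>, simp add: algebra_simps eval_nat_numeral)
      show "((\<lambda>t. S u t) has_real_derivative - \<beta> / (u - v) - (\<beta> * (u + v) + \<kappa>) / (u - v)^2) (at v)"
        unfolding S_def by (rule DERIV_cong, (auto intro!: derivative_eq_intros simp: that)[1])
          (use nz in \<open>simp add: divide_simps\<close>, simp add: algebra_simps eval_nat_numeral)
    qed
    note pt = partial_two_variables[OF open_U y, of "nscal (gbar c)" S, OF S]
    have p: "partial 3 (nscal (gbar c)) y = 0" "partial 4 (nscal (gbar c)) y = 0"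
      "partial 1 (nscal (gbar c)) y = - \<beta> / d y + (\<beta> * u y + \<kappa>) / (d y)^2"
      "partial 2 (nscal (gbar c)) y = - \<beta> / d y - (\<beta> * u y + \<kappa>) / (d y)^2"
      if "u = (\<lambda>y. y $ 1 + y $ 2)" for u
      unfolding that by (rule pt(1) pt(2) pt(3)[OF _ D(1)[OF distinct[OF y]]] pt(4)[OF _ D(2)[OF distinct[OF y]]], assumption)+
    have e: "\<delta> * ((v + \<delta>) * (- \<beta> / \<delta> + (\<beta> * (v + \<delta> + v) + \<kappa>) / \<delta>^2) + v * (- \<beta> / \<delta> - (\<beta> * (v + \<delta> + v) + \<kappa>) / \<delta>^2)) = \<kappa>"
      "- \<delta> * (- \<beta> / \<delta> + r / \<delta>^2 + (- \<beta> / \<delta> - r / \<delta>^2)) = 2 * \<beta>" if "\<delta> \<noteq> 0" for v \<delta> r :: real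
      using that by (simp_all add: divide_simps) (simp_all add: algebra_simps eval_nat_numeral)
    note e' = e(1)[OF d_nz[OF y], of "y $ 2", simplified diff_add_cancel add_diff_cancel_left' add.commute[of "y $ 2" "d y"]] e(2)[OF d_nz[OF y]]
    show "ham_field (gbar c) (I c) (nscal (gbar c)) y = vector [0, 0, \<kappa>, 2 * \<beta>]"
      unfolding vec_eq_iff forall_4 ham_field_I[OF y p(1,2)[OF refl]] p(3,4)[OF refl] e' by simp
  qed simp_all
qed

lemma bach_flat_iff: "bach_flat \<A> g \<longleftrightarrow> 4 * k * (C1 - C2) = (B1 - B2) * l"
proof -
  have *: "(\<forall>i j. bach (g c) i j x = 0) \<longleftrightarrow> 4 * k * (C1 - C2) = (B1 - B2) * l" if "c \<in> \<A>" "x \<in> cimg c" for c x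
    by (rule ot_quartic.bach_flat_at_iff[OF chart_quartic[OF that(1) q] that(2)])
  obtain p c where "c \<in> \<A>" "p \<in> cdom c" using manifold(3) chart_of_point by blast
  then have "c \<in> \<A>" "cmap c p \<in> cimg c" by auto
  then show ?thesis unfolding bach_flat_def using * by blast
qed

text \<open>The scalar curvature has \<open>\<xi>\<close>-derivative proportional to \<open>k\<close>, so a constant value forces \<open>k = 0\<close>.\<close>

lemma constant_nscal_imp:
  assumes "\<And>c x. c \<in> \<A> \<Longrightarrow> x \<in> cimg c \<Longrightarrow> Scal (g c) x = \<kappa>"
  shows "k = 0" "\<kappa> = - 6 * l"
proof -
  obtain p c where c: "c \<in> \<A>" "p \<in> cdom c" using manifold(3) chart_of_point by blast
  then have x: "cmap c p \<in> cimg c" by auto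
  have "partial 1 (nscal (g c)) (cmap c p) = partial 1 (\<lambda>y. \<kappa> / 6) (cmap c p)"
    by (rule partial_cong[OF open_cimg[OF c(1)] x]) (simp add: nscal_def assms[OF c(1)])
  also have "\<dots> = 0" by (rule has_partial_imp_partial[OF has_partial_const])
  finally show k: "k = 0" unfolding nscal_partials(1)[OF c(1) x] by simp
  show "\<kappa> = - 6 * l"
    using nscal_eq[OF c(1) x] assms[OF c(1) x] unfolding nscal_def by (simp add: k)
qed

lemma constant_scalar_curvature_iff: "constant_scalar_curvature \<A> g \<longleftrightarrow> k = 0"
proof
  assume "constant_scalar_curvature \<A> g"
  then obtain \<kappa> where "\<And>c x. c \<in> \<A> \<Longrightarrow> x \<in> cimg c \<Longrightarrow> Scal (g c) x = \<kappa>"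
    unfolding constant_scalar_curvature_def by blast
  then show "k = 0" by (rule constant_nscal_imp(1))
next
  assume k: "k = 0"
  have "Scal (g c) x = - 6 * l" if "c \<in> \<A>" "x \<in> cimg c" for c x
    using nscal_eq[OF that] unfolding nscal_def k by simp
  then show "constant_scalar_curvature \<A> g"
    unfolding constant_scalar_curvature_def by blast
qed

lemma scalar_flat_iff: "scalar_flat \<A> g \<longleftrightarrow> k = 0 \<and> l = 0"
proof
  assume "scalar_flat \<A> g"
  then have "Scal (g c) x = 0" if "c \<in> \<A>" "x \<in> cimg c" for c x
    using that unfolding scalar_flat_def by blast
  from constant_nscal_imp[OF this] show "k = 0 \<and> l = 0" by simp
next
  assume k: "k = 0 \<and> l = 0"
  have "Scal (g c) x = 0" if "c \<in> \<A>" "x \<in> cimg c" for c x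
    using nscal_eq[OF that] k unfolding nscal_def by simp
  then show "scalar_flat \<A> g" unfolding scalar_flat_def by blast
qed

end

lemma anti_selfdual_iff_scalar_flat: "anti_selfdual \<A> \<sigma> g \<longleftrightarrow> scalar_flat \<A> g"
proof -
  have "(\<forall>i j k l. weyl_plus (g c) (\<sigma> c) i j k l x = 0) \<longleftrightarrow> Scal (g c) x = 0" if "c \<in> \<A>" "x \<in> cimg c" for c x
    by (rule ot_structures.weyl_plus_at_iff[OF ot_conformal.axioms(1)[OF chart_geometry[OF that(1)]] that(2)])
  then show ?thesis unfolding anti_selfdual_def scalar_flat_def by blast
qed

end

theorem proposition10:
  fixes X :: "'a topology" and \<A> :: "'a chart set" and \<sigma> :: "'a chart \<Rightarrow> scalar"
    and g J I :: "'a chart \<Rightarrow> matfield" and \<xi> \<eta> :: "'a \<Rightarrow> real" and F G :: "real \<Rightarrow> real"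
  defines "M \<equiv> topspace X"
    and "g' \<equiv> conformal_metric (\<lambda>p. 1 / (\<xi> p - \<eta> p)\<^sup>2) g"
  assumes manifold: "smooth_manifold X \<A>" "connected_space X" "M \<noteq> {}"
    and kaehler: "kaehler_surface \<A> \<sigma> g J"
    and ortho_toric: "ortho_toric X \<A> g J \<xi> \<eta>"
    and smooth: "smooth_real_on (\<xi> ` M) F" "smooth_real_on (\<eta> ` M) G"
    and ansatz: "ortho_toric_form \<A> g J \<xi> \<eta> F G"
    and opposite: "opposite_structure \<A> \<sigma> g J \<xi> \<eta> I"
  shows "(extremal \<A> g J \<longleftrightarrow>
            (\<exists>k l A B\<^sub>1 B\<^sub>2 C\<^sub>1 C\<^sub>2. quartic_form (\<xi> ` M) (\<eta> ` M) F G k l A B\<^sub>1 B\<^sub>2 C\<^sub>1 C\<^sub>2)) \<and>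
         (\<forall>k l A B\<^sub>1 B\<^sub>2 C\<^sub>1 C\<^sub>2. quartic_form (\<xi> ` M) (\<eta> ` M) F G k l A B\<^sub>1 B\<^sub>2 C\<^sub>1 C\<^sub>2 \<longrightarrow>
            (\<forall>c\<in>\<A>. \<forall>p\<in>cdom c. nscal (g c) (cmap c p) = - 2 * k * (\<xi> p + \<eta> p) - l) \<and>
            kaehler_surface \<A> (\<lambda>c x. - \<sigma> c x) g' I \<and> extremal \<A> g' I \<and>
            (bach_flat \<A> g \<longleftrightarrow> 4 * k * (C\<^sub>1 - C\<^sub>2) = (B\<^sub>1 - B\<^sub>2) * l) \<and>
            (constant_scalar_curvature \<A> g \<longleftrightarrow> k = 0) \<and>
            (scalar_flat \<A> g \<longleftrightarrow> k = 0 \<and> l = 0) \<and>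
            (anti_selfdual \<A> \<sigma> g \<longleftrightarrow> k = 0 \<and> l = 0))"
proof -
  interpret S: ortho_toric_surface X \<A> \<sigma> g J I \<xi> \<eta> F G
    by unfold_locales (use manifold kaehler smooth ansatz opposite in \<open>simp_all add: M_def\<close>)
  have gbar: "g' = S.gbar"
    unfolding g'_def S.gbar_def ..
  have ext: "extremal \<A> g J \<longleftrightarrow>
      (\<exists>k l A B\<^sub>1 B\<^sub>2 C\<^sub>1 C\<^sub>2. quartic_form (\<xi> ` M) (\<eta> ` M) F G k l A B\<^sub>1 B\<^sub>2 C\<^sub>1 C\<^sub>2)"
    unfolding M_def using S.extremal_imp_quartic S.extremal_of_quartic by blast
  have "(\<forall>c\<in>\<A>. \<forall>p\<in>cdom c. nscal (g c) (cmap c p) = - 2 * k * (\<xi> p + \<eta> p) - l) \<and>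
      kaehler_surface \<A> (\<lambda>c x. - \<sigma> c x) g' I \<and> extremal \<A> g' I \<and>
      (bach_flat \<A> g \<longleftrightarrow> 4 * k * (C\<^sub>1 - C\<^sub>2) = (B\<^sub>1 - B\<^sub>2) * l) \<and>
      (constant_scalar_curvature \<A> g \<longleftrightarrow> k = 0) \<and>
      (scalar_flat \<A> g \<longleftrightarrow> k = 0 \<and> l = 0) \<and>
      (anti_selfdual \<A> \<sigma> g \<longleftrightarrow> k = 0 \<and> l = 0)"
    if "quartic_form (\<xi> ` M) (\<eta> ` M) F G k l A B\<^sub>1 B\<^sub>2 C\<^sub>1 C\<^sub>2" for k l A B\<^sub>1 B\<^sub>2 C\<^sub>1 C\<^sub>2
  proof -
    note q = that[unfolded M_def]
    have "nscal (g c) (cmap c p) = - 2 * k * (\<xi> p + \<eta> p) - l" if "c \<in> \<A>" "p \<in> cdom c" for c p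
      using S.nscal_eq[OF q that(1), of "cmap c p"] S.coordinates(1,2)[OF that] that(2) by simp
    then show ?thesis
      unfolding gbar S.anti_selfdual_iff_scalar_flat
      using S.kaehler_gbar S.extremal_gbar[OF q] S.bach_flat_iff[OF q]
        S.constant_scalar_curvature_iff[OF q] S.scalar_flat_iff[OF q] by blast
  qed
  with ext show ?thesis by blast
qed

end
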